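(* Let $1\le p,q\le\infty$ and $A\in GL(d,\mathbb{R})$. Then, for every $f\in W(\mathcal{F}L^p,L^q)(\mathbb{R}^d)$, $$\|f_A\|_{W(\mathcal{F}L^p,L^q)}\lesssim|\det A|^{1/p-1/q-1}\bigl(\det(I+A^*A)\bigr)^{1/2}\|f\|_{W(\mathcal{F}L^p,L^q)},$$ where the implied constant is independent of $A$ and $f$.
   Context: For $A\in GL(d,\mathbb{R})$, $f_A(t)=f(At)$ and $A^*$ is the transpose of $A$. Fourier transform: $\hat f(\xi)=\int_{\mathbb{R}^d} f(t)e^{-2\pi i t\cdot\xi}\,dt$; $T_xg(t)=g(t-x)$; $\|h\|_{\mathcal{F}L^p}=\|\hat h\|_{L^p}$. Wiener amalgam space: fix a window $g\in C_0^\infty(\mathbb{R}^d)$ with $\|g\|_{L^2}=1$. For $1\le p,q\le\infty$, $W(\mathcal{F}L^p,L^q)$ is the space of tempered distributions $f$ on $\mathbb{R}^d$ with $\|f\|_{W(\mathcal{F}L^p,L^q)}=\bigl\|\,\|f\,T_xg\|_{\mathcal{F}L^p}\bigr\|_{L^q_x}<\infty$. Different nonzero windows in $C_0^\infty$ (or in the Schwartz class) give equivalent norms. *)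

theory Defs
  imports "HOL-Analysis.Analysis" "HOL-Probability.Essential_Supremum"
begin

section \<open>Smooth, compactly supported and Schwartz functions\<close>

definition partial_deriv :: "'n::finite \<Rightarrow> (real^'n \<Rightarrow> complex) \<Rightarrow> real^'n \<Rightarrow> complex" where
  "partial_deriv i \<phi> = (\<lambda>x. frechet_derivative \<phi> (at x) (axis i 1))"

text \<open>A list of indices plays the role of a multi-index; for smooth functions the order of the
  list is irrelevant.\<close>

fun iter_deriv :: "'n::finite list \<Rightarrow> (real^'n \<Rightarrow> complex) \<Rightarrow> real^'n \<Rightarrow> complex" where
  "iter_deriv [] \<phi> = \<phi>"
| "iter_deriv (i # \<alpha>) \<phi> = partial_deriv i (iter_deriv \<alpha> \<phi>)"

definition smooth_fun :: "(real^'n::finite \<Rightarrow> complex) \<Rightarrow> bool" where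
  "smooth_fun \<phi> \<longleftrightarrow> (\<forall>\<alpha>. iter_deriv \<alpha> \<phi> differentiable_on UNIV)"

definition test_functions :: "(real^'n::finite \<Rightarrow> complex) set" where
  "test_functions = {\<phi>. smooth_fun \<phi> \<and> compact (closure {x. \<phi> x \<noteq> 0})}"

definition schwartz :: "(real^'n::finite \<Rightarrow> complex) set" where
  "schwartz = {\<phi>. smooth_fun \<phi> \<and>
     (\<forall>k \<alpha>. bounded (range (\<lambda>x. norm x ^ k * norm (iter_deriv \<alpha> \<phi> x))))}"

definition schwartz_seminorm :: "nat \<Rightarrow> 'n::finite list \<Rightarrow> (real^'n \<Rightarrow> complex) \<Rightarrow> real" where
  "schwartz_seminorm k \<alpha> \<phi> = (SUP x. norm x ^ k * norm (iter_deriv \<alpha> \<phi> x))"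

section \<open>Tempered distributions\<close>

text \<open>Functionals are total functions of which only the values on the Schwartz space matter. The
  pairing is bilinear, i.e. no complex conjugation is involved.\<close>

type_synonym 'n distr = "(real^'n \<Rightarrow> complex) \<Rightarrow> complex"

definition tempered_distr :: "'n::finite distr \<Rightarrow> bool" where
  "tempered_distr u \<longleftrightarrow>
     (\<forall>\<phi>\<in>schwartz. \<forall>\<psi>\<in>schwartz. u (\<lambda>x. \<phi> x + \<psi> x) = u \<phi> + u \<psi>) \<and>
     (\<forall>c. \<forall>\<phi>\<in>schwartz. u (\<lambda>x. c * \<phi> x) = c * u \<phi>) \<and>
     (\<exists>C N. \<forall>\<phi>\<in>schwartz.
        norm (u \<phi>) \<le> C * (\<Sum>k\<le>N. \<Sum>\<alpha>\<in>{\<alpha>. length \<alpha> \<le> N}. schwartz_seminorm k \<alpha> \<phi>))"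

definition translate :: "real^'n::finite \<Rightarrow> (real^'n \<Rightarrow> complex) \<Rightarrow> real^'n \<Rightarrow> complex" where
  "translate x g = (\<lambda>t. g (t - x))"

definition distr_mult :: "'n::finite distr \<Rightarrow> (real^'n \<Rightarrow> complex) \<Rightarrow> 'n distr" where
  "distr_mult u g = (\<lambda>\<phi>. u (\<lambda>t. g t * \<phi> t))"

text \<open>The extension of \<open>f \<mapsto> (\<lambda>t. f (A t))\<close> from functions to distributions, for invertible
  \<open>A\<close>; it is dictated by the change of variables
  \<open>\<integral> f (A t) \<phi> t dt = 1 / \<bar>det A\<bar> * \<integral> f s \<phi> (A\<inverse> s) ds\<close>.\<close>

definition distr_dilate :: "real^'n^'n::finite \<Rightarrow> 'n distr \<Rightarrow> 'n distr" where
  "distr_dilate A u = (\<lambda>\<phi>. complex_of_real (1 / \<bar>det A\<bar>) * u (\<lambda>t. \<phi> (matrix_inv A *v t)))"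

definition fourier :: "(real^'n::finite \<Rightarrow> complex) \<Rightarrow> real^'n \<Rightarrow> complex" where
  "fourier \<phi> \<xi> = (\<integral>t. \<phi> t * exp (- 2 * complex_of_real pi * \<i> * complex_of_real (t \<bullet> \<xi>)) \<partial>lborel)"

definition distr_fourier :: "'n::finite distr \<Rightarrow> 'n distr" where
  "distr_fourier u = (\<lambda>\<phi>. u (fourier \<phi>))"

section \<open>Lebesgue norms\<close>

text \<open>Only used for exponents \<open>r > 0\<close>.\<close>

definition ennreal_powr :: "ennreal \<Rightarrow> real \<Rightarrow> ennreal" where
  "ennreal_powr a r = (if a = \<infinity> then \<infinity> else ennreal (enn2real a powr r))"

definition Lp_norm :: "ennreal \<Rightarrow> (real^'n::finite \<Rightarrow> ennreal) \<Rightarrow> ennreal" where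
  "Lp_norm p F =
     (if p = \<infinity> then esssup lborel F
      else ennreal_powr (\<integral>\<^sup>+x. ennreal_powr (F x) (enn2real p) \<partial>lborel) (1 / enn2real p))"

definition represents :: "(real^'n::finite \<Rightarrow> complex) \<Rightarrow> 'n distr \<Rightarrow> bool" where
  "represents h u \<longleftrightarrow> h \<in> borel_measurable lborel \<and>
     (\<forall>\<phi>\<in>schwartz. integrable lborel (\<lambda>x. h x * \<phi> x) \<and> u \<phi> = (\<integral>x. h x * \<phi> x \<partial>lborel))"

text \<open>The function representing a distribution is unique almost everywhere, so the infimum
  ranges over at most one value; it is \<open>\<infinity>\<close> if the distribution is not a function.\<close>

definition distr_Lp_norm :: "ennreal \<Rightarrow> 'n::finite distr \<Rightarrow> ennreal" where
  "distr_Lp_norm p u = (INF h\<in>{h. represents h u}. Lp_norm p (\<lambda>x. ennreal (norm (h x))))"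

definition FLp_norm :: "ennreal \<Rightarrow> 'n::finite distr \<Rightarrow> ennreal" where
  "FLp_norm p u = distr_Lp_norm p (distr_fourier u)"

section \<open>Wiener amalgam spaces\<close>

definition amalgam_window :: "(real^'n::finite \<Rightarrow> complex) \<Rightarrow> bool" where
  "amalgam_window g \<longleftrightarrow> g \<in> test_functions \<and> Lp_norm 2 (\<lambda>t. ennreal (norm (g t))) = 1"

definition amalgam_norm ::
  "(real^'n::finite \<Rightarrow> complex) \<Rightarrow> ennreal \<Rightarrow> ennreal \<Rightarrow> 'n distr \<Rightarrow> ennreal" where
  "amalgam_norm g p q f = Lp_norm q (\<lambda>x. FLp_norm p (distr_mult f (translate x g)))"

definition amalgam_space ::
  "(real^'n::finite \<Rightarrow> complex) \<Rightarrow> ennreal \<Rightarrow> ennreal \<Rightarrow> 'n distr set" where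
  "amalgam_space g p q = {f. tempered_distr f \<and> amalgam_norm g p q f < \<infinity>}"

end

theory Submission
  imports Defs "HOL-Probability.Characteristic_Functions" "HOL-Probability.Sinc_Integral"
begin

text \<open>Dilating by \<open>A\<close> turns the window \<open>g\<close> into \<open>g \<circ> A\<inverse>\<close> and produces, by linear changes of
  variables in frequency and position, the factors \<open>\<bar>det A\<bar>\<close> to the powers \<open>1 / p - 1\<close> and
  \<open>-1 / q\<close>. It remains to replace the dilated window by \<open>g\<close>. Insert \<open>\<integral> \<bar>g (t - y)\<bar>\<^sup>2 dy = 1\<close>: this writes
  \<open>f T\<^sub>x (g \<circ> A\<inverse>)\<close> as an average over \<open>y\<close> of \<open>f T\<^sub>y g\<close> times the product of \<open>cnj (T\<^sub>y g)\<close> and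
  \<open>T\<^sub>x (g \<circ> A\<inverse>)\<close>. The Fourier transform of such a product has \<open>L\<^sup>1\<close> norm at most the square of that of
  \<open>g\<close>, uniformly in \<open>x\<close>, \<open>y\<close> and \<open>A\<close>, because this norm is invariant under invertible affine maps.
  Moreover only those \<open>y\<close> contribute for which \<open>y - x\<close> lies in \<open>A B + B\<close>, where \<open>B\<close> is a ball
  containing the support of \<open>g\<close>. By Minkowski's inequality the norm therefore grows at most by
  the volume of \<open>A B + B\<close>, which is of the order of \<open>det (I + A\<^sup>TA)\<close> to the power \<open>1 / 2\<close>.\<close>

section \<open>Linear changes of variables\<close>

text \<open>The obstacle is that \<open>f\<close> is only a distribution, so the average over y and
  the two Fourier expansions have to be carried through \<open>f\<close>. Tested on time-frequency
  shifts of one test function, \<open>f\<close> gives a continuous function of polynomial growth in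
  position and frequency, and for weights with enough moments \<open>f\<close> may be applied under
  the integral sign; after that only inequalities between nonnegative functions remain. The same
  interchange, with frequency as the sole parameter, shows that the Fourier transform of
  \<open>f\<close> times a window is a function. Its uniqueness almost everywhere, which makes the
  infimum in \<open>distr_Lp_norm\<close> its norm, is tested with mollifiers built from
  \<open>g\<close> times its conjugate, a test function whose integral is 1 because \<open>g\<close>
  is normalised in L2. Behind the volume factor stands Cauchy-Binet: det (I + A A^T) is the sum of
  the squared maximal minors of the block matrix [I A]. Only the bound of one squared minor by this
  sum is needed, since A B + B lies in a parallelepiped spanned by multiples of the columns of the
  largest minor.\<close>

lemma Basis_cart_prod:
  fixes l u :: "real^'n"
  shows "(\<Prod>b\<in>Basis. (u - l) \<bullet> b) = (\<Prod>i\<in>UNIV. u $ i - l $ i)"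
proof -
  have B: "(Basis :: (real^'n) set) = range (\<lambda>i. axis i 1)"
    by (auto simp: Basis_vec_def)
  show ?thesis
    unfolding B by (subst prod.reindex) (auto simp: inj_on_def axis_eq_axis inner_axis)
qed

lemma lborel_cart_eqI:
  fixes M :: "(real^'n) measure"
  assumes "\<And>l u. (\<And>i. l $ i \<le> u $ i) \<Longrightarrow> emeasure M (box l u) = ennreal (\<Prod>i\<in>UNIV. u $ i - l $ i)"
    and "sets M = sets borel"
  shows "lborel = M"
proof (rule lborel_eqI)
  fix l u :: "real^'n"
  assume le: "\<And>b. b \<in> Basis \<Longrightarrow> l \<bullet> b \<le> u \<bullet> b"
  have "l $ i \<le> u $ i" for i
    using le[of "axis i 1"] by (simp add: inner_axis)
  then show "emeasure M (box l u) = (\<Prod>b\<in>Basis. (u - l) \<bullet> b)"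
    using assms(1) by (simp only: Basis_cart_prod)
qed (rule assms(2))

lemma emeasure_box_cart:
  fixes l u :: "real^'n"
  assumes "\<And>i. l $ i \<le> u $ i"
  shows "emeasure lborel (box l u) = ennreal (\<Prod>i\<in>UNIV. u $ i - l $ i)"
proof -
  have "\<And>b. b \<in> Basis \<Longrightarrow> l \<bullet> b \<le> u \<bullet> b"
    using assms by (auto simp: Basis_vec_def inner_axis)
  then show ?thesis
    by (simp only: emeasure_lborel_box Basis_cart_prod)
qed

lemma measurable_matrix_mult [measurable]: "(\<lambda>x. A *v x) \<in> borel_measurable borel"
  for A :: "real^'n^'m"
  by (intro borel_measurable_continuous_onI linear_continuous_on) simp

lemma measure_shear_cbox:
  fixes a b :: "real^'n"
  assumes "m \<noteq> n"
  shows "(\<lambda>x. \<chi> i. if i = m then x$m + x$n else x$i) ` cbox a b \<in> lmeasurable" (is "?g ` _ \<in> _")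
    and "measure lebesgue ((\<lambda>x. \<chi> i. if i = m then x$m + x$n else x$i) ` cbox a b) = measure lebesgue (cbox a b)"
proof -
  have lin: "linear ?g"
    by (rule linearI) (auto simp: vec_eq_iff algebra_simps)
  then show "?g ` cbox a b \<in> lmeasurable"
    by (simp add: measurable_linear_image_interval)
  show "measure lebesgue (?g ` cbox a b) = measure lebesgue (cbox a b)"
  proof (cases "cbox a b = {}")
    case False
    \<comment> \<open>\<open>measure_shear_interval\<close> asks for a box whose \<open>n\<close>-th
      coordinates are nonnegative. Translating by \<open>v\<close> puts the lower face at 0, and
      both measures are translation invariant.\<close>
    define v :: "real^'n" where "v = - axis n (a $ n)"
    have tr: "cbox (v + a) (v + b) = (+) v ` cbox a b"
      by (simp add: cbox_translation)
    have "?g ` cbox (v + a) (v + b) = (+) (?g v) ` ?g ` cbox a b"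
      using linear_add[OF lin] by (simp add: tr image_image)
    then have "measure lebesgue (?g ` cbox (v + a) (v + b)) = measure lebesgue (?g ` cbox a b)"
      by (simp only: measure_translation)
    moreover have "measure lebesgue (?g ` cbox (v + a) (v + b)) = measure lebesgue (cbox (v + a) (v + b))"
      by (intro measure_shear_interval assms) (use False in \<open>auto simp: tr, simp add: v_def\<close>)
    moreover have "measure lebesgue (cbox (v + a) (v + b)) = measure lebesgue (cbox a b)"
      by (simp only: measure_translation tr)
    ultimately show ?thesis by simp
  qed simp
qed

lemma lborel_distr_shear:
  fixes m n :: "'n::finite"
  assumes "m \<noteq> n"
  shows "distr lborel borel (\<lambda>x::real^'n. \<chi> i. if i = m then x$m + x$n else x$i) = lborel" (is "distr _ _ ?g = _")
proof -
  define h where "h = (\<lambda>x::real^'n. \<chi> i. if i = m then x$m - x$n else x$i)"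
  have lin: "linear ?g" "linear h"
    unfolding h_def by (auto intro!: linearI simp: vec_eq_iff algebra_simps)
  have inv: "h (?g x) = x" "?g (h x) = x" for x
    using assms by (auto simp: h_def vec_eq_iff)
  have [measurable]: "h \<in> borel_measurable borel" "?g \<in> borel_measurable borel"
    using lin by (auto intro: borel_measurable_continuous_onI linear_continuous_on linear_conv_bounded_linear[THEN iffD1])
  \<comment> \<open>Preimages under the inverse shear \<open>h\<close> are images under the shear,
    which is the form of the preceding lemma. The invariance under \<open>h\<close> is then pushed
    forward by the shear.\<close>
  have "lborel = distr lborel borel h"
  proof (rule lborel_cart_eqI)
    fix l u :: "real^'n" assume le: "\<And>i. l $ i \<le> u $ i"
    have pre: "h -` box l u = ?g ` box l u"
      using inv by (auto simp: image_iff) (metis inv(2))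
    \<comment> \<open>The image formula is known for closed boxes, the characterisation of
      \<open>lborel\<close> uses open ones; they differ by the linear image of a null set.\<close>
    have "negligible (?g ` (cbox l u - box l u))"
      by (rule negligible_differentiable_image_negligible)
         (auto intro: linear_imp_differentiable_on lin negligible_frontier_interval)
    then have neg: "negligible ((?g ` cbox l u - ?g ` box l u) \<union> (?g ` box l u - ?g ` cbox l u))"
      by (rule negligible_subset) (use box_subset_cbox in fastforce)
    have "measure lebesgue (?g ` box l u) = measure lebesgue (?g ` cbox l u)" "?g ` box l u \<in> lmeasurable"
      using measure_negligible_symdiff[OF measure_shear_cbox(1)[OF assms] neg]
        lmeasurable_negligible_symdiff[OF measure_shear_cbox(1)[OF assms] neg] by auto
    then have *: "emeasure lebesgue (?g ` box l u) = ennreal (measure lebesgue (cbox l u))"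
      using measure_shear_cbox(2)[OF assms, of l u]
      by (simp add: emeasure_eq_measure2)
    have "emeasure (distr lborel borel h) (box l u) = emeasure lborel (?g ` box l u)"
      by (simp add: emeasure_distr pre)
    also have "\<dots> = emeasure lebesgue (?g ` box l u)"
      using measurable_sets[OF \<open>h \<in> borel_measurable borel\<close>, of "box l u"] by (simp add: pre)
    also have "\<dots> = ennreal (\<Prod>i\<in>UNIV. u $ i - l $ i)"
      using le by (auto simp: * content_cbox_if_cart interval_eq_empty_cart not_less[symmetric])
    finally show "emeasure (distr lborel borel h) (box l u) = ennreal (\<Prod>i\<in>UNIV. u $ i - l $ i)" .
  qed simp
  then have "distr lborel borel ?g = distr (distr lborel borel h) borel ?g"
    by simp
  also have "\<dots> = lborel"
    by (simp add: distr_distr o_def inv distr_id2)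
  finally show ?thesis .
qed

lemma lborel_distr_swap:
  fixes m n :: "'n::finite"
  shows "distr lborel borel (\<lambda>x::real^'n. \<chi> i. x $ Transposition.transpose m n i) = lborel" (is "distr _ _ ?g = _")
proof (rule lborel_cart_eqI[symmetric])
  fix l u :: "real^'n" assume le: "\<And>i. l $ i \<le> u $ i"
  have [measurable]: "?g \<in> borel_measurable borel"
    by (intro borel_measurable_continuous_onI continuous_intros)
  have "?g -` box l u = box (?g l) (?g u)"
  proof -
    have "(\<forall>i. l $ i < x $ Transposition.transpose m n i \<and> x $ Transposition.transpose m n i < u $ i) \<longleftrightarrow>
      (\<forall>i. l $ Transposition.transpose m n i < x $ i \<and> x $ i < u $ Transposition.transpose m n i)" for x
      by (metis transpose_involutory)
    then show ?thesis
      by (auto simp: mem_box_cart)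
  qed
  then have "emeasure (distr lborel borel ?g) (box l u) = emeasure lborel (box (?g l) (?g u))"
    by (simp add: emeasure_distr)
  also have "\<dots> = ennreal (\<Prod>i\<in>UNIV. u $ Transposition.transpose m n i - l $ Transposition.transpose m n i)"
    by (subst emeasure_box_cart) (auto simp: le)
  also have "(\<Prod>i\<in>UNIV. u $ Transposition.transpose m n i - l $ Transposition.transpose m n i) = (\<Prod>i\<in>UNIV. u $ i - l $ i)"
    by (rule prod.reindex_bij_betw[of "Transposition.transpose m n" UNIV UNIV "\<lambda>i. u $ i - l $ i"]) simp
  finally show "emeasure (distr lborel borel ?g) (box l u) = ennreal (\<Prod>i\<in>UNIV. u $ i - l $ i)" .
qed simp

text \<open>The formula is multiplicative in the matrix, so elementary factors suffice: diagonal
  matrices, coordinate swaps and shears. The guard on the determinant inside \<open>P\<close> makes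
  the case of a zero row vacuous, and in the product case it passes to both factors.\<close>

lemma nn_integral_lborel_matrix:
  fixes A :: "real^'n^'n" and f :: "real^'n \<Rightarrow> ennreal"
  assumes "det A \<noteq> 0" and "f \<in> borel_measurable borel"
  shows "(\<integral>\<^sup>+x. f x \<partial>lborel) = ennreal \<bar>det A\<bar> * (\<integral>\<^sup>+x. f (A *v x) \<partial>lborel)"
proof -
  define P where "P A \<longleftrightarrow> (det A \<noteq> 0 \<longrightarrow> (\<forall>f\<in>borel_measurable borel.
      (\<integral>\<^sup>+x. f x \<partial>lborel) = ennreal \<bar>det A\<bar> * (\<integral>\<^sup>+x. f (A *v x) \<partial>lborel)))" for A :: "real^'n^'n"
  have *: "P A" if "\<bar>det A\<bar> = 1" "distr lborel borel ((*v) A) = lborel" for A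
    unfolding P_def
  proof (intro impI ballI)
    fix f :: "real^'n \<Rightarrow> ennreal" assume [measurable]: "f \<in> borel_measurable borel"
    have "(\<integral>\<^sup>+x. f x \<partial>distr lborel borel ((*v) A)) = (\<integral>\<^sup>+x. f (A *v x) \<partial>lborel)"
      by (simp add: nn_integral_distr)
    then show "(\<integral>\<^sup>+x. f x \<partial>lborel) = ennreal \<bar>det A\<bar> * (\<integral>\<^sup>+x. f (A *v x) \<partial>lborel)"
      using that by simp
  qed
  have "P A"
  proof (induction A rule: induct_matrix_elementary_alt)
    case (1 A B)
    show ?case
      unfolding P_def
    proof (intro impI ballI)
      fix f :: "real^'n \<Rightarrow> ennreal" assume [measurable]: "f \<in> borel_measurable borel" and d: "det (A ** B) \<noteq> 0"
      have "(\<integral>\<^sup>+x. f x \<partial>lborel) = ennreal \<bar>det A\<bar> * (\<integral>\<^sup>+x. f (A *v x) \<partial>lborel)"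
        using 1(1)[unfolded P_def, rule_format, of f] d by (simp add: det_mul)
      also have "(\<integral>\<^sup>+x. f (A *v x) \<partial>lborel) = ennreal \<bar>det B\<bar> * (\<integral>\<^sup>+x. f (A *v (B *v x)) \<partial>lborel)"
        using 1(2)[unfolded P_def, rule_format, of "\<lambda>x. f (A *v x)"] d by (simp add: det_mul)
      finally show "(\<integral>\<^sup>+x. f x \<partial>lborel) = ennreal \<bar>det (A ** B)\<bar> * (\<integral>\<^sup>+x. f ((A ** B) *v x) \<partial>lborel)"
        by (simp add: det_mul abs_mult ennreal_mult mult.assoc matrix_vector_mul_assoc)
    qed
  next
    case (2 A i)
    then show ?case by (simp add: P_def det_zero_row)
  next
    case (3 A)
    show ?case
      unfolding P_def
    proof (intro impI ballI)
      fix f :: "real^'n \<Rightarrow> ennreal" assume [measurable]: "f \<in> borel_measurable borel" and d: "det A \<noteq> 0"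
      have det: "det A = (\<Prod>i\<in>UNIV. A $ i $ i)"
        by (rule det_diagonal) (use 3 in auto)
      \<comment> \<open>\<open>lborel_affine_euclidean\<close> indexes the scaling factors by basis
        vectors; the descriptions recover the coordinate \<open>i\<close> from
        \<open>axis i 1\<close>.\<close>
      define c where "c b = A $ (THE i. b = axis i 1) $ (THE i. b = axis i 1)" for b :: "real^'n"
      have c: "c (axis i 1) = A $ i $ i" for i
        by (simp add: c_def axis_eq_axis)
      have B: "(Basis :: (real^'n) set) = range (\<lambda>i. axis i 1)"
        by (auto simp: Basis_vec_def)
      have inj: "inj (\<lambda>i::'n. axis i (1::real))"
        by (auto simp: inj_on_def axis_eq_axis)
      have Ax': "(A *v x) $ i = A $ i $ i * x $ i" for x i
        by (simp add: matrix_vector_mult_def 3 comm_monoid_add_class.sum.remove[where x=i])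
      have Ax: "(\<Sum>j\<in>Basis. (c j * (x \<bullet> j)) *\<^sub>R j) = A *v x" for x
        unfolding B
        by (subst sum.reindex[OF inj]) (simp add: c inner_axis, simp add: vec_eq_iff Ax' axis_def if_distrib[of "\<lambda>y. _ * y"] cong: if_cong)
      have "lborel = density (distr lborel borel (\<lambda>x. 0 + (\<Sum>j\<in>Basis. (c j * (x \<bullet> j)) *\<^sub>R j))) (\<lambda>_. (\<Prod>j\<in>Basis. \<bar>c j\<bar>))"
        by (rule lborel_affine_euclidean) (use d in \<open>auto simp: B c det\<close>)
      also have "(\<Prod>j\<in>Basis. \<bar>c j\<bar>) = \<bar>det A\<bar>"
        by (simp add: B prod.reindex[OF inj] c det abs_prod)
      finally have "(\<integral>\<^sup>+x. f x \<partial>lborel) = (\<integral>\<^sup>+x. f x \<partial>density (distr lborel borel ((*v) A)) (\<lambda>_. \<bar>det A\<bar>))"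
        by (simp add: Ax)
      also have "\<dots> = ennreal \<bar>det A\<bar> * (\<integral>\<^sup>+x. f (A *v x) \<partial>lborel)"
        by (simp add: nn_integral_density nn_integral_distr nn_integral_cmult)
      finally show "(\<integral>\<^sup>+x. f x \<partial>lborel) = ennreal \<bar>det A\<bar> * (\<integral>\<^sup>+x. f (A *v x) \<partial>lborel)" .
    qed
  next
    case (4 m n)
    have "det (\<chi> i j. mat 1 $ i $ Transposition.transpose m n j :: real^'n^'n) = of_int (sign (Transposition.transpose m n)) * det (mat 1 :: real^'n^'n)"
      by (rule det_permute_columns) (simp add: permutes_swap_id)
    moreover have "(*v) (\<chi> i j. mat 1 $ i $ Transposition.transpose m n j) = (\<lambda>x::real^'n. \<chi> i. x $ Transposition.transpose m n i)"
    proof -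
      have *: "(if i = Transposition.transpose m n j then 1 else 0) * x $ j
          = (if j = Transposition.transpose m n i then x $ Transposition.transpose m n i else 0)" for x :: "real^'n" and i j
        by auto
      show ?thesis
        unfolding fun_eq_iff vec_eq_iff matrix_vector_mult_def mat_def vec_lambda_beta * by simp
    qed
    ultimately show ?case
      by (intro *) (auto simp: lborel_distr_swap sign_swap_id 4)
  next
    case (5 m n)
    have "(\<chi> i j. of_bool (i = m \<and> j = n \<or> i = j)) = (\<chi> i. if i = m then row m (mat 1) + 1 *s row n (mat 1) else row i (mat 1 :: real^'n^'n))"
      using 5 by (auto simp: vec_eq_iff row_def mat_def)
    then have "det (\<chi> i j. of_bool (i = m \<and> j = n \<or> i = j) :: real^'n^'n) = 1"
      using det_row_operation[OF 5, of "mat 1" 1] by simp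
    moreover have "(*v) (\<chi> i j. of_bool (i = m \<and> j = n \<or> i = j)) = (\<lambda>x::real^'n. \<chi> i. if i = m then x$m + x$n else x$i)"
    proof -
      have "of_bool (i = m \<and> j = n \<or> i = j) * x $ j = (if j = i then x $ i else 0) + (if i = m \<and> j = n then x $ n else 0)" for x :: "real^'n" and i j
        using 5 by auto
      then show ?thesis
        using 5 by (simp add: fun_eq_iff vec_eq_iff matrix_vector_mult_def sum.distrib)
    qed
    ultimately show ?case
      by (intro *) (auto simp: lborel_distr_shear 5)
  qed
  then show ?thesis
    using assms unfolding P_def by blast
qed


section \<open>The volume of the image of a ball plus a ball\<close>

lemma det_gram_pos:
  fixes A :: "real^'n^'n"
  shows "det (mat 1 + A ** transpose A) > 0"
proof (rule ccontr)
  \<comment> \<open>A homotopy from the identity, where the determinant is 1. If it were not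
    positive at the end, it would vanish somewhere, and a kernel vector there contradicts positive
    definiteness.\<close>
  let ?h = "\<lambda>t. det (mat 1 + t *\<^sub>R (A ** transpose A))"
  assume "\<not> ?thesis"
  moreover have "continuous_on {0..1} ?h"
    unfolding det_def by (intro continuous_intros)
  ultimately have "\<exists>t\<ge>0. t \<le> 1 \<and> ?h t = 0"
    by (intro IVT2') auto
  then obtain t where t: "t \<ge> 0" "?h t = 0" by auto
  then obtain x where x: "x \<noteq> 0" "(mat 1 + t *\<^sub>R (A ** transpose A)) *v x = 0"
    using invertible_det_nz[of "mat 1 + t *\<^sub>R (A ** transpose A)"]
    by (metis invertible_left_inverse matrix_left_invertible_ker)
  have "0 = x \<bullet> ((mat 1 + t *\<^sub>R (A ** transpose A)) *v x)"
    by (simp add: x)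
  also have "\<dots> = x \<bullet> x + t * ((transpose A *v x) \<bullet> (transpose A *v x))"
    by (simp add: matrix_vector_mult_add_rdistrib inner_right_distrib scaleR_matrix_vector_assoc[symmetric]
        matrix_vector_mul_assoc[symmetric] dot_lmul_matrix[symmetric])
  also have "\<dots> > 0"
    using x(1) t(1) by (intro add_pos_nonneg) auto
  finally show False by simp
qed

text \<open>The preimage of the unit ball under an expanding map lies in the unit ball, while its
  volume is that of the ball divided by the modulus of the determinant.\<close>

lemma det_ge_one_of_expanding:
  fixes T :: "real^'n^'n"
  assumes "\<And>x. norm x \<le> norm (T *v x)"
  shows "\<bar>det T\<bar> \<ge> 1"
proof -
  have "\<forall>x. T *v x = 0 \<longrightarrow> x = 0"
    using assms by (metis norm_le_zero_iff norm_zero)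
  then have d: "det T \<noteq> 0"
    by (simp add: invertible_det_nz[symmetric] invertible_left_inverse matrix_left_invertible_ker)
  let ?B = "cball (0::real^'n) 1"
  have "emeasure lborel ?B = ennreal \<bar>det T\<bar> * (\<integral>\<^sup>+x. indicator ?B (T *v x) \<partial>lborel)"
    by (subst nn_integral_lborel_matrix[OF d, symmetric]) (simp_all add: borel_measurable_indicator)
  also have "\<dots> \<le> ennreal \<bar>det T\<bar> * (\<integral>\<^sup>+x. indicator ?B x \<partial>lborel)"
    using assms by (intro mult_left_mono nn_integral_mono) (auto simp: indicator_def intro: order_trans)
  finally have "emeasure lborel ?B \<le> ennreal \<bar>det T\<bar> * emeasure lborel ?B"
    by simp
  moreover have "emeasure lborel ?B = ennreal (measure lborel ?B)"
    by (intro emeasure_eq_ennreal_measure) (use emeasure_lborel_cball_finite[of "0::real^'n" 1] in auto)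
  moreover have "measure lborel ?B > 0"
    using content_cball_pos[of 1 "0::real^'n"] by simp
  ultimately show ?thesis
    by (simp add: ennreal_mult[symmetric])
qed

text \<open>Among all choices of \<open>n\<close> columns of the block matrix \<open>[I A]\<close> take one with maximal
  determinant; by Cramer's rule every column of \<open>[I A]\<close> is then a combination of the chosen ones
  with coefficients in \<open>[-1,1]\<close>.\<close>

lemma maximal_minor:
  fixes A :: "real^'n^'n"
  obtains M :: "real^'n^'n" and B :: "real^'n^'n" and C :: "real^'n^'n"
  where "det M \<noteq> 0" "(det M)\<^sup>2 \<le> det (mat 1 + A ** transpose A)"
    "M ** B = mat 1" "M ** C = A" "\<And>i j. \<bar>B $ i $ j\<bar> \<le> 1" "\<And>i j. \<bar>C $ i $ j\<bar> \<le> 1"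
proof -
  \<comment> \<open>The sum type indexes the columns of [I A]: \<open>Inl\<close> those of the
    identity, \<open>Inr\<close> those of \<open>A\<close>. A selection may repeat columns, which
    only makes its determinant 0.\<close>
  define col :: "'n + 'n \<Rightarrow> real^'n" where "col k = (case k of Inl i \<Rightarrow> axis i 1 | Inr i \<Rightarrow> column i A)" for k
  define M where "M \<sigma> = (\<chi> i j. col (\<sigma> j) $ i)" for \<sigma> :: "'n \<Rightarrow> 'n + 'n"
  have "\<exists>\<sigma>. \<forall>\<tau>. \<bar>det (M \<tau>)\<bar> \<le> \<bar>det (M \<sigma>)\<bar>"
  proof -
    let ?S = "range (\<lambda>\<tau>. \<bar>det (M \<tau>)\<bar>)"
    have "Max ?S \<in> ?S" by (intro Max_in) auto
    then obtain \<sigma> where "Max ?S = \<bar>det (M \<sigma>)\<bar>" by (rule imageE)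
    moreover have "\<bar>det (M \<tau>)\<bar> \<le> Max ?S" for \<tau> by (intro Max_ge) auto
    ultimately show ?thesis by metis
  qed
  then obtain \<sigma> where max: "\<And>\<tau>. \<bar>det (M \<tau>)\<bar> \<le> \<bar>det (M \<sigma>)\<bar>" by auto
  \<comment> \<open>Selecting the identity block gives determinant 1, so the maximum is at least 1
    and Cramer's rule may divide by it.\<close>
  have "M Inl = mat 1"
    by (simp add: M_def col_def vec_eq_iff axis_def mat_def)
  with max[of Inl] have d: "det (M \<sigma>) \<noteq> 0" by auto
  define w where "w c = (\<chi> k. det (\<chi> i j. if j = k then c $ i else M \<sigma> $ i $ j) / det (M \<sigma>))" for c
  have Mw: "M \<sigma> *v w c = c" for c
    unfolding w_def using cramer[OF d] by blast
  have wle: "\<bar>w (col k) $ j\<bar> \<le> 1" for k j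
  proof -
    \<comment> \<open>The numerator in Cramer's rule is again the determinant of a selection, hence
      at most the maximum; this is where the bound 1 on the coefficients comes from.\<close>
    have "(\<chi> i j'. if j' = j then col k $ i else M \<sigma> $ i $ j') = M (\<sigma>(j := k))"
      by (simp add: M_def vec_eq_iff)
    then show ?thesis
      using max[of "\<sigma>(j := k)"] d by (simp add: w_def)
  qed
  define B where "B = (\<chi> i j. w (col (Inl j)) $ i)"
  define C where "C = (\<chi> i j. w (col (Inr j)) $ i)"
  have MB: "M \<sigma> ** B = mat 1"
    using Mw[of "col (Inl _)"]
    by (simp add: B_def vec_eq_iff matrix_matrix_mult_def matrix_vector_mult_def col_def axis_def mat_def)
  then have BM: "B ** M \<sigma> = mat 1"
    by (simp add: matrix_left_right_inverse)
  have MC: "M \<sigma> ** C = A"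
    using Mw[of "col (Inr _)"]
    by (simp add: C_def vec_eq_iff matrix_matrix_mult_def matrix_vector_mult_def col_def column_def)
  let ?P = "mat 1 + A ** transpose A"
  \<comment> \<open>\<open>?P\<close> is the sum of c c^T over all columns c of [I A], and the
    selected ones contribute M M^T to it. Conjugating by \<open>B\<close>, the inverse of the
    selected matrix, gives a \<open>T\<close> that dominates the identity, so its determinant is at
    least 1; this is the comparison of the squared minor with det \<open>?P\<close>.\<close>
  define T where "T = B ** ?P ** transpose B"
  have inj: "inj \<sigma>"
  proof (rule injI, rule ccontr)
    fix i j assume "\<sigma> i = \<sigma> j" "i \<noteq> j"
    then have "det (M \<sigma>) = 0"
      by (intro det_identical_columns[of i j]) (auto simp: M_def column_def)
    with d show False by simp
  qed
  have quad: "x \<bullet> (?P *v x) = (\<Sum>k\<in>UNIV. (col k \<bullet> x)\<^sup>2)" for x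
  proof -
    have "(transpose A *v x) $ i = column i A \<bullet> x" for i
      by (simp add: matrix_vector_mult_def transpose_def column_def inner_vec_def)
    then have "(transpose A *v x) \<bullet> (transpose A *v x) = (\<Sum>i\<in>UNIV. (column i A \<bullet> x)\<^sup>2)"
      by (simp add: inner_vec_def power2_eq_square)
    moreover have "x \<bullet> x = (\<Sum>i\<in>UNIV. (axis i 1 \<bullet> x)\<^sup>2)"
      by (simp add: inner_vec_def[of x x] power2_eq_square inner_axis')
    moreover have "x \<bullet> (?P *v x) = x \<bullet> x + (transpose A *v x) \<bullet> (transpose A *v x)"
      by (simp add: matrix_vector_mult_add_rdistrib inner_right_distrib
          matrix_vector_mul_assoc[symmetric] dot_lmul_matrix[symmetric])
    moreover have "(\<Sum>k\<in>UNIV. (col k \<bullet> x)\<^sup>2) = (\<Sum>i\<in>UNIV. (axis i 1 \<bullet> x)\<^sup>2) + (\<Sum>i\<in>UNIV. (column i A \<bullet> x)\<^sup>2)"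
      unfolding UNIV_sum by (subst sum.union_disjoint) (auto simp: sum.reindex col_def)
    ultimately show ?thesis by simp
  qed
  have "norm x \<le> norm (T *v x)" for x
  proof -
    define z where "z = transpose B *v x"
    have "transpose (M \<sigma>) *v z = x"
      using BM by (simp add: z_def matrix_vector_mul_assoc matrix_transpose_mul[symmetric] del: transpose_matrix_vector)
    then have "x $ j = col (\<sigma> j) \<bullet> z" for j
      by (auto simp: vec_eq_iff M_def transpose_def matrix_vector_mult_def inner_vec_def)
    then have "x \<bullet> x = (\<Sum>j\<in>UNIV. (col (\<sigma> j) \<bullet> z)\<^sup>2)"
      by (simp add: inner_vec_def[of x x] power2_eq_square)
    also have "\<dots> = (\<Sum>k\<in>range \<sigma>. (col k \<bullet> z)\<^sup>2)"
      by (simp add: sum.reindex[OF inj])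
    also have "\<dots> \<le> (\<Sum>k\<in>UNIV. (col k \<bullet> z)\<^sup>2)"
      by (intro sum_mono2) auto
    also have "\<dots> = x \<bullet> (T *v x)"
      unfolding quad[symmetric] by (simp add: T_def z_def matrix_vector_mul_assoc[symmetric] dot_lmul_matrix[symmetric])
    also have "\<dots> \<le> norm x * norm (T *v x)"
      by (rule norm_cauchy_schwarz)
    finally have "norm x * norm x \<le> norm x * norm (T *v x)"
      by (simp add: dot_square_norm power2_eq_square)
    then show ?thesis
      by (cases "x = 0") auto
  qed
  then have "1 \<le> \<bar>det T\<bar>"
    by (rule det_ge_one_of_expanding)
  moreover have "det (M \<sigma>) * det B = 1"
    using MB by (metis det_I det_mul)
  then have "(det (M \<sigma>))\<^sup>2 * det T = det ?P"
    by (simp add: T_def det_mul power2_eq_square) algebra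
  ultimately have "(det (M \<sigma>))\<^sup>2 \<le> \<bar>det ?P\<bar>"
    by (metis abs_mult abs_of_nonneg mult_left_mono mult.right_neutral zero_le_power2)
  then have "(det (M \<sigma>))\<^sup>2 \<le> det ?P"
    using det_gram_pos[of A] by simp
  then show ?thesis
    using that[of "M \<sigma>" B C] d MB MC wle by (simp add: B_def C_def)
qed

text \<open>With A = M C and I = M B one has A u + v = M (C u + B v), and bounded entries of
  \<open>B\<close> and \<open>C\<close> keep the argument of \<open>M\<close> in a cube whose size
  does not depend on \<open>A\<close>. All dependence on \<open>A\<close> is thus in det
  \<open>M\<close>.\<close>

lemma emeasure_linear_image_plus_ball:
  fixes A :: "real^'n^'n" and R :: real
  assumes "invertible A" "0 \<le> R"
  shows "emeasure lborel {A *v u + v | u v. u \<in> cball 0 R \<and> v \<in> cball 0 R}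
    \<le> ennreal ((4 * CARD('n) * R) ^ CARD('n) * sqrt (det (mat 1 + transpose A ** A)))"
proof -
  obtain M B C :: "real^'n^'n" where d: "det M \<noteq> 0" and det: "(det M)\<^sup>2 \<le> det (mat 1 + A ** transpose A)"
    and MB: "M ** B = mat 1" and MC: "M ** C = A"
    and le: "\<And>i j. \<bar>B $ i $ j\<bar> \<le> 1" "\<And>i j. \<bar>C $ i $ j\<bar> \<le> 1"
    using maximal_minor[of A] by metis
  \<comment> \<open>Each coordinate of \<open>C u\<close> and of \<open>B v\<close> is a sum of
    CARD('n) terms bounded by \<open>R\<close>. The two together give this half side, hence side 4
    CARD('n) R.\<close>
  define c :: "real^'n" where "c = (\<chi> i. 2 * (CARD('n) * R))"
  have comp: "\<bar>(D *v u) $ i\<bar> \<le> CARD('n) * R" if "\<And>i j. \<bar>D $ i $ j\<bar> \<le> 1" "u \<in> cball 0 R" for D :: "real^'n^'n" and u i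
  proof -
    have "\<bar>(D *v u) $ i\<bar> \<le> (\<Sum>j\<in>UNIV. \<bar>D $ i $ j * u $ j\<bar>)"
      by (simp add: matrix_vector_mult_def sum_abs)
    also have "\<dots> \<le> (\<Sum>j\<in>(UNIV::'n set). 1 * R)"
      using that component_le_norm_cart[of u] unfolding abs_mult
      by (intro sum_mono mult_mono) (auto intro: order_trans)
    finally show ?thesis by simp
  qed
  let ?K = "(*v) M ` cbox (- c) c"
  have "{A *v u + v | u v. u \<in> cball 0 R \<and> v \<in> cball 0 R} \<subseteq> ?K"
  proof safe
    fix u v :: "real^'n" assume u: "u \<in> cball 0 R" and v: "v \<in> cball 0 R"
    have "A *v u + v = M *v (C *v u + B *v v)"
      by (simp add: matrix_vector_right_distrib matrix_vector_mul_assoc MC MB)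
    moreover have "C *v u + B *v v \<in> cbox (- c) c"
    proof -
      have "\<bar>(C *v u) $ i + (B *v v) $ i\<bar> \<le> 2 * (CARD('n) * R)" for i
        using comp[OF le(2) u, of i] comp[OF le(1) v, of i] by linarith
      then show ?thesis
        by (auto simp: mem_box_cart c_def abs_le_iff) (metis minus_le_iff minus_add_distrib add.commute uminus_add_conv_diff)
    qed
    ultimately show "A *v u + v \<in> ?K" by auto
  qed
  moreover have K: "compact ?K"
    by (intro compact_continuous_image linear_continuous_on) auto
  ultimately have "emeasure lborel {A *v u + v | u v. u \<in> cball 0 R \<and> v \<in> cball 0 R} \<le> emeasure lborel ?K"
    by (intro emeasure_mono) (auto intro: borel_compact)
  also have "\<dots> = (\<integral>\<^sup>+x. indicator ?K x \<partial>lborel)"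
    using K by (simp add: borel_compact)
  also have "\<dots> = ennreal \<bar>det M\<bar> * (\<integral>\<^sup>+x. indicator ?K (M *v x) \<partial>lborel)"
    by (intro nn_integral_lborel_matrix d borel_measurable_indicator borel_compact K)
  also have "(\<lambda>x. indicator ?K (M *v x) :: ennreal) = indicator (cbox (- c) c)"
  proof -
    have "inj ((*v) M)"
      using d by (simp add: inj_matrix_vector_mult invertible_det_nz)
    then show ?thesis
      by (auto simp: indicator_def inj_image_mem_iff fun_eq_iff)
  qed
  also have "(\<integral>\<^sup>+x. indicator (cbox (- c) c) x \<partial>lborel) = ennreal ((4 * CARD('n) * R) ^ CARD('n))"
  proof -
    have "cbox (- c) c \<noteq> {}" using assms(2) by (auto simp: interval_eq_empty_cart c_def not_less)
    then have "measure lborel (cbox (- c) c) = (4 * CARD('n) * R) ^ CARD('n)"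
      by (simp add: content_cbox_cart c_def power_mult_distrib)
    moreover have "emeasure lborel (cbox (- c) c) = ennreal (measure lborel (cbox (- c) c))"
      by (intro emeasure_eq_ennreal_measure) (use emeasure_lborel_cbox_finite[of "-c" c] in auto)
    ultimately show ?thesis by simp
  qed
  also have "ennreal \<bar>det M\<bar> * ennreal ((4 * CARD('n) * R) ^ CARD('n))
      \<le> ennreal (sqrt (det (mat 1 + A ** transpose A))) * ennreal ((4 * CARD('n) * R) ^ CARD('n))"
    using real_le_rsqrt[OF det] real_sqrt_le_mono[OF det] by (intro mult_right_mono ennreal_leI) auto
  \<comment> \<open>Since A (I + A^T A) = (I + A A^T) A, the two determinants agree after cancelling
    det \<open>A\<close>.\<close>
  also have "det (mat 1 + A ** transpose A) = det (mat 1 + transpose A ** A)"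
  proof -
    have "(B + C) ** A = B ** A + C ** A" for B C :: "real^'n^'n"
      by (simp add: matrix_matrix_mult_def vec_eq_iff sum.distrib distrib_right)
    then have "A ** (mat 1 + transpose A ** A) = (mat 1 + A ** transpose A) ** A"
      by (simp add: matrix_add_ldistrib matrix_mul_assoc)
    then have "det A * det (mat 1 + transpose A ** A) = det (mat 1 + A ** transpose A) * det A"
      by (metis det_mul)
    moreover have "det A \<noteq> 0" using assms(1) by (simp add: invertible_det_nz)
    ultimately show ?thesis by simp
  qed
  finally show ?thesis
    using assms(2) by (subst ennreal_mult') (simp_all add: mult.commute)
qed


section \<open>Lebesgue norms\<close>

lemma ennreal_powr_top [simp]: "ennreal_powr top r = top"
  by (simp add: ennreal_powr_def)

lemma ennreal_powr_ennreal [simp]: "0 \<le> a \<Longrightarrow> ennreal_powr (ennreal a) r = ennreal (a powr r)"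
  by (simp add: ennreal_powr_def)

lemma ennreal_powr_0 [simp]: "ennreal_powr 0 r = 0"
  by (simp add: ennreal_powr_def)

lemma ennreal_powr_eq_0_iff [simp]: "ennreal_powr a r = 0 \<longleftrightarrow> a = 0"
  by (cases a) (auto simp: ennreal_powr_def)

lemma ennreal_powr_1 [simp]: "ennreal_powr a 1 = a"
  by (cases a) auto

lemma measurable_ennreal_powr [measurable (raw)]:
  assumes [measurable]: "f \<in> borel_measurable M"
  shows "(\<lambda>x. ennreal_powr (f x) r) \<in> borel_measurable M"
  unfolding ennreal_powr_def by measurable

lemma ennreal_powr_mono: "a \<le> b \<Longrightarrow> 0 \<le> r \<Longrightarrow> ennreal_powr a r \<le> ennreal_powr b r"
  by (cases a; cases b) (auto simp: top_unique intro!: ennreal_leI powr_mono2)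

lemma ennreal_powr_mult: "0 < r \<Longrightarrow> ennreal_powr (a * b) r = ennreal_powr a r * ennreal_powr b r"
  by (cases a; cases b) (auto simp: ennreal_mult[symmetric] powr_mult ennreal_mult_top ennreal_top_mult)

lemma ennreal_powr_powr: "ennreal_powr (ennreal_powr a r) s = ennreal_powr a (r * s)"
  by (cases a) (auto simp: powr_powr)

lemma ennreal_powr_inverse [simp]:
  assumes "0 < r"
  shows "ennreal_powr (ennreal_powr a r) (1 / r) = a" "ennreal_powr (ennreal_powr a (1 / r)) r = a"
  using assms by (simp_all add: ennreal_powr_powr)

text \<open>The graph of the convex function x^r lies above its tangent at \<open>c\<close>. This is
  Young's inequality for the numbers a^r and c^r with weights 1/r and 1 - 1/r.\<close>

lemma powr_tangent_le:
  fixes a c r :: real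
  assumes "0 \<le> a" "0 < c" "1 \<le> r"
  shows "r * c powr (r - 1) * a \<le> a powr r + (r - 1) * c powr r"
proof (cases "a = 0")
  case False
  then have "(a powr r) powr (1 / r) * (c powr r) powr (1 - 1 / r)
      \<le> 1 / r * a powr r + (1 - 1 / r) * c powr r"
    using assms by (intro Youngs_inequality_0) auto
  moreover have "(a powr r) powr (1 / r) = a" "(c powr r) powr (1 - 1 / r) = c powr (r - 1)"
    using assms False by (simp_all add: powr_powr algebra_simps)
  ultimately have "r * (a * c powr (r - 1)) \<le> r * (1 / r * a powr r + (1 - 1 / r) * c powr r)"
    using assms by (intro mult_left_mono) auto
  also have "\<dots> = a powr r + (r - 1) * c powr r"
    using assms by (simp add: field_simps)
  finally show ?thesis by (simp add: algebra_simps)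
qed (use assms in auto)

text \<open>The tangent inequality at h / N, multiplied by the weight \<open>N\<close>. If
  \<open>N\<close> vanishes, so does \<open>h\<close>, and both sides are 0; if \<open>h\<close> is
  infinite with finite positive \<open>N\<close>, the right side is infinite.\<close>

lemma ennreal_tangent_le:
  fixes h N :: ennreal and c r :: real
  assumes "N = 0 \<Longrightarrow> h = 0" "N < top" "0 < c" "1 \<le> r"
  shows "ennreal (r * c powr (r - 1)) * h \<le> N * ennreal_powr (h / N) r + ennreal ((r - 1) * c powr r) * N"
proof (cases "N = 0 \<or> h = top")
  case True
  then show ?thesis
    using assms by (auto simp: ennreal_divide_self ennreal_top_divide ennreal_mult_top)
next
  case False
  then obtain n k where nk: "N = ennreal n" "n > 0" "h = ennreal k" "k \<ge> 0"
    using assms(2) by (cases N; cases h) (auto simp: less_le)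
  have "n * (r * c powr (r - 1) * (k / n)) \<le> n * ((k / n) powr r + (r - 1) * c powr r)"
    using nk assms by (intro mult_left_mono powr_tangent_le) auto
  then have "ennreal (r * c powr (r - 1) * k) \<le> ennreal (n * (k / n) powr r + (r - 1) * c powr r * n)"
    using nk by (intro ennreal_leI) (simp add: field_simps)
  then show ?thesis
    using nk assms by (simp add: divide_ennreal ennreal_mult'[symmetric] ennreal_plus[symmetric] del: ennreal_plus)
qed

text \<open>Jensen's inequality for the probability density \<open>N / S\<close>, obtained by integrating the tangent
  line inequality at \<open>c = (\<integral> h) / S\<close>.\<close>

lemma nn_integral_powr_le:
  fixes h N :: "'a \<Rightarrow> ennreal"
  assumes [measurable]: "h \<in> borel_measurable M" "N \<in> borel_measurable M"
    and "1 \<le> r" and S: "0 < (\<integral>\<^sup>+y. N y \<partial>M)" "(\<integral>\<^sup>+y. N y \<partial>M) < top"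
    and zero: "AE y in M. N y = 0 \<longrightarrow> h y = 0"
  shows "ennreal_powr (\<integral>\<^sup>+y. h y \<partial>M) r
    \<le> ennreal_powr (\<integral>\<^sup>+y. N y \<partial>M) (r - 1) * (\<integral>\<^sup>+y. N y * ennreal_powr (h y / N y) r \<partial>M)"
    (is "ennreal_powr ?I r \<le> ennreal_powr ?S (r - 1) * ?J")
proof -
  have fin: "AE y in M. N y < top"
    using nn_integral_noteq_infinite[of N M] S(2) by (auto simp: less_top)
  have key: "ennreal (r * c powr (r - 1)) * ?I \<le> ?J + ennreal ((r - 1) * c powr r) * ?S" if "c > 0" for c
  proof -
    have "ennreal (r * c powr (r - 1)) * ?I = (\<integral>\<^sup>+y. ennreal (r * c powr (r - 1)) * h y \<partial>M)"
      by (simp add: nn_integral_cmult)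
    also have "\<dots> \<le> (\<integral>\<^sup>+y. N y * ennreal_powr (h y / N y) r + ennreal ((r - 1) * c powr r) * N y \<partial>M)"
      by (rule nn_integral_mono_AE) (use zero fin in eventually_elim, use that assms in \<open>auto intro!: ennreal_tangent_le\<close>)
    also have "\<dots> = ?J + ennreal ((r - 1) * c powr r) * ?S"
      by (simp add: nn_integral_add nn_integral_cmult)
    finally show ?thesis .
  qed
  obtain s where s: "?S = ennreal s" "s > 0"
    using S by (cases ?S) auto
  show ?thesis
  proof (cases "?J = top \<or> ?I = 0")
    case True
    then show ?thesis using s by (auto simp: ennreal_mult_top)
  next
    case False
    then obtain j where j: "?J = ennreal j" "j \<ge> 0"
      by (cases ?J) auto
    \<comment> \<open>The tangent at 1 serves only to show that the integral of \<open>h\<close> is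
      finite; otherwise the optimal point c = i / s could not be formed.\<close>
    have "ennreal r * ?I \<le> ennreal (j + (r - 1) * s)"
      using key[of 1] j s assms(3) by (simp add: ennreal_mult'[symmetric] ennreal_plus[symmetric] del: ennreal_plus)
    then have "?I \<noteq> top"
      using assms(3) by (auto simp: ennreal_mult_top top_unique)
    then obtain i where i: "?I = ennreal i" "i > 0"
      using assms(3) False by (cases ?I) (auto simp: ennreal_mult_top less_le)
    define c where "c = i / s"
    have c: "c > 0" "i = c * s" using i s by (auto simp: c_def)
    have "r * c powr (r - 1) * i \<le> j + (r - 1) * c powr r * s"
      using key[OF c(1)] assms(3) i j s
      by (simp add: ennreal_mult'[symmetric] ennreal_plus[symmetric] del: ennreal_plus)
    moreover have "c powr (r - 1) * i = c powr r * s"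
      using c by (simp add: powr_diff)
    then have "r * c powr (r - 1) * i = r * (c powr r * s)"
      by simp
    moreover have "(r - 1) * c powr r * s = r * (c powr r * s) - c powr r * s"
      by (simp add: algebra_simps)
    ultimately have "c powr r * s \<le> j"
      by linarith
    then have "s powr (r - 1) * (c powr r * s) \<le> s powr (r - 1) * j"
      by (intro mult_left_mono) auto
    moreover have "s powr (r - 1) * (c powr r * s) = i powr r"
      using c s by (simp add: powr_mult powr_diff)
    ultimately show ?thesis
      using i j s by (simp add: ennreal_mult[symmetric])
  qed
qed

section \<open>Lebesgue norms and Minkowski's integral inequality\<close>

lemma Lp_norm_finite:
  "p \<noteq> \<infinity> \<Longrightarrow> Lp_norm p F = ennreal_powr (\<integral>\<^sup>+x. ennreal_powr (F x) (enn2real p) \<partial>lborel) (1 / enn2real p)"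
  by (simp add: Lp_norm_def)

lemma one_le_enn2real: "1 \<le> p \<Longrightarrow> p \<noteq> \<infinity> \<Longrightarrow> 1 \<le> enn2real p"
  using enn2real_mono[of 1 p] by (simp add: less_top)

lemma Lp_norm_mono:
  assumes "1 \<le> p" "AE x in lborel. F x \<le> G x" "F \<in> borel_measurable borel"
  shows "Lp_norm p F \<le> Lp_norm p G"
proof (cases "p = \<infinity>")
  case False
  then have "0 < enn2real p" using one_le_enn2real[OF assms(1)] by simp
  then show ?thesis
    unfolding Lp_norm_finite[OF False]
    by (intro ennreal_powr_mono nn_integral_mono_AE) (use assms(2) in \<open>auto elim!: eventually_mono intro: ennreal_powr_mono\<close>)
qed (use assms in \<open>auto simp: Lp_norm_def intro: esssup_AE_mono\<close>)

lemma esssup_le_iff: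
  fixes F :: "'a \<Rightarrow> ennreal"
  assumes "F \<in> borel_measurable M"
  shows "esssup M F \<le> c \<longleftrightarrow> (AE x in M. F x \<le> c)"
proof
  assume "esssup M F \<le> c"
  then show "AE x in M. F x \<le> c"
    using esssup_AE[of F M] by (auto elim!: eventually_mono)
qed (use assms in auto)

lemma Lp_norm_cmult:
  assumes "1 \<le> p" "0 \<le> c" and [measurable]: "F \<in> borel_measurable borel"
  shows "Lp_norm p (\<lambda>x. ennreal c * F x) \<le> ennreal c * Lp_norm p F"
proof (cases "p = \<infinity>")
  case True
  have "AE x in lborel. F x \<le> esssup lborel F" by (rule esssup_AE)
  then have "AE x in lborel. ennreal c * F x \<le> ennreal c * esssup lborel F"
    by eventually_elim (auto intro: mult_left_mono)
  then show ?thesis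
    using True by (simp add: Lp_norm_def esssup_le_iff)
next
  case False
  then have "0 < enn2real p" using one_le_enn2real[OF assms(1)] by simp
  then show ?thesis
    using assms(2) by (simp add: Lp_norm_finite[OF False] ennreal_powr_mult nn_integral_cmult powr_powr)
qed

text \<open>For infinite \<open>p\<close> the exponent \<open>enn2real (1 / p)\<close> is 0 and the
  factor is 1. What has to be shown there is that invertible affine maps pull null sets back to null
  sets.\<close>

lemma Lp_norm_affine:
  fixes A :: "real^'n^'n"
  assumes "1 \<le> p" and d: "det A \<noteq> 0" and [measurable]: "F \<in> borel_measurable borel"
  shows "Lp_norm p (\<lambda>x. F (A *v x + b)) \<le> ennreal (\<bar>det A\<bar> powr (- enn2real (1 / p))) * Lp_norm p F"
proof -
  have tr: "(\<integral>\<^sup>+x. G x \<partial>lborel) = ennreal \<bar>det A\<bar> * (\<integral>\<^sup>+x. G (A *v x + b) \<partial>lborel)"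
    if [measurable]: "G \<in> borel_measurable borel" for G :: "real^'n \<Rightarrow> ennreal"
  proof -
    have "(\<integral>\<^sup>+x. G x \<partial>lborel) = (\<integral>\<^sup>+x. G (b + x) \<partial>lborel)"
      by (subst lborel_distr_plus[of b, symmetric]) (simp add: nn_integral_distr)
    also have "\<dots> = ennreal \<bar>det A\<bar> * (\<integral>\<^sup>+x. G (A *v x + b) \<partial>lborel)"
      by (subst nn_integral_lborel_matrix[OF d]) (simp_all add: add.commute)
    finally show ?thesis .
  qed
  show ?thesis
  proof (cases "p = \<infinity>")
    case True
    let ?s = "esssup lborel F"
    \<comment> \<open>The set where \<open>F\<close> exceeds its essential supremum, written as a
      function of values 0 and 1 so that the change of variables carries the vanishing of its
      integral over.\<close>
    let ?G = "\<lambda>x. if F x \<le> ?s then 0 else (1::ennreal)"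
    have "AE x in lborel. F x \<le> ?s" by (rule esssup_AE)
    then have "(\<integral>\<^sup>+x. ?G x \<partial>lborel) = 0"
      by (subst nn_integral_0_iff_AE) (auto elim!: eventually_mono)
    then have "(\<integral>\<^sup>+x. ?G (A *v x + b) \<partial>lborel) = 0"
      using d by (subst (asm) tr) auto
    then have "AE x in lborel. F (A *v x + b) \<le> ?s"
      by (subst (asm) nn_integral_0_iff_AE) (auto elim!: eventually_mono split: if_splits)
    then show ?thesis
      using True d by (simp add: Lp_norm_def esssup_le_iff)
  next
    case False
    let ?r = "enn2real p"
    have r: "0 < ?r" using one_le_enn2real[OF assms(1) False] by simp
    let ?I = "\<integral>\<^sup>+x. ennreal_powr (F (A *v x + b)) ?r \<partial>lborel"
    have p: "enn2real (1 / p) = 1 / ?r"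
      using r False by (cases p) (auto simp: divide_ennreal ennreal_1[symmetric] simp del: ennreal_1)
    have "Lp_norm p F = ennreal_powr (ennreal \<bar>det A\<bar> * ?I) (1 / ?r)"
      unfolding Lp_norm_finite[OF False] by (subst tr) auto
    then have "Lp_norm p F = ennreal (\<bar>det A\<bar> powr (1 / ?r)) * ennreal_powr ?I (1 / ?r)"
      using r by (simp add: ennreal_powr_mult)
    then have "ennreal (\<bar>det A\<bar> powr (- (1 / ?r))) * Lp_norm p F
        = ennreal (\<bar>det A\<bar> powr (- (1 / ?r)) * \<bar>det A\<bar> powr (1 / ?r)) * ennreal_powr ?I (1 / ?r)"
      by (simp add: ennreal_mult mult.assoc)
    also have "\<bar>det A\<bar> powr (- (1 / ?r)) * \<bar>det A\<bar> powr (1 / ?r) = 1"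
      using d by (simp add: powr_add[symmetric])
    finally show ?thesis
      unfolding p Lp_norm_finite[OF False] by simp
  qed
qed

lemma measurable_Lp_norm:
  fixes H :: "'a::euclidean_space \<Rightarrow> real^'n \<Rightarrow> ennreal"
  assumes [measurable]: "case_prod H \<in> borel_measurable (lborel \<Otimes>\<^sub>M lborel)"
  shows "(\<lambda>y. Lp_norm p (H y)) \<in> borel_measurable borel"
proof -
  have m: "(\<lambda>y. Lp_norm p (H y)) \<in> borel_measurable lborel"
  proof (cases "p = \<infinity>")
    case True
    have [measurable]: "H y \<in> borel_measurable borel" for y
      using measurable_Pair2[OF assms, of y] by simp
    show ?thesis
    proof (rule borel_measurableI_le)
      fix c
      \<comment> \<open>A sublevel set of the essential supremum consists of those \<open>y\<close>
        for which an integral over \<open>x\<close> vanishes, and such integrals are measurable in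
        \<open>y\<close>.\<close>
      have "Lp_norm p (H y) \<le> c \<longleftrightarrow> (\<integral>\<^sup>+x. (if H y x \<le> c then 0 else 1) \<partial>lborel) = 0" for y
        using True by (subst nn_integral_0_iff_AE) (auto simp: Lp_norm_def esssup_le_iff elim!: eventually_mono split: if_splits)
      then show "{y \<in> space lborel. Lp_norm p (H y) \<le> c} \<in> sets lborel"
        by simp
    qed
  next
    case False
    show ?thesis
      unfolding Lp_norm_finite[OF False] by measurable
  qed
  then show ?thesis by simp
qed

lemma AE_zero_of_Lp_norm_zero:
  assumes "1 \<le> p" "Lp_norm p F = 0" and [measurable]: "F \<in> borel_measurable borel"
  shows "AE x in lborel. F x = 0"
proof (cases "p = \<infinity>")
  case True
  then show ?thesis
    using assms esssup_le_iff[of F lborel 0] by (simp add: Lp_norm_def)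
next
  case False
  then show ?thesis
    using assms(2) by (simp add: Lp_norm_finite nn_integral_0_iff_AE)
qed

text \<open>The proof avoids duality. For finite \<open>p\<close> Jensen's inequality is applied at
  each \<open>x\<close> with the weight N(y), the norm of the slice H(y). Each normalised slice has
  norm 1, so integrating over \<open>x\<close> leaves S^(r-1) times S with S the integral of
  \<open>N\<close>. For infinite \<open>p\<close> the two almost-everywhere quantifiers are
  exchanged.\<close>

lemma Minkowski_nn_integral:
  fixes H :: "'a::euclidean_space \<Rightarrow> real^'n \<Rightarrow> ennreal"
  assumes p: "1 \<le> p" and [measurable]: "case_prod H \<in> borel_measurable (lborel \<Otimes>\<^sub>M lborel)"
  shows "Lp_norm p (\<lambda>x. \<integral>\<^sup>+y. H y x \<partial>lborel) \<le> (\<integral>\<^sup>+y. Lp_norm p (H y) \<partial>lborel)"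
proof -
  define N where "N y = Lp_norm p (H y)" for y
  have N [measurable]: "N \<in> borel_measurable borel"
    unfolding N_def using assms(2) by (rule measurable_Lp_norm)
  have H2 [measurable]: "H y \<in> borel_measurable borel" for y
    using measurable_Pair2[OF assms(2), of y] by simp
  have H1 [measurable]: "(\<lambda>y. H y x) \<in> borel_measurable borel" for x
    using measurable_Pair1[OF assms(2), of x] by simp
  have H12 [measurable]: "(\<lambda>z. H (fst z) (snd z)) \<in> borel_measurable (lborel \<Otimes>\<^sub>M lborel)"
    using assms(2) by (simp add: case_prod_beta')
  show ?thesis
  proof (cases "p = \<infinity>")
    case True
    have "AE y in lborel. AE x in lborel. H y x \<le> N y"
      using True by (auto simp: N_def Lp_norm_def intro: esssup_AE)
    moreover have "{z \<in> space (lborel \<Otimes>\<^sub>M lborel). H (fst z) (snd z) \<le> N (fst z)} \<in> sets (lborel \<Otimes>\<^sub>M lborel)"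
      by measurable
    ultimately have "AE x in lborel. AE y in lborel. H y x \<le> N y"
      using lborel_pair.AE_commute[of "\<lambda>y x. H y x \<le> N y"] by blast
    then have "AE x in lborel. (\<integral>\<^sup>+y. H y x \<partial>lborel) \<le> (\<integral>\<^sup>+y. N y \<partial>lborel)"
      by eventually_elim (rule nn_integral_mono_AE)
    then show ?thesis
      unfolding N_def[symmetric] using True by (simp add: Lp_norm_def[where p=top] esssup_le_iff)
  next
    case False
    define r where "r = enn2real p"
    have r: "1 \<le> r" using one_le_enn2real[OF p False] by (simp add: r_def)
    \<comment> \<open>Jensen's inequality divides by \<open>N\<close>, which is harmless only if
      \<open>H\<close> vanishes where \<open>N\<close> does. This holds for each \<open>y\<close> at
      almost every \<open>x\<close>, and Fubini reverses the quantifiers.\<close>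
    have zero: "AE x in lborel. AE y in lborel. N y = 0 \<longrightarrow> H y x = 0"
    proof -
      have "AE y in lborel. AE x in lborel. N y = 0 \<longrightarrow> H y x = 0"
      proof (rule AE_I2)
        show "AE x in lborel. N y = 0 \<longrightarrow> H y x = 0" for y
          using AE_zero_of_Lp_norm_zero[OF p _ H2, of y] by (cases "N y = 0") (auto simp: N_def)
      qed
      moreover have "{z \<in> space (lborel \<Otimes>\<^sub>M lborel). N (fst z) = 0 \<longrightarrow> H (fst z) (snd z) = 0} \<in> sets (lborel \<Otimes>\<^sub>M lborel)"
        by measurable
      ultimately show ?thesis
        using lborel_pair.AE_commute[of "\<lambda>y x. N y = 0 \<longrightarrow> H y x = 0"] by blast
    qed
    let ?S = "\<integral>\<^sup>+y. N y \<partial>lborel"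
    consider "?S = top" | "?S = 0" | "0 < ?S" "?S < top"
      by (metis less_top not_gr_zero)
    then show ?thesis
    proof cases
      case 1
      then show ?thesis by (simp add: N_def)
    next
      case 2
      then have N0: "AE y in lborel. N y = 0"
        by (simp add: nn_integral_0_iff_AE)
      have "AE x in lborel. (\<integral>\<^sup>+y. H y x \<partial>lborel) = 0"
        using zero
      proof eventually_elim
        case (elim x)
        then have "AE y in lborel. H y x = 0"
          using N0 by eventually_elim auto
        then show ?case by (simp add: nn_integral_0_iff_AE)
      qed
      then have "(\<integral>\<^sup>+x. ennreal_powr (\<integral>\<^sup>+y. H y x \<partial>lborel) r \<partial>lborel) = 0"
        by (subst nn_integral_0_iff_AE) auto
      then show ?thesis
        by (simp add: Lp_norm_finite[OF False] r_def)
    next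
      case 3
      have fin: "AE y in lborel. N y < top"
        using nn_integral_noteq_infinite[of N lborel] 3 by (auto simp: less_top)
      have "(\<integral>\<^sup>+x. ennreal_powr (\<integral>\<^sup>+y. H y x \<partial>lborel) r \<partial>lborel)
          \<le> (\<integral>\<^sup>+x. ennreal_powr ?S (r - 1) * (\<integral>\<^sup>+y. N y * ennreal_powr (H y x / N y) r \<partial>lborel) \<partial>lborel)"
        by (rule nn_integral_mono_AE) (use zero in eventually_elim, use r 3 in \<open>auto intro!: nn_integral_powr_le\<close>)
      also have "\<dots> = ennreal_powr ?S (r - 1) * (\<integral>\<^sup>+x. \<integral>\<^sup>+y. N y * ennreal_powr (H y x / N y) r \<partial>lborel \<partial>lborel)"
        by (simp add: nn_integral_cmult)
      also have "(\<integral>\<^sup>+x. \<integral>\<^sup>+y. N y * ennreal_powr (H y x / N y) r \<partial>lborel \<partial>lborel)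
          = (\<integral>\<^sup>+y. \<integral>\<^sup>+x. N y * ennreal_powr (H y x / N y) r \<partial>lborel \<partial>lborel)"
        by (rule lborel_pair.Fubini') measurable
      also have "\<dots> = ?S"
      proof (rule nn_integral_cong_AE, use fin in eventually_elim)
        case (elim y)
        show ?case
        proof (cases "N y = 0")
          case False
          have "(\<integral>\<^sup>+x. N y * ennreal_powr (H y x / N y) r \<partial>lborel)
              = N y * (\<integral>\<^sup>+x. ennreal_powr (H y x) r * ennreal_powr (inverse (N y)) r \<partial>lborel)"
            using r by (simp add: nn_integral_cmult divide_ennreal_def ennreal_powr_mult)
          also have "\<dots> = N y * ((\<integral>\<^sup>+x. ennreal_powr (H y x) r \<partial>lborel) * ennreal_powr (inverse (N y)) r)"
            by (simp add: nn_integral_multc)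
          also have "(\<integral>\<^sup>+x. ennreal_powr (H y x) r \<partial>lborel) = ennreal_powr (N y) r"
            using r \<open>p \<noteq> \<infinity>\<close> by (simp add: N_def Lp_norm_finite r_def)
          also have "ennreal_powr (N y) r * ennreal_powr (inverse (N y)) r = ennreal_powr (N y / N y) r"
            using r by (simp add: ennreal_powr_mult divide_ennreal_def)
          also have "N y / N y = 1"
            using False elim by (simp add: ennreal_divide_self)
          finally show ?thesis
            using ennreal_powr_ennreal[of 1 r] by simp
        qed simp
      qed
      also have "ennreal_powr ?S (r - 1) * ?S = ennreal_powr ?S r"
        using 3 by (cases ?S) (auto simp: ennreal_mult[symmetric] powr_diff)
      finally have "ennreal_powr (\<integral>\<^sup>+x. ennreal_powr (\<integral>\<^sup>+y. H y x \<partial>lborel) r \<partial>lborel) (1 / r) \<le> ennreal_powr (ennreal_powr ?S r) (1 / r)"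
        using r by (intro ennreal_powr_mono) auto
      then show ?thesis
        using r by (simp add: Lp_norm_finite[OF False, of "\<lambda>x. \<integral>\<^sup>+y. H y x \<partial>lborel"] r_def N_def)
    qed
  qed
qed


section \<open>Smooth functions\<close>

definition fourier_char :: "real^'n \<Rightarrow> real^'n \<Rightarrow> complex" where
  "fourier_char \<xi> t = exp (- 2 * complex_of_real pi * \<i> * complex_of_real (t \<bullet> \<xi>))"

lemma norm_fourier_char [simp]: "norm (fourier_char \<xi> t) = 1"
  by (simp add: fourier_char_def norm_exp_eq_Re)

lemma fourier_char_add: "fourier_char (\<xi> + \<eta>) t = fourier_char \<xi> t * fourier_char \<eta> t"
  by (simp add: fourier_char_def inner_add_right mult_exp_exp algebra_simps)

lemma fourier_char_add_right: "fourier_char \<xi> (s + t) = fourier_char \<xi> s * fourier_char \<xi> t"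
  by (simp add: fourier_char_def inner_add_left mult_exp_exp algebra_simps)

lemma fourier_char_0 [simp]: "fourier_char 0 t = 1" "fourier_char \<xi> 0 = 1"
  by (simp_all add: fourier_char_def)

lemma fourier_char_commute: "fourier_char \<xi> t = fourier_char t \<xi>"
  by (simp add: fourier_char_def inner_commute)

lemma cnj_fourier_char: "cnj (fourier_char \<xi> t) = fourier_char (- \<xi>) t"
  by (simp add: fourier_char_def exp_cnj)

lemma fourier_char_minus: "fourier_char (- \<xi>) t = fourier_char \<xi> (- t)"
  by (simp add: fourier_char_def)

lemma fourier_char_matrix: "fourier_char \<xi> (B *v t) = fourier_char (transpose B *v \<xi>) t"
  by (simp add: fourier_char_def) (metis dot_lmul_matrix inner_commute)

lemma borel_measurable_fourier_char [measurable (raw)]: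
  assumes [measurable]: "f \<in> borel_measurable M" "g \<in> borel_measurable M"
  shows "(\<lambda>x. fourier_char (f x) (g x)) \<in> borel_measurable M"
  unfolding fourier_char_def by measurable

lemma has_derivative_fourier_char:
  "(fourier_char \<xi> has_derivative (\<lambda>h. (- 2 * complex_of_real pi * \<i> * complex_of_real (h \<bullet> \<xi>)) * fourier_char \<xi> x)) (at x)"
proof -
  let ?c = "- 2 * complex_of_real pi * \<i>"
  have "((\<lambda>t. ?c * complex_of_real (t \<bullet> \<xi>)) has_derivative (\<lambda>h. ?c * complex_of_real (h \<bullet> \<xi>))) (at x)"
    by (auto intro!: derivative_eq_intros)
  from has_derivative_compose[OF this DERIV_exp[unfolded has_field_derivative_def]]
  show ?thesis
    by (simp add: fourier_char_def[abs_def] mult.commute)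
qed

lemma norm_fourier_char_diff_le: "norm (fourier_char \<xi> t - fourier_char \<eta> t) \<le> 2 * pi * norm t * norm (\<xi> - \<eta>)"
proof -
  have *: "norm (exp (\<i> * complex_of_real a) - exp (\<i> * complex_of_real b)) \<le> \<bar>a - b\<bar>" for a b
  proof -
    have "((\<lambda>x. exp (\<i> * complex_of_real x)) has_derivative (\<lambda>h. \<i> * complex_of_real h * exp (\<i> * complex_of_real x))) (at x within UNIV)" for x
    proof -
      have "((\<lambda>t. \<i> * complex_of_real t) has_derivative (\<lambda>h. \<i> * complex_of_real h)) (at x within UNIV)"
        by (auto intro!: derivative_eq_intros)
      from has_derivative_compose[OF this DERIV_exp[unfolded has_field_derivative_def]]
      show ?thesis by (simp add: mult.commute)
    qed
    then have "norm (exp (\<i> * complex_of_real a) - exp (\<i> * complex_of_real b)) \<le> 1 * norm (a - b)"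
      by (rule differentiable_bound[OF convex_UNIV])
         (auto intro!: onorm_le simp: norm_mult)
    then show ?thesis by simp
  qed
  have eq: "fourier_char \<zeta> t = exp (\<i> * complex_of_real (- 2 * pi * (t \<bullet> \<zeta>)))" for \<zeta>
    by (simp add: fourier_char_def algebra_simps)
  have "norm (fourier_char \<xi> t - fourier_char \<eta> t) \<le> \<bar>- 2 * pi * (t \<bullet> \<xi>) - (- 2 * pi * (t \<bullet> \<eta>))\<bar>"
    unfolding eq by (rule *)
  also have "\<dots> = 2 * pi * \<bar>t \<bullet> (\<xi> - \<eta>)\<bar>"
    by (simp add: inner_diff_right right_diff_distrib[symmetric] abs_mult abs_minus_commute)
  also have "\<dots> \<le> 2 * pi * (norm t * norm (\<xi> - \<eta>))"
    by (intro mult_left_mono Cauchy_Schwarz_ineq2) auto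
  finally show ?thesis by (simp add: mult.assoc)
qed

section \<open>Closure properties of smooth functions\<close>

lemma partial_deriv_eq: "(\<phi> has_derivative D) (at x) \<Longrightarrow> partial_deriv i \<phi> x = D (axis i 1)"
  by (simp add: partial_deriv_def frechet_derivative_at[symmetric])

lemma iter_deriv_append: "iter_deriv (\<alpha> @ \<beta>) \<phi> = iter_deriv \<alpha> (iter_deriv \<beta> \<phi>)"
  by (induction \<alpha>) auto

text \<open>This replaces the Leibniz and chain rules for multi-indices: it is enough to exhibit a
  class of differentiable functions that one partial derivative does not leave.\<close>

lemma smooth_fun_coinduct:
  assumes "\<phi> \<in> S" "\<And>\<psi> x. \<psi> \<in> S \<Longrightarrow> \<psi> differentiable (at x)" "\<And>\<psi> i. \<psi> \<in> S \<Longrightarrow> partial_deriv i \<psi> \<in> S"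
  shows "smooth_fun \<phi>"
proof -
  have "iter_deriv \<alpha> \<phi> \<in> S" for \<alpha>
    by (induction \<alpha>) (use assms in auto)
  then show ?thesis
    using assms(2) by (auto simp: smooth_fun_def differentiable_on_def)
qed

lemma smooth_fun_partial_deriv: "smooth_fun \<phi> \<Longrightarrow> smooth_fun (partial_deriv i \<phi>)"
  unfolding smooth_fun_def by (metis iter_deriv_append iter_deriv.simps)

lemma linear_axis_expansion:
  fixes D :: "real^'n \<Rightarrow> complex"
  assumes "linear D"
  shows "D h = (\<Sum>j\<in>UNIV. complex_of_real (h $ j) * D (axis j 1))"
proof -
  have "D h = D (\<Sum>j\<in>UNIV. h $ j *\<^sub>R axis j 1)"
    using basis_expansion[of h] by (simp only: scalar_mult_eq_scaleR)
  also have "\<dots> = (\<Sum>j\<in>UNIV. complex_of_real (h $ j) * D (axis j 1))"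
    by (simp only: linear_sum[OF assms] linear_scale[OF assms]) (simp add: scaleR_conv_of_real)
  finally show ?thesis .
qed

abbreviation dir_deriv :: "(real^'n \<Rightarrow> complex) \<Rightarrow> real^'n \<Rightarrow> real^'n \<Rightarrow> complex" where
  "dir_deriv \<phi> x \<equiv> \<lambda>h. \<Sum>j\<in>UNIV. complex_of_real (h $ j) * partial_deriv j \<phi> x"

lemma smooth_fun_has_derivative:
  assumes "smooth_fun \<phi>"
  shows "(\<phi> has_derivative (dir_deriv \<phi> x)) (at x)"
proof -
  have "\<phi> differentiable (at x)"
    using assms[unfolded smooth_fun_def, THEN spec, of "[]"] by (simp add: differentiable_on_def)
  then obtain D where D: "(\<phi> has_derivative D) (at x)"
    by (auto simp: differentiable_def)
  then have "D h = (dir_deriv \<phi> x h)" for h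
    using linear_axis_expansion[OF has_derivative_linear[OF D], of h] by (simp add: partial_deriv_eq[OF D])
  then have "D = (dir_deriv \<phi> x)"
    by auto
  with D show ?thesis by simp
qed

lemma smooth_fun_continuous: "smooth_fun \<phi> \<Longrightarrow> continuous_on S \<phi>"
  by (rule continuous_at_imp_continuous_on) (auto intro: has_derivative_continuous smooth_fun_has_derivative)

lemma smooth_fun_measurable: "smooth_fun \<phi> \<Longrightarrow> \<phi> \<in> borel_measurable borel"
  by (intro borel_measurable_continuous_onI smooth_fun_continuous)

text \<open>The class for \<open>smooth_fun_coinduct\<close>. The chain rule for affine maps and the
  product rule leave only sums of products of its members with constants. In the end the class
  equals the smooth functions, whereupon its introduction rules read as closure properties of
  smoothness.\<close>

inductive_set smooth_algebra :: "(real^'n \<Rightarrow> complex) set" where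
  affine: "smooth_fun \<phi> \<Longrightarrow> (\<lambda>t. \<phi> ((B :: real^'n^'n) *v t + c)) \<in> smooth_algebra"
| cnj: "smooth_fun \<phi> \<Longrightarrow> (\<lambda>t. cnj (\<phi> t)) \<in> smooth_algebra"
| char: "fourier_char \<xi> \<in> smooth_algebra"
| const: "(\<lambda>t. c) \<in> smooth_algebra"
| add: "\<phi> \<in> smooth_algebra \<Longrightarrow> \<psi> \<in> smooth_algebra \<Longrightarrow> (\<lambda>t. \<phi> t + \<psi> t) \<in> smooth_algebra"
| mult: "\<phi> \<in> smooth_algebra \<Longrightarrow> \<psi> \<in> smooth_algebra \<Longrightarrow> (\<lambda>t. \<phi> t * \<psi> t) \<in> smooth_algebra"

lemma smooth_algebra_sum:
  assumes "\<And>i. i \<in> I \<Longrightarrow> f i \<in> smooth_algebra"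
  shows "(\<lambda>t. \<Sum>i\<in>I. f i t) \<in> smooth_algebra"
  using assms
proof (induction I rule: infinite_finite_induct)
  case (insert i I)
  then show ?case by (auto intro: smooth_algebra.add)
qed (auto intro: smooth_algebra.const)

lemma smooth_algebra_has_derivative:
  assumes "\<phi> \<in> smooth_algebra"
  shows "\<exists>D. (\<forall>x. (\<phi> has_derivative D x) (at x)) \<and> (\<forall>i. (\<lambda>x. D x (axis i 1)) \<in> smooth_algebra)"
  using assms
proof induction
  case (affine \<phi> B c)
  define D where "D x h = (\<Sum>j\<in>UNIV. complex_of_real ((B *v h) $ j) * partial_deriv j \<phi> (B *v x + c))" for x h
  have "((\<lambda>t. \<phi> (B *v t + c)) has_derivative D x) (at x)" for x
  proof -
    have "((\<lambda>t. B *v t + c) has_derivative (\<lambda>h. B *v h)) (at x)"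
      by (auto intro!: derivative_eq_intros bounded_linear_imp_has_derivative)
    from has_derivative_compose[OF this smooth_fun_has_derivative[OF affine]]
    show ?thesis by (simp add: D_def[abs_def])
  qed
  moreover have "(\<lambda>x. D x (axis i 1)) \<in> smooth_algebra" for i
    unfolding D_def
    by (intro smooth_algebra_sum smooth_algebra.mult smooth_algebra.const smooth_algebra.affine smooth_fun_partial_deriv affine)
  ultimately show ?case by blast
next
  case (cnj \<phi>)
  have "((\<lambda>t. cnj (\<phi> t)) has_derivative (\<lambda>h. cnj (dir_deriv \<phi> x h))) (at x)" for x
    by (intro bounded_linear.has_derivative[OF bounded_linear_cnj] smooth_fun_has_derivative cnj)
  moreover have "(\<lambda>x. cnj (\<Sum>j\<in>UNIV. complex_of_real (axis i 1 $ j) * partial_deriv j \<phi> x)) \<in> smooth_algebra" for i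
    unfolding cnj_sum complex_cnj_mult
    by (intro smooth_algebra_sum smooth_algebra.mult smooth_algebra.const smooth_algebra.cnj smooth_fun_partial_deriv cnj)
  ultimately show ?case
    by (intro exI[of _ "\<lambda>x h. cnj (dir_deriv \<phi> x h)"]) blast
next
  case (char \<xi>)
  have "(\<lambda>x. (- 2 * complex_of_real pi * \<i> * complex_of_real (axis i 1 \<bullet> \<xi>)) * fourier_char \<xi> x) \<in> smooth_algebra" for i
    by (intro smooth_algebra.mult smooth_algebra.const smooth_algebra.char)
  then show ?case
    by (intro exI[of _ "\<lambda>x h. (- 2 * complex_of_real pi * \<i> * complex_of_real (h \<bullet> \<xi>)) * fourier_char \<xi> x"])
       (blast intro: has_derivative_fourier_char)
next
  case (const c)
  show ?case by (rule exI[of _ "\<lambda>x h. 0"]) (auto intro: smooth_algebra.const)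
next
  case (add \<phi> \<psi>)
  then obtain D E where *: "\<And>x. (\<phi> has_derivative D x) (at x)" "\<And>i. (\<lambda>x. D x (axis i 1)) \<in> smooth_algebra"
    "\<And>x. (\<psi> has_derivative E x) (at x)" "\<And>i. (\<lambda>x. E x (axis i 1)) \<in> smooth_algebra"
    by metis
  show ?case
    by (rule exI[of _ "\<lambda>x h. D x h + E x h"]) (auto intro!: has_derivative_add smooth_algebra.add *)
next
  case (mult \<phi> \<psi>)
  then obtain D E where *: "\<And>x. (\<phi> has_derivative D x) (at x)" "\<And>i. (\<lambda>x. D x (axis i 1)) \<in> smooth_algebra"
    "\<And>x. (\<psi> has_derivative E x) (at x)" "\<And>i. (\<lambda>x. E x (axis i 1)) \<in> smooth_algebra"
    by metis
  show ?case
    by (rule exI[of _ "\<lambda>x h. \<phi> x * E x h + D x h * \<psi> x"])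
       (auto intro!: has_derivative_mult smooth_algebra.add smooth_algebra.mult mult *)
qed

lemma smooth_algebra_smooth: "\<phi> \<in> smooth_algebra \<Longrightarrow> smooth_fun \<phi>"
proof (erule smooth_fun_coinduct)
  fix \<psi> :: "real^'n \<Rightarrow> complex" and x i assume "\<psi> \<in> smooth_algebra"
  then obtain D where D: "\<And>x. (\<psi> has_derivative D x) (at x)" "\<And>i. (\<lambda>x. D x (axis i 1)) \<in> smooth_algebra"
    using smooth_algebra_has_derivative by metis
  show "\<psi> differentiable (at x)"
    using D(1) by (auto simp: differentiable_def)
  show "partial_deriv i \<psi> \<in> smooth_algebra"
  proof -
    have "partial_deriv i \<psi> = (\<lambda>x. D x (axis i 1))"
      by (rule ext) (rule partial_deriv_eq[OF D(1)])
    then show ?thesis using D(2) by simp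
  qed
qed

lemma smooth_algebra_iff: "\<phi> \<in> smooth_algebra \<longleftrightarrow> smooth_fun \<phi>"
  using smooth_algebra.affine[of \<phi> "mat 1" 0] smooth_algebra_smooth by auto

lemmas smooth_fun_affine = smooth_algebra.affine[unfolded smooth_algebra_iff]
  and smooth_fun_cnj = smooth_algebra.cnj[unfolded smooth_algebra_iff]
  and smooth_fun_char = smooth_algebra.char[unfolded smooth_algebra_iff]
  and smooth_fun_const = smooth_algebra.const[unfolded smooth_algebra_iff]
  and smooth_fun_add = smooth_algebra.add[unfolded smooth_algebra_iff]
  and smooth_fun_mult = smooth_algebra.mult[unfolded smooth_algebra_iff]

section \<open>Test functions: support, bounds and derivatives\<close>

lemma test_functions_iff: "\<phi> \<in> test_functions \<longleftrightarrow> smooth_fun \<phi> \<and> bounded {x. \<phi> x \<noteq> 0}"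
  by (simp add: test_functions_def compact_closure)

lemma test_functions_smooth: "\<phi> \<in> test_functions \<Longrightarrow> smooth_fun \<phi>"
  by (simp add: test_functions_iff)

lemma test_functions_supportE:
  assumes "\<phi> \<in> test_functions"
  obtains R where "R > 0" "\<And>x. \<phi> x \<noteq> 0 \<Longrightarrow> norm x \<le> R"
proof -
  from assms obtain R where "R > 0" "\<forall>x\<in>{x. \<phi> x \<noteq> 0}. norm x \<le> R"
    unfolding test_functions_iff bounded_pos by blast
  then show ?thesis using that by auto
qed

lemma test_functions_mult:
  assumes "\<phi> \<in> test_functions" "smooth_fun \<psi>"
  shows "(\<lambda>t. \<phi> t * \<psi> t) \<in> test_functions"
  using assms by (auto simp: test_functions_iff intro: smooth_fun_mult elim: bounded_subset)

lemma test_functions_affine: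
  fixes B :: "real^'n^'n"
  assumes "\<phi> \<in> test_functions" "C ** B = mat 1"
  shows "(\<lambda>t. \<phi> (B *v t + c)) \<in> test_functions"
proof -
  have "bounded ((\<lambda>x. C *v (x - c)) ` {x. \<phi> x \<noteq> 0})"
    using assms bounded_linear_image[OF bounded_translation[of _ "- c"] matrix_vector_mul_bounded_linear[of C]]
    by (simp add: test_functions_iff image_image)
  moreover have "{t. \<phi> (B *v t + c) \<noteq> 0} \<subseteq> (\<lambda>x. C *v (x - c)) ` {x. \<phi> x \<noteq> 0}"
  proof
    fix t assume "t \<in> {t. \<phi> (B *v t + c) \<noteq> 0}"
    moreover have "t = C *v ((B *v t + c) - c)"
      by (simp add: matrix_vector_mul_assoc assms(2))
    ultimately show "t \<in> (\<lambda>x. C *v (x - c)) ` {x. \<phi> x \<noteq> 0}" by blast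
  qed
  ultimately show ?thesis
    using assms(1) smooth_fun_affine by (auto simp: test_functions_iff intro: bounded_subset)
qed

lemma test_functions_translate: "\<phi> \<in> test_functions \<Longrightarrow> (\<lambda>t. \<phi> (t - c)) \<in> test_functions"
  using test_functions_affine[of \<phi> "mat 1" "mat 1" "- c"] by simp

lemma test_functions_partial_deriv:
  assumes "\<phi> \<in> test_functions"
  shows "partial_deriv i \<phi> \<in> test_functions"
proof -
  have "{x. partial_deriv i \<phi> x \<noteq> 0} \<subseteq> closure {x. \<phi> x \<noteq> 0}"
  proof (clarify, rule ccontr)
    fix x assume x: "partial_deriv i \<phi> x \<noteq> 0" "x \<notin> closure {x. \<phi> x \<noteq> 0}"
    have "(\<phi> has_derivative (\<lambda>h. 0)) (at x)"
      by (rule has_derivative_transform_within_open[OF has_derivative_const[of 0], of "- closure {x. \<phi> x \<noteq> 0}"])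
         (use x closure_subset[of "{x. \<phi> x \<noteq> 0}"] in auto)
    with x(1) show False by (simp add: partial_deriv_eq)
  qed
  then show ?thesis
    using assms bounded_subset[OF bounded_closure] smooth_fun_partial_deriv
    by (auto simp: test_functions_iff)
qed

lemma test_functions_iter_deriv: "\<phi> \<in> test_functions \<Longrightarrow> iter_deriv \<alpha> \<phi> \<in> test_functions"
  by (induction \<alpha>) (auto intro: test_functions_partial_deriv)

lemma test_functions_boundedE:
  assumes "\<phi> \<in> test_functions"
  obtains B where "B > 0" "\<And>x. norm (\<phi> x) \<le> B"
proof -
  have "bounded (\<phi> ` closure {x. \<phi> x \<noteq> 0})"
    using assms unfolding test_functions_def
    by (intro compact_imp_bounded compact_continuous_image smooth_fun_continuous) auto
  then obtain B where B: "B > 0" "\<forall>y\<in>\<phi> ` closure {x. \<phi> x \<noteq> 0}. norm y \<le> B"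
    unfolding bounded_pos by blast
  have "norm (\<phi> x) \<le> B" for x
    using B closure_subset[of "{x. \<phi> x \<noteq> 0}"] by (cases "\<phi> x = 0") auto
  with B(1) show ?thesis using that by blast
qed

lemma test_functions_schwartz:
  assumes "\<phi> \<in> test_functions"
  shows "\<phi> \<in> schwartz"
  unfolding schwartz_def
proof (intro CollectI conjI allI)
  show "smooth_fun \<phi>" using assms by (rule test_functions_smooth)
  fix k \<alpha>
  have *: "iter_deriv \<alpha> \<phi> \<in> test_functions" using assms by (rule test_functions_iter_deriv)
  obtain B where B: "B > 0" "\<And>x. norm (iter_deriv \<alpha> \<phi> x) \<le> B"
    using test_functions_boundedE[OF *] by metis
  obtain R where R: "R > 0" "\<And>x. iter_deriv \<alpha> \<phi> x \<noteq> 0 \<Longrightarrow> norm x \<le> R"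
    using test_functions_supportE[OF *] by metis
  have "norm x ^ k * norm (iter_deriv \<alpha> \<phi> x) \<le> R ^ k * B" for x
  proof (cases "iter_deriv \<alpha> \<phi> x = 0")
    case False
    then show ?thesis using R B by (intro mult_mono power_mono) auto
  qed (use R B in auto)
  then show "bounded (range (\<lambda>x. norm x ^ k * norm (iter_deriv \<alpha> \<phi> x)))"
    unfolding bounded_iff by (intro exI[of _ "R ^ k * B"]) auto
qed

lemma onorm_axis_sum_le:
  fixes a :: "'n::finite \<Rightarrow> complex" and B :: real
  assumes "\<And>j. norm (a j) \<le> B"
  shows "onorm (\<lambda>h::real^'n. \<Sum>j\<in>UNIV. complex_of_real (h $ j) * a j) \<le> CARD('n) * B"
proof (rule onorm_le)
  fix h :: "real^'n"
  have "norm (\<Sum>j\<in>UNIV. complex_of_real (h $ j) * a j) \<le> (\<Sum>j\<in>(UNIV::'n set). norm h * B)"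
    by (rule sum_norm_le) (auto simp: norm_mult component_le_norm_cart assms intro!: mult_mono)
  then show "norm (\<Sum>j\<in>UNIV. complex_of_real (h $ j) * a j) \<le> CARD('n) * B * norm h"
    by (simp add: mult_ac)
qed

lemma test_functions_lipschitzE:
  fixes \<phi> :: "real^'n \<Rightarrow> complex"
  assumes "\<phi> \<in> test_functions"
  obtains L where "L > 0" "\<And>x y. norm (\<phi> x - \<phi> y) \<le> L * norm (x - y)"
proof -
  have "\<exists>B>0. \<forall>x. norm (partial_deriv j \<phi> x) \<le> B" for j
    using test_functions_boundedE[OF test_functions_partial_deriv[OF assms]] by metis
  then obtain B where B: "\<And>j. B j > 0" "\<And>j x. norm (partial_deriv j \<phi> x) \<le> B j"
    by metis
  define C where "C = (\<Sum>j\<in>UNIV. B j)"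
  have C: "norm (partial_deriv j \<phi> x) \<le> C" for j x
    using B(2)[of j x] member_le_sum[of j UNIV B] B(1) by (auto simp: C_def less_imp_le intro: order_trans)
  have "C > 0" unfolding C_def by (intro sum_pos) (use B in auto)
  moreover have "norm (\<phi> x - \<phi> y) \<le> CARD('n) * C * norm (x - y)" for x y
    by (rule differentiable_bound[OF convex_UNIV, of \<phi>])
       (use smooth_fun_has_derivative[OF test_functions_smooth[OF assms]] onorm_axis_sum_le[OF C] in auto)
  ultimately show ?thesis using that[of "CARD('n) * C"] by simp
qed

lemma test_functions_integrable:
  assumes "\<phi> \<in> test_functions"
  shows "integrable lborel \<phi>"
proof -
  obtain B where B: "B > 0" "\<And>x. norm (\<phi> x) \<le> B"
    using test_functions_boundedE[OF assms] by metis
  obtain R where R: "R > 0" "\<And>x. \<phi> x \<noteq> 0 \<Longrightarrow> norm x \<le> R"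
    using test_functions_supportE[OF assms] by metis
  have "integrable lborel (\<lambda>x. B * indicator (cball (0::real^'a) R) x)"
    using emeasure_lborel_cball_finite[of "0::real^'a" R] by (intro integrable_mult_right integrable_real_indicator) auto
  then show ?thesis
  proof (rule Bochner_Integration.integrable_bound)
    show "\<phi> \<in> borel_measurable lborel"
      using smooth_fun_measurable[OF test_functions_smooth[OF assms]] by simp
    show "AE x in lborel. norm (\<phi> x) \<le> norm (B * indicator (cball 0 R) x)"
      using B R(2) by (intro AE_I2) (auto simp: indicator_def)
  qed
qed


lemma norm_fst_le_norm: "norm (fst z) \<le> norm z" and norm_snd_le_norm: "norm (snd z) \<le> norm z"
  using norm_fst_le[of "fst z" "snd z"] norm_snd_le[of "snd z" "fst z"] by simp_all

section \<open>Superpositions of time-frequency shifts\<close>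

text \<open>Linear combinations of time-frequency shifts of test functions; the parameter is
  \<open>z = (y, \<eta>)\<close>. The coefficients \<open>\<eta> $ i\<close> make the class closed under differentiation in \<open>t\<close>.\<close>

inductive_set tf_families :: "((real^'n) \<times> (real^'n) \<Rightarrow> real^'n \<Rightarrow> complex) set" where
  shift: "b \<in> test_functions \<Longrightarrow> (\<lambda>z t. b (t - fst z) * fourier_char (snd z) t) \<in> tf_families"
| mult: "G \<in> tf_families \<Longrightarrow> (\<lambda>z t. c * complex_of_real (snd z $ i) * G z t) \<in> tf_families"
| add: "G \<in> tf_families \<Longrightarrow> H \<in> tf_families \<Longrightarrow> (\<lambda>z t. G z t + H z t) \<in> tf_families"

lemma tf_families_has_derivative:
  fixes G :: "(real^'n) \<times> (real^'n) \<Rightarrow> real^'n \<Rightarrow> complex"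
  assumes "G \<in> tf_families"
  shows "\<exists>D. (\<forall>z x. (G z has_derivative D z x) (at x)) \<and> (\<forall>i. (\<lambda>z x. D z x (axis i 1)) \<in> tf_families)"
  using assms
proof induction
  case (shift b)
  define c where "c = - 2 * complex_of_real pi * \<i>"
  define D where "D z x h = b (x - fst z) * ((c * complex_of_real (h \<bullet> snd z)) * fourier_char (snd z) x)
      + (dir_deriv b (x - fst z) h) * fourier_char (snd z) x"
    for z :: "(real^'n) \<times> (real^'n)" and x h
  have "((\<lambda>t. b (t - fst z) * fourier_char (snd z) t) has_derivative D z x) (at x)" for z x
  proof -
    have "((\<lambda>t. t - fst z) has_derivative (\<lambda>h. h)) (at x)"
      by (auto intro!: derivative_eq_intros)
    from has_derivative_compose[OF this smooth_fun_has_derivative[OF test_functions_smooth[OF shift]]]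
    show ?thesis
      unfolding D_def[abs_def] c_def
      by (intro has_derivative_mult has_derivative_fourier_char)
  qed
  moreover have "(\<lambda>z x. D z x (axis i 1)) \<in> tf_families" for i
  proof -
    have "(\<Sum>j\<in>UNIV. complex_of_real (axis i 1 $ j) * partial_deriv j b y) = partial_deriv i b y" for y
      by (simp add: axis_def if_distrib[of "\<lambda>x. x * _"] if_distrib[of complex_of_real] cong: if_cong)
    \<comment> \<open>Differentiating the character brings down the coefficient that the rule
      \<open>mult\<close> admits; differentiating the window gives a shift of another test
      function.\<close>
    then have "D z x (axis i 1) = c * complex_of_real (snd z $ i) * (b (x - fst z) * fourier_char (snd z) x)
        + partial_deriv i b (x - fst z) * fourier_char (snd z) x" for z x
      by (simp add: D_def inner_axis')
    then show ?thesis
      by (simp only:) (intro tf_families.intros shift test_functions_partial_deriv)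
  qed
  ultimately show ?case by blast
next
  case (mult G c i)
  then obtain D where D: "\<And>z x. (G z has_derivative D z x) (at x)" "\<And>i. (\<lambda>z x. D z x (axis i 1)) \<in> tf_families"
    by metis
  have "((\<lambda>t. c * complex_of_real (snd z $ i) * G z t) has_derivative (\<lambda>h. c * complex_of_real (snd z $ i) * D z x h)) (at x)" for z x
    by (intro has_derivative_mult_right D)
  moreover have "(\<lambda>z x. c * complex_of_real (snd z $ i) * D z x (axis j 1)) \<in> tf_families" for j
    by (intro tf_families.mult D)
  ultimately show ?case
    by (intro exI[of _ "\<lambda>z x h. c * complex_of_real (snd z $ i) * D z x h"]) blast
next
  case (add G H)
  then obtain D E where D: "\<And>z x. (G z has_derivative D z x) (at x)" "\<And>i. (\<lambda>z x. D z x (axis i 1)) \<in> tf_families"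
      "\<And>z x. (H z has_derivative E z x) (at x)" "\<And>i. (\<lambda>z x. E z x (axis i 1)) \<in> tf_families"
    by metis
  then show ?case
    by (intro exI[of _ "\<lambda>z x h. D z x h + E z x h"]) (auto intro!: has_derivative_add tf_families.add)
qed

lemma tf_families_partial_deriv:
  fixes G :: "(real^'n) \<times> (real^'n) \<Rightarrow> real^'n \<Rightarrow> complex"
  assumes "G \<in> tf_families"
  shows "(\<lambda>z. partial_deriv i (G z)) \<in> tf_families"
    and "(G z has_derivative (dir_deriv (G z) x)) (at x)"
proof -
  obtain D where D: "\<And>z x. (G z has_derivative D z x) (at x)" "\<And>i. (\<lambda>z x. D z x (axis i 1)) \<in> tf_families"
    using tf_families_has_derivative[OF assms] by metis
  have *: "partial_deriv i (G z) x = D z x (axis i 1)" for i z x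
    by (rule partial_deriv_eq[OF D(1)])
  then have "(\<lambda>z. partial_deriv i (G z)) = (\<lambda>z x. D z x (axis i 1))"
    by (intro ext)
  then show "(\<lambda>z. partial_deriv i (G z)) \<in> tf_families" using D(2) by simp
  have "D z x = (dir_deriv (G z) x)"
    unfolding * using linear_axis_expansion[OF has_derivative_linear[OF D(1)]] by (intro ext)
  then show "(G z has_derivative (dir_deriv (G z) x)) (at x)"
    using D(1)[of z x] by simp
qed

lemma tf_families_iter_deriv: "G \<in> tf_families \<Longrightarrow> (\<lambda>z. iter_deriv \<alpha> (G z)) \<in> tf_families"
  by (induction \<alpha>) (auto intro: tf_families_partial_deriv)

lemma tf_families_smooth:
  fixes G :: "(real^'n) \<times> (real^'n) \<Rightarrow> real^'n \<Rightarrow> complex"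
  assumes "G \<in> tf_families"
  shows "smooth_fun (G z)"
  unfolding smooth_fun_def differentiable_on_def differentiable_def
  using tf_families_partial_deriv(2)[OF tf_families_iter_deriv[OF assms]] has_derivative_at_withinI by blast

text \<open>On the support of the shifted window the norm of t is at most R plus that of the shift,
  so powers of t become powers of z; each coefficient of \<open>mult\<close> adds one degree. Since
  the class is closed under derivatives, all Schwartz seminorms of \<open>G z\<close> grow
  polynomially in z.\<close>

lemma tf_families_bound:
  fixes G :: "(real^'n) \<times> (real^'n) \<Rightarrow> real^'n \<Rightarrow> complex"
  assumes "G \<in> tf_families"
  shows "\<exists>C N. 0 \<le> C \<and> (\<forall>z t. norm t ^ k * norm (G z t) \<le> C * (1 + norm z) ^ N)"
  using assms
proof induction
  case (shift b)
  obtain R where R: "R > 0" "\<And>x. b x \<noteq> 0 \<Longrightarrow> norm x \<le> R"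
    using test_functions_supportE[OF shift] by metis
  obtain B where B: "B > 0" "\<And>x. norm (b x) \<le> B"
    using test_functions_boundedE[OF shift] by metis
  have "norm t ^ k * norm (b (t - fst z) * fourier_char (snd z) t) \<le> ((1 + R) ^ k * B) * (1 + norm z) ^ k" for z t
  proof (cases "b (t - fst z) = 0")
    case False
    have "norm t \<le> norm (t - fst z) + norm (fst z)"
      by (metis add.commute diff_add_cancel norm_triangle_ineq)
    also have "\<dots> \<le> R + norm z"
      using R(2)[OF False] norm_fst_le_norm[of z] by (intro add_mono) auto
    also have "\<dots> \<le> (1 + R) * (1 + norm z)"
      using R(1) by (simp add: algebra_simps)
    finally have "norm t ^ k \<le> ((1 + R) * (1 + norm z)) ^ k"
      by (intro power_mono) auto
    then have "norm t ^ k * norm (b (t - fst z) * fourier_char (snd z) t) \<le> ((1 + R) * (1 + norm z)) ^ k * B"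
      using B R(1) by (simp add: norm_mult mult_mono)
    then show ?thesis by (simp add: power_mult_distrib mult_ac)
  qed (use R B in auto)
  moreover have "0 \<le> (1 + R) ^ k * B" using R B by simp
  ultimately show ?case by blast
next
  case (mult G c i)
  then obtain C N where CN: "0 \<le> C" "\<And>z t. norm t ^ k * norm (G z t) \<le> C * (1 + norm z) ^ N"
    by metis
  have "norm t ^ k * norm (c * complex_of_real (snd z $ i) * G z t) \<le> (norm c * C) * (1 + norm z) ^ Suc N" for z t
  proof -
    have "\<bar>snd z $ i\<bar> \<le> 1 + norm z"
      using component_le_norm_cart[of "snd z" i] norm_snd_le_norm[of z] by linarith
    then have "norm c * \<bar>snd z $ i\<bar> * (norm t ^ k * norm (G z t)) \<le> norm c * (1 + norm z) * (C * (1 + norm z) ^ N)"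
      by (intro mult_mono CN) auto
    then show ?thesis by (simp add: norm_mult mult_ac)
  qed
  moreover have "0 \<le> norm c * C" using CN by simp
  ultimately show ?case by blast
next
  case (add G H)
  from add.IH obtain C N C' N' where CN: "0 \<le> C" "\<And>z t. norm t ^ k * norm (G z t) \<le> C * (1 + norm z) ^ N"
      "0 \<le> C'" "\<And>z t. norm t ^ k * norm (H z t) \<le> C' * (1 + norm z) ^ N'"
    by blast
  have "norm t ^ k * norm (G z t + H z t) \<le> (C + C') * (1 + norm z) ^ max N N'" for z t
  proof -
    have "norm t ^ k * norm (G z t + H z t) \<le> norm t ^ k * (norm (G z t) + norm (H z t))"
      by (intro mult_left_mono norm_triangle_ineq) auto
    also have "\<dots> \<le> C * (1 + norm z) ^ N + C' * (1 + norm z) ^ N'"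
      using CN(2,4)[of t z] by (simp add: distrib_left)
    also have "\<dots> \<le> C * (1 + norm z) ^ max N N' + C' * (1 + norm z) ^ max N N'"
      by (intro add_mono mult_left_mono power_increasing CN) auto
    finally show ?thesis by (simp add: distrib_right)
  qed
  moreover have "0 \<le> C + C'" using CN by simp
  ultimately show ?case by blast
qed

text \<open>The quantitative form of continuity of z to \<open>G z\<close> in every Schwartz
  seminorm. It makes \<open>u (G z)\<close> continuous and controls the error when the parameter map
  is replaced by simple functions.\<close>

lemma tf_families_lipschitz:
  fixes G :: "(real^'n) \<times> (real^'n) \<Rightarrow> real^'n \<Rightarrow> complex"
  assumes "G \<in> tf_families"
  shows "\<exists>C N. 0 \<le> C \<and> (\<forall>z z' t. norm t ^ k * norm (G z t - G z' t) \<le> C * norm (z - z') * (1 + norm z + norm z') ^ N)"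
  using assms
proof induction
  case (shift b)
  obtain R where R: "R > 0" "\<And>x. b x \<noteq> 0 \<Longrightarrow> norm x \<le> R"
    using test_functions_supportE[OF shift] by metis
  obtain B where B: "B > 0" "\<And>x. norm (b x) \<le> B"
    using test_functions_boundedE[OF shift] by metis
  obtain L where L: "L > 0" "\<And>x y. norm (b x - b y) \<le> L * norm (x - y)"
    using test_functions_lipschitzE[OF shift] by metis
  define C where "C = (1 + R) ^ k * (L + B * (2 * pi * (1 + R)))"
  have "norm t ^ k * norm (b (t - fst z) * fourier_char (snd z) t - b (t - fst z') * fourier_char (snd z') t)
      \<le> C * norm (z - z') * (1 + norm z + norm z') ^ Suc k" (is "_ * norm ?d \<le> _") for z z' t
  proof (cases "b (t - fst z) = 0 \<and> b (t - fst z') = 0")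
    case False
    let ?X = "1 + norm z + norm z'"
    have X: "1 \<le> ?X" by simp
    have "norm (t - fst z) \<le> R \<or> norm (t - fst z') \<le> R"
      using R(2) False by blast
    moreover have "norm t \<le> norm (t - fst z) + norm (fst z)" "norm t \<le> norm (t - fst z') + norm (fst z')"
      by (metis add.commute diff_add_cancel norm_triangle_ineq)+
    moreover have "norm (fst z) \<le> norm z" "norm (fst z') \<le> norm z'"
      by (rule norm_fst_le_norm)+
    ultimately have "norm t \<le> R + norm z + norm z'"
      using norm_ge_zero[of z] norm_ge_zero[of z'] by linarith
    also have "\<dots> \<le> (1 + R) * ?X"
      using R(1) by (simp add: algebra_simps)
    finally have t: "norm t \<le> (1 + R) * ?X" .
    \<comment> \<open>Position and frequency are changed one at a time: the window is Lipschitz, and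
      the character is Lipschitz in its frequency with a constant growing like the norm of
      t.\<close>
    have "?d = (b (t - fst z) - b (t - fst z')) * fourier_char (snd z) t
        + b (t - fst z') * (fourier_char (snd z) t - fourier_char (snd z') t)"
      by (simp add: algebra_simps)
    then have "norm ?d \<le> norm ((b (t - fst z) - b (t - fst z')) * fourier_char (snd z) t)
        + norm (b (t - fst z') * (fourier_char (snd z) t - fourier_char (snd z') t))"
      by (simp only: norm_triangle_ineq)
    also have "\<dots> = norm (b (t - fst z) - b (t - fst z'))
        + norm (b (t - fst z')) * norm (fourier_char (snd z) t - fourier_char (snd z') t)"
      by (simp only: norm_mult norm_fourier_char mult_1_right)
    also have "\<dots> \<le> L * norm (fst z - fst z') + B * (2 * pi * norm t * norm (snd z - snd z'))"
      using L(2)[of "t - fst z" "t - fst z'"] B by (intro add_mono mult_mono norm_fourier_char_diff_le) (auto simp: norm_minus_commute)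
    also have "\<dots> \<le> L * norm (z - z') * ?X + B * (2 * pi * ((1 + R) * ?X) * norm (z - z'))"
    proof (rule add_mono)
      have "norm (fst z - fst z') \<le> norm (z - z')" using norm_fst_le_norm[of "z - z'"] by simp
      then have "L * norm (fst z - fst z') * 1 \<le> L * norm (z - z') * ?X"
        using L X by (intro mult_mono) auto
      then show "L * norm (fst z - fst z') \<le> L * norm (z - z') * ?X" by simp
      have "norm (snd z - snd z') \<le> norm (z - z')" using norm_snd_le_norm[of "z - z'"] by simp
      then show "B * (2 * pi * norm t * norm (snd z - snd z')) \<le> B * (2 * pi * ((1 + R) * ?X) * norm (z - z'))"
        using t R B by (intro mult_left_mono mult_mono) auto
    qed
    also have "\<dots> = (L + B * (2 * pi * (1 + R))) * norm (z - z') * ?X"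
      by (simp add: algebra_simps)
    finally have "norm t ^ k * norm ?d \<le> ((1 + R) * ?X) ^ k * ((L + B * (2 * pi * (1 + R))) * norm (z - z') * ?X)"
      using t R by (intro mult_mono power_mono) auto
    then show ?thesis by (simp add: C_def power_mult_distrib mult_ac)
  qed (use R B L in \<open>auto simp: C_def\<close>)
  moreover have "0 \<le> C" using R B L by (simp add: C_def)
  ultimately show ?case by blast
next
  case (mult G c i)
  then obtain C N where CN: "0 \<le> C" "\<And>z z' t. norm t ^ k * norm (G z t - G z' t) \<le> C * norm (z - z') * (1 + norm z + norm z') ^ N"
    by metis
  obtain C' N' where CN': "0 \<le> C'" "\<And>z t. norm t ^ k * norm (G z t) \<le> C' * (1 + norm z) ^ N'"
    using tf_families_bound[OF mult.hyps] by metis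
  have "norm t ^ k * norm (c * complex_of_real (snd z $ i) * G z t - c * complex_of_real (snd z' $ i) * G z' t)
      \<le> (norm c * (C + C')) * norm (z - z') * (1 + norm z + norm z') ^ Suc (max N N')" (is "_ * norm ?d \<le> _") for z z' t
  proof -
    let ?X = "1 + norm z + norm z'"
    have X: "1 \<le> ?X" by simp
    have z: "\<bar>snd z $ i\<bar> \<le> ?X"
      using component_le_norm_cart[of "snd z" i] norm_snd_le_norm[of z] norm_ge_zero[of z'] by linarith
    have zz: "\<bar>snd z $ i - snd z' $ i\<bar> \<le> norm (z - z')"
      using component_le_norm_cart[of "snd (z - z')" i] norm_snd_le_norm[of "z - z'"] by simp
    have eq: "?d = c * (complex_of_real (snd z $ i) * (G z t - G z' t) + complex_of_real (snd z $ i - snd z' $ i) * G z' t)"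
      by (simp add: algebra_simps)
    have "norm ?d \<le> norm c * (\<bar>snd z $ i\<bar> * norm (G z t - G z' t) + \<bar>snd z $ i - snd z' $ i\<bar> * norm (G z' t))"
    proof -
      have "norm (u + v) \<le> norm u + norm v" for u v :: complex
        by (rule norm_triangle_ineq)
      from this[of "complex_of_real (snd z $ i) * (G z t - G z' t)" "complex_of_real (snd z $ i - snd z' $ i) * G z' t"]
      have "norm (complex_of_real (snd z $ i) * (G z t - G z' t) + complex_of_real (snd z $ i - snd z' $ i) * G z' t)
          \<le> \<bar>snd z $ i\<bar> * norm (G z t - G z' t) + \<bar>snd z $ i - snd z' $ i\<bar> * norm (G z' t)"
        by (simp only: norm_mult norm_of_real)
      then have "norm (c * (complex_of_real (snd z $ i) * (G z t - G z' t) + complex_of_real (snd z $ i - snd z' $ i) * G z' t))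
          \<le> norm c * (\<bar>snd z $ i\<bar> * norm (G z t - G z' t) + \<bar>snd z $ i - snd z' $ i\<bar> * norm (G z' t))"
        unfolding norm_mult[of c] by (rule mult_left_mono) simp
      then show ?thesis by (simp only: eq)
    qed
    then have "norm t ^ k * norm ?d \<le> norm t ^ k * (norm c * (\<bar>snd z $ i\<bar> * norm (G z t - G z' t) + \<bar>snd z $ i - snd z' $ i\<bar> * norm (G z' t)))"
      by (intro mult_left_mono) auto
    also have "\<dots> = norm c * (\<bar>snd z $ i\<bar> * (norm t ^ k * norm (G z t - G z' t)) + \<bar>snd z $ i - snd z' $ i\<bar> * (norm t ^ k * norm (G z' t)))"
      by (simp add: algebra_simps)
    also have "\<dots> \<le> norm c * (?X * (C * norm (z - z') * ?X ^ max N N') + norm (z - z') * (C' * ?X ^ max N N' * ?X))"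
    proof (rule mult_left_mono[OF add_mono])
      have "norm t ^ k * norm (G z t - G z' t) \<le> C * norm (z - z') * ?X ^ max N N'"
        by (rule order_trans[OF CN(2)]) (intro mult_left_mono power_increasing X; use CN in simp)
      then show "\<bar>snd z $ i\<bar> * (norm t ^ k * norm (G z t - G z' t)) \<le> ?X * (C * norm (z - z') * ?X ^ max N N')"
        by (rule mult_mono[OF z]) auto
      have "norm t ^ k * norm (G z' t) \<le> C' * (1 + norm z') ^ N'" by (rule CN')
      also have "\<dots> \<le> C' * ?X ^ N'"
        using CN' by (intro mult_left_mono power_mono) auto
      also have "\<dots> \<le> C' * ?X ^ max N N'"
        using CN' by (intro mult_left_mono power_increasing X) auto
      also have "\<dots> \<le> C' * ?X ^ max N N' * ?X"
        using mult_left_mono[OF X, of "C' * ?X ^ max N N'"] CN' by simp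
      finally show "\<bar>snd z $ i - snd z' $ i\<bar> * (norm t ^ k * norm (G z' t)) \<le> norm (z - z') * (C' * ?X ^ max N N' * ?X)"
        by (rule mult_mono[OF zz]) auto
    qed auto
    also have "\<dots> = (norm c * (C + C')) * norm (z - z') * ?X ^ Suc (max N N')"
      by (simp add: algebra_simps)
    finally show ?thesis .
  qed
  moreover have "0 \<le> norm c * (C + C')" using CN CN' by simp
  ultimately show ?case by blast
next
  case (add G H)
  from add.IH obtain C N C' N' where CN: "0 \<le> C" "\<And>z z' t. norm t ^ k * norm (G z t - G z' t) \<le> C * norm (z - z') * (1 + norm z + norm z') ^ N"
      "0 \<le> C'" "\<And>z z' t. norm t ^ k * norm (H z t - H z' t) \<le> C' * norm (z - z') * (1 + norm z + norm z') ^ N'"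
    by blast
  have "norm t ^ k * norm ((G z t + H z t) - (G z' t + H z' t)) \<le> (C + C') * norm (z - z') * (1 + norm z + norm z') ^ max N N'" for z z' t
  proof -
    let ?X = "1 + norm z + norm z'"
    have "norm t ^ k * norm ((G z t + H z t) - (G z' t + H z' t)) \<le> norm t ^ k * (norm (G z t - G z' t) + norm (H z t - H z' t))"
      by (intro mult_left_mono norm_diff_triangle_ineq) auto
    also have "\<dots> \<le> C * norm (z - z') * ?X ^ N + C' * norm (z - z') * ?X ^ N'"
      using CN(2,4)[of t z z'] by (simp add: distrib_left)
    also have "\<dots> \<le> C * norm (z - z') * ?X ^ max N N' + C' * norm (z - z') * ?X ^ max N N'"
      by (intro add_mono mult_left_mono power_increasing mult_nonneg_nonneg CN) auto
    finally show ?thesis by (simp add: distrib_right)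
  qed
  moreover have "0 \<le> C + C'" using CN by simp
  ultimately show ?case by blast
qed

text \<open>A quadratic remainder that is uniform in position and polynomial in z, hence integrable
  against weights with moments; it allows differentiation under the integral.\<close>

lemma tf_families_taylor:
  fixes G :: "(real^'n) \<times> (real^'n) \<Rightarrow> real^'n \<Rightarrow> complex"
  assumes "G \<in> tf_families"
  shows "\<exists>C N. 0 \<le> C \<and> (\<forall>z x y. norm (G z y - G z x - (dir_deriv (G z) x (y - x)))
    \<le> C * (1 + norm z) ^ N * norm (y - x) ^ 2)"
proof -
  have "\<exists>C N. 0 \<le> C \<and> (\<forall>z t. norm (partial_deriv i (partial_deriv j (G z)) t) \<le> C * (1 + norm z) ^ N)" for i j
    using tf_families_bound[OF tf_families_partial_deriv(1)[OF tf_families_partial_deriv(1)[OF assms]], of 0 i j] by simp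
  then obtain C0 N0 where C0: "\<And>i j. 0 \<le> C0 i j" "\<And>i j z t. norm (partial_deriv i (partial_deriv j (G z)) t) \<le> C0 i j * (1 + norm z) ^ N0 i j"
    by metis
  define C where "C = (\<Sum>(i,j)\<in>UNIV. C0 i j)"
  define N where "N = (\<Sum>(i,j)\<in>UNIV. N0 i j)"
  have second: "norm (partial_deriv i (partial_deriv j (G z)) t) \<le> C * (1 + norm z) ^ N" for i j z t
  proof -
    have "C0 i j \<le> C"
      unfolding C_def using member_le_sum[of "(i, j)" UNIV "\<lambda>(i,j). C0 i j"] C0 by auto
    moreover have "N0 i j \<le> N"
      unfolding N_def using member_le_sum[of "(i, j)" UNIV "\<lambda>(i,j). N0 i j"] by auto
    ultimately have "C0 i j * (1 + norm z) ^ N0 i j \<le> C * (1 + norm z) ^ N"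
      using C0(1)[of i j] by (intro mult_mono power_increasing) auto
    with C0(2) show ?thesis by (rule order_trans)
  qed
  have first: "norm (partial_deriv j (G z) y - partial_deriv j (G z) x) \<le> CARD('n) * (C * (1 + norm z) ^ N) * norm (y - x)" for j z x y
  proof (rule differentiable_bound[OF convex_UNIV])
    show "(partial_deriv j (G z) has_derivative (dir_deriv (partial_deriv j (G z)) v)) (at v within UNIV)" for v
      by (rule tf_families_partial_deriv(2)[OF tf_families_partial_deriv(1)[OF assms]])
    show "onorm (dir_deriv (partial_deriv j (G z)) v) \<le> CARD('n) * (C * (1 + norm z) ^ N)" for v
      by (rule onorm_axis_sum_le) (rule second)
  qed auto
  have "norm (G z y - G z x - (dir_deriv (G z) x (y - x)))
    \<le> (CARD('n) * (CARD('n) * C)) * (1 + norm z) ^ N * norm (y - x) ^ 2" for z x y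
  proof -
    let ?K = "CARD('n) * (CARD('n) * (C * (1 + norm z) ^ N) * norm (y - x))"
    have "norm (G z y - G z x - (dir_deriv (G z) x (y - x))) \<le> norm (y - x) * ?K"
    proof (rule differentiable_bound_linearization[where S = "closed_segment x y"])
      show "x + t *\<^sub>R (y - x) \<in> closed_segment x y" if "t \<in> {0..1}" for t
        using that by (auto simp: closed_segment_def algebra_simps intro!: exI[of _ t])
      show "(G z has_derivative (dir_deriv (G z) v)) (at v within closed_segment x y)" for v
        by (rule has_derivative_at_withinI[OF tf_families_partial_deriv(2)[OF assms]])
      show "onorm ((dir_deriv (G z) v) - (dir_deriv (G z) x)) \<le> ?K"
        if "v \<in> closed_segment x y" for v
      proof -
        have "(dir_deriv (G z) v) - (dir_deriv (G z) x)
          = (\<lambda>h. \<Sum>j\<in>UNIV. complex_of_real (h $ j) * (partial_deriv j (G z) v - partial_deriv j (G z) x))"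
          by (simp add: fun_eq_iff sum_subtractf right_diff_distrib)
        moreover have "norm (partial_deriv j (G z) v - partial_deriv j (G z) x) \<le> CARD('n) * (C * (1 + norm z) ^ N) * norm (y - x)" for j
        proof -
          have "norm (v - x) \<le> norm (y - x)"
            using segment_bound(1)[OF that] by (simp add: norm_minus_commute)
          then show ?thesis
            using C0 by (intro order_trans[OF first] mult_left_mono mult_nonneg_nonneg) (auto simp: C_def intro!: sum_nonneg)
        qed
        ultimately show ?thesis
          by (simp only: onorm_axis_sum_le)
      qed
    qed auto
    then show ?thesis by (simp add: power2_eq_square mult_ac)
  qed
  moreover have "0 \<le> CARD('n) * (CARD('n) * C)"
    using C0 by (auto simp: C_def intro!: sum_nonneg mult_nonneg_nonneg)
  ultimately show ?thesis by blast
qed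


lemma tf_families_measurable: "G \<in> tf_families \<Longrightarrow> (\<lambda>z. G z t) \<in> borel_measurable borel"
proof (induction rule: tf_families.induct)
  case (shift b)
  have [measurable]: "b \<in> borel_measurable borel"
    by (intro smooth_fun_measurable test_functions_smooth shift)
  show ?case by (simp add: borel_prod[symmetric])
next
  case (mult G c i)
  then have [measurable]: "(\<lambda>z. G z t) \<in> borel_measurable borel" by simp
  have "(\<lambda>z :: (real^'a) \<times> (real^'a). snd z $ i) \<in> borel_measurable borel"
    by (intro borel_measurable_continuous_onI continuous_intros)
  then show ?case by measurable
next
  case (add G H)
  then show ?case by simp
qed

text \<open>Everything about the families grows at most polynomially in z, so finite moments of all
  orders of \<open>Z\<close> under the weight \<open>w\<close> are what makes each integral below
  converge.\<close>

definition moments_integrable :: "'m measure \<Rightarrow> ('m \<Rightarrow> complex) \<Rightarrow> ('m \<Rightarrow> 'a::euclidean_space) \<Rightarrow> bool" where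
  "moments_integrable M w Z \<longleftrightarrow> w \<in> borel_measurable M \<and> Z \<in> borel_measurable M \<and>
     (\<forall>N. integrable M (\<lambda>m. norm (w m) * (1 + norm (Z m)) ^ N))"

lemma moments_integrable_bounded:
  assumes "moments_integrable M w Z" and [measurable]: "Z' \<in> borel_measurable M"
    and "0 \<le> a" and le: "\<And>m. m \<in> space M \<Longrightarrow> 1 + norm (Z' m) \<le> a * (1 + norm (Z m))"
  shows "moments_integrable M w Z'"
  unfolding moments_integrable_def
proof (intro conjI allI)
  show [measurable]: "w \<in> borel_measurable M" using assms(1) by (simp add: moments_integrable_def)
  fix N
  have "integrable M (\<lambda>m. a ^ N * (norm (w m) * (1 + norm (Z m)) ^ N))"
    using assms(1) by (simp add: moments_integrable_def)
  then show "integrable M (\<lambda>m. norm (w m) * (1 + norm (Z' m)) ^ N)"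
  proof (rule Bochner_Integration.integrable_bound)
    show "AE m in M. norm (norm (w m) * (1 + norm (Z' m)) ^ N) \<le> norm (a ^ N * (norm (w m) * (1 + norm (Z m)) ^ N))"
    proof (rule AE_I2)
      fix m assume "m \<in> space M"
      then have "(1 + norm (Z' m)) ^ N \<le> (a * (1 + norm (Z m))) ^ N"
        by (intro power_mono le) auto
      then have "norm (w m) * (1 + norm (Z' m)) ^ N \<le> norm (w m) * (a * (1 + norm (Z m))) ^ N"
        by (intro mult_left_mono) auto
      then show "norm (norm (w m) * (1 + norm (Z' m)) ^ N) \<le> norm (a ^ N * (norm (w m) * (1 + norm (Z m)) ^ N))"
        using \<open>0 \<le> a\<close> by (simp add: power_mult_distrib abs_mult mult_ac)
    qed
  qed measurable
qed fact

lemma moments_integrable_bound: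
  fixes f :: "'m \<Rightarrow> complex"
  assumes "moments_integrable M w Z" and [measurable]: "f \<in> borel_measurable M"
    and le: "\<And>m. m \<in> space M \<Longrightarrow> norm (f m) \<le> C * (1 + norm (Z m)) ^ N" and "0 \<le> C"
  shows "integrable M (\<lambda>m. w m * f m)"
    and "norm (\<integral>m. w m * f m \<partial>M) \<le> C * (\<integral>m. norm (w m) * (1 + norm (Z m)) ^ N \<partial>M)"
proof -
  have [measurable]: "w \<in> borel_measurable M" and i: "integrable M (\<lambda>m. norm (w m) * (1 + norm (Z m)) ^ N)"
    using assms(1) by (simp_all add: moments_integrable_def)
  have le': "norm (w m * f m) \<le> C * (norm (w m) * (1 + norm (Z m)) ^ N)" if "m \<in> space M" for m
    using mult_left_mono[OF le[OF that], of "norm (w m)"] by (simp add: norm_mult mult_ac)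
  show int: "integrable M (\<lambda>m. w m * f m)"
    by (rule Bochner_Integration.integrable_bound[OF integrable_mult_right[OF i, of C]])
       (use le' \<open>0 \<le> C\<close> in \<open>auto simp: abs_mult\<close>)
  have "norm (\<integral>m. w m * f m \<partial>M) \<le> (\<integral>m. C * (norm (w m) * (1 + norm (Z m)) ^ N) \<partial>M)"
    using int i le' by (intro order_trans[OF integral_norm_bound] integral_mono) auto
  then show "norm (\<integral>m. w m * f m \<partial>M) \<le> C * (\<integral>m. norm (w m) * (1 + norm (Z m)) ^ N \<partial>M)"
    by simp
qed

definition superpose :: "'m measure \<Rightarrow> ('m \<Rightarrow> complex) \<Rightarrow> ('m \<Rightarrow> (real^'n) \<times> (real^'n)) \<Rightarrow>
    ((real^'n) \<times> (real^'n) \<Rightarrow> real^'n \<Rightarrow> complex) \<Rightarrow> real^'n \<Rightarrow> complex" where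
  "superpose M w Z G t = (\<integral>m. w m * G (Z m) t \<partial>M)"

lemma superpose_integrable:
  assumes "moments_integrable M w Z" "G \<in> tf_families"
  shows "integrable M (\<lambda>m. w m * G (Z m) t)"
proof -
  obtain C N where "0 \<le> C" "\<And>z t. norm t ^ 0 * norm (G z t) \<le> C * (1 + norm z) ^ N"
    using tf_families_bound[OF assms(2), of 0] by metis
  moreover have "(\<lambda>m. G (Z m) t) \<in> borel_measurable M"
    by (rule measurable_compose[OF _ tf_families_measurable[OF assms(2)]]) (use assms(1) in \<open>simp add: moments_integrable_def\<close>)
  ultimately show ?thesis
    using assms(1) by (intro moments_integrable_bound(1)[of M w Z _ C N]) auto
qed

lemma superpose_has_derivative:
  fixes G :: "(real^'n) \<times> (real^'n) \<Rightarrow> real^'n \<Rightarrow> complex"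
  assumes mom: "moments_integrable M w Z" and G: "G \<in> tf_families"
  shows "(superpose M w Z G has_derivative
    (\<lambda>h. \<Sum>j\<in>UNIV. complex_of_real (h $ j) * superpose M w Z (\<lambda>z. partial_deriv j (G z)) x)) (at x)"
    (is "(_ has_derivative ?D) _")
proof -
  obtain C N where C: "0 \<le> C" and taylor: "\<And>z x y. norm (G z y - G z x - (dir_deriv (G z) x (y - x)))
    \<le> C * (1 + norm z) ^ N * norm (y - x) ^ 2"
    using tf_families_taylor[OF G] by blast
  define I where "I = (\<integral>m. norm (w m) * (1 + norm (Z m)) ^ N \<partial>M)"
  have G': "(\<lambda>z. partial_deriv j (G z)) \<in> tf_families" for j
    by (intro tf_families_partial_deriv G)
  note int = superpose_integrable[OF mom G] superpose_integrable[OF mom G']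
  have meas: "(\<lambda>m. H (Z m) t) \<in> borel_measurable M" if "H \<in> tf_families" for H t
    by (rule measurable_compose[OF _ tf_families_measurable[OF that]]) (use mom in \<open>simp add: moments_integrable_def\<close>)
  \<comment> \<open>Integrating the pointwise Taylor estimate turns the factor depending on z into
    the moment \<open>I\<close>. Divided by the increment, the error is still linear in it and tends
    to 0.\<close>
  have est: "norm ((superpose M w Z G y - superpose M w Z G x) - ?D (y - x)) \<le> C * norm (y - x) ^ 2 * I" for y
  proof -
    let ?r = "\<lambda>m. G (Z m) y - G (Z m) x - (dir_deriv (G (Z m)) x (y - x))"
    have "(superpose M w Z G y - superpose M w Z G x) - ?D (y - x)
        = (\<integral>m. w m * G (Z m) y \<partial>M) - (\<integral>m. w m * G (Z m) x \<partial>M)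
          - (\<Sum>j\<in>UNIV. \<integral>m. complex_of_real ((y - x) $ j) * (w m * partial_deriv j (G (Z m)) x) \<partial>M)"
      by (simp add: superpose_def)
    also have "\<dots> = (\<integral>m. w m * G (Z m) y - w m * G (Z m) x
          - (\<Sum>j\<in>UNIV. complex_of_real ((y - x) $ j) * (w m * partial_deriv j (G (Z m)) x)) \<partial>M)"
      by (simp add: int Bochner_Integration.integral_diff Bochner_Integration.integral_sum)
    also have "\<dots> = (\<integral>m. w m * ?r m \<partial>M)"
      by (simp add: right_diff_distrib sum_distrib_left mult_ac)
    also have "norm \<dots> \<le> (C * norm (y - x) ^ 2) * I"
      unfolding I_def
    proof (rule moments_integrable_bound(2)[OF mom])
      show "?r \<in> borel_measurable M"
        by (intro borel_measurable_diff borel_measurable_sum borel_measurable_times borel_measurable_const meas G G')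
      show "norm (?r m) \<le> C * norm (y - x) ^ 2 * (1 + norm (Z m)) ^ N" for m
        using taylor[of "Z m" y x] by (simp add: mult_ac)
    qed (use C in auto)
    finally show ?thesis .
  qed
  show ?thesis
  proof (rule has_derivativeI_sandwich[of 1])
    show "bounded_linear ?D"
      by (intro bounded_linear_sum bounded_linear_mult_const bounded_linear_compose[OF bounded_linear_of_real bounded_linear_vec_nth])
    show "norm ((superpose M w Z G y - superpose M w Z G x) - ?D (y - x)) / norm (y - x) \<le> C * norm (y - x) * I"
      if "y \<noteq> x" for y
      using est[of y] that by (simp add: divide_le_eq power2_eq_square mult_ac)
    have "((\<lambda>y. C * norm (y - x) * I) \<longlongrightarrow> C * norm (x - x) * I) (at x)"
      by (intro tendsto_intros)
    then show "((\<lambda>y. C * norm (y - x) * I) \<longlongrightarrow> 0) (at x)" by simp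
  qed auto
qed

lemma superpose_iter_deriv:
  assumes "moments_integrable M w Z" "G \<in> tf_families"
  shows "iter_deriv \<alpha> (superpose M w Z G) = superpose M w Z (\<lambda>z. iter_deriv \<alpha> (G z))"
proof (induction \<alpha>)
  case (Cons i \<alpha>)
  have "partial_deriv i (superpose M w Z (\<lambda>z. iter_deriv \<alpha> (G z))) x
      = superpose M w Z (\<lambda>z. partial_deriv i (iter_deriv \<alpha> (G z))) x" for x
    using partial_deriv_eq[OF superpose_has_derivative[OF assms(1) tf_families_iter_deriv[OF assms(2)]], of i]
    by (simp add: axis_def if_distrib[of complex_of_real] if_distrib[of "\<lambda>x. x * _"] cong: if_cong)
  then show ?case
    by (simp add: Cons fun_eq_iff)
qed simp

lemma superpose_schwartz:
  assumes mom: "moments_integrable M w Z" and G: "G \<in> tf_families"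
  shows "superpose M w Z G \<in> schwartz"
  unfolding schwartz_def
proof (intro CollectI conjI allI)
  show "smooth_fun (superpose M w Z G)"
    unfolding smooth_fun_def superpose_iter_deriv[OF assms] differentiable_on_def differentiable_def
    using superpose_has_derivative[OF mom tf_families_iter_deriv[OF G]] has_derivative_at_withinI by blast
  fix k \<alpha>
  let ?H = "\<lambda>z. iter_deriv \<alpha> (G z)"
  have H: "?H \<in> tf_families" by (intro tf_families_iter_deriv G)
  obtain C N where C: "0 \<le> C" "\<And>z t. norm t ^ k * norm (?H z t) \<le> C * (1 + norm z) ^ N"
    using tf_families_bound[OF H, of k] by metis
  have "norm x ^ k * norm (superpose M w Z ?H x) \<le> C * (\<integral>m. norm (w m) * (1 + norm (Z m)) ^ N \<partial>M)" for x
  proof -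
    have "norm x ^ k * norm (superpose M w Z ?H x) = norm (\<integral>m. w m * (complex_of_real (norm x ^ k) * ?H (Z m) x) \<partial>M)"
    proof -
      have "(\<integral>m. w m * (complex_of_real (norm x ^ k) * ?H (Z m) x) \<partial>M) = complex_of_real (norm x ^ k) * superpose M w Z ?H x"
        unfolding superpose_def by (subst integral_mult_right_zero[symmetric]) (simp add: mult_ac)
      then show ?thesis by (simp add: norm_mult norm_power)
    qed
    also have "\<dots> \<le> C * (\<integral>m. norm (w m) * (1 + norm (Z m)) ^ N \<partial>M)"
    proof (rule moments_integrable_bound(2)[OF mom])
      show "(\<lambda>m. complex_of_real (norm x ^ k) * ?H (Z m) x) \<in> borel_measurable M"
        by (intro borel_measurable_times borel_measurable_const, rule measurable_compose[OF _ tf_families_measurable[OF H]])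
           (use mom in \<open>simp add: moments_integrable_def\<close>)
    qed (use C in \<open>auto simp: norm_mult norm_power\<close>)
    finally show ?thesis .
  qed
  then show "bounded (range (\<lambda>x. norm x ^ k * norm (iter_deriv \<alpha> (superpose M w Z G) x)))"
    unfolding superpose_iter_deriv[OF assms] bounded_iff by (auto intro!: exI)
qed


section \<open>Linearity and continuity of tempered distributions\<close>

lemma iter_deriv_linear:
  assumes "smooth_fun \<phi>" "smooth_fun \<psi>"
  shows "iter_deriv \<alpha> (\<lambda>x. \<phi> x + c * \<psi> x) = (\<lambda>x. iter_deriv \<alpha> \<phi> x + c * iter_deriv \<alpha> \<psi> x)"
proof (induction \<alpha>)
  case (Cons i \<alpha>)
  have s: "smooth_fun (iter_deriv \<alpha> \<phi>)" "smooth_fun (iter_deriv \<alpha> \<psi>)"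
    using assms by (induction \<alpha>) (auto intro: smooth_fun_partial_deriv)
  have "partial_deriv i (\<lambda>x. iter_deriv \<alpha> \<phi> x + c * iter_deriv \<alpha> \<psi> x) x
      = partial_deriv i (iter_deriv \<alpha> \<phi>) x + c * partial_deriv i (iter_deriv \<alpha> \<psi>) x" for x
  proof -
    have "((\<lambda>x. iter_deriv \<alpha> \<phi> x + c * iter_deriv \<alpha> \<psi> x) has_derivative
        (\<lambda>h. (dir_deriv (iter_deriv \<alpha> \<phi>) x h)
          + c * (dir_deriv (iter_deriv \<alpha> \<psi>) x h))) (at x)"
      by (intro has_derivative_add has_derivative_mult_right smooth_fun_has_derivative s)
    from partial_deriv_eq[OF this, of i] show ?thesis
      by (simp only: partial_deriv_eq[OF smooth_fun_has_derivative[OF s(1), of x], of i]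
          partial_deriv_eq[OF smooth_fun_has_derivative[OF s(2), of x], of i])
  qed
  then show ?case by (simp add: Cons fun_eq_iff)
qed simp

lemma schwartz_boundE:
  assumes "\<phi> \<in> schwartz"
  obtains B where "\<And>x. norm x ^ k * norm (iter_deriv \<alpha> \<phi> x) \<le> B"
proof -
  have "bounded (range (\<lambda>x. norm x ^ k * norm (iter_deriv \<alpha> \<phi> x)))"
    using assms by (simp add: schwartz_def)
  then obtain B where "\<And>x. norm (norm x ^ k * norm (iter_deriv \<alpha> \<phi> x)) \<le> B"
    unfolding bounded_iff by blast
  then have "norm x ^ k * norm (iter_deriv \<alpha> \<phi> x) \<le> B" for x
    by (smt (verit) norm_of_real real_norm_def)
  then show ?thesis using that by blast
qed

lemma schwartz_linear:
  assumes "\<phi> \<in> schwartz" "\<psi> \<in> schwartz"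
  shows "(\<lambda>x. \<phi> x + c * \<psi> x) \<in> schwartz"
  unfolding schwartz_def
proof (intro CollectI conjI allI)
  have s: "smooth_fun \<phi>" "smooth_fun \<psi>" using assms by (simp_all add: schwartz_def)
  show "smooth_fun (\<lambda>x. \<phi> x + c * \<psi> x)"
    by (intro smooth_fun_add smooth_fun_mult smooth_fun_const s)
  fix k \<alpha>
  obtain B where B: "\<And>x. norm x ^ k * norm (iter_deriv \<alpha> \<phi> x) \<le> B"
    using schwartz_boundE[OF assms(1)] by blast
  obtain B' where B': "\<And>x. norm x ^ k * norm (iter_deriv \<alpha> \<psi> x) \<le> B'"
    using schwartz_boundE[OF assms(2)] by blast
  have "norm x ^ k * norm (iter_deriv \<alpha> \<phi> x + c * iter_deriv \<alpha> \<psi> x) \<le> B + norm c * B'" for x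
  proof -
    have "norm x ^ k * norm (iter_deriv \<alpha> \<phi> x + c * iter_deriv \<alpha> \<psi> x)
        \<le> norm x ^ k * (norm (iter_deriv \<alpha> \<phi> x) + norm c * norm (iter_deriv \<alpha> \<psi> x))"
      by (intro mult_left_mono order_trans[OF norm_triangle_ineq]) (auto simp: norm_mult)
    also have "\<dots> = norm x ^ k * norm (iter_deriv \<alpha> \<phi> x) + norm c * (norm x ^ k * norm (iter_deriv \<alpha> \<psi> x))"
      by (simp add: algebra_simps)
    also have "\<dots> \<le> B + norm c * B'"
      by (intro add_mono mult_left_mono B B') auto
    finally show ?thesis .
  qed
  then show "bounded (range (\<lambda>x. norm x ^ k * norm (iter_deriv \<alpha> (\<lambda>x. \<phi> x + c * \<psi> x) x)))"
    unfolding iter_deriv_linear[OF s] bounded_iff by (auto intro!: exI)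
qed

lemma schwartz_zero: "(\<lambda>x. 0) \<in> schwartz"
  by (intro test_functions_schwartz) (simp add: test_functions_iff smooth_fun_const)

lemma schwartz_seminorm_le:
  assumes "\<And>x. norm x ^ k * norm (iter_deriv \<alpha> \<phi> x) \<le> B"
  shows "schwartz_seminorm k \<alpha> \<phi> \<le> B"
  unfolding schwartz_seminorm_def by (rule cSUP_least) (use assms in auto)

lemma schwartz_seminorm_nonneg:
  assumes "\<phi> \<in> schwartz"
  shows "0 \<le> schwartz_seminorm k \<alpha> \<phi>"
proof -
  have "bdd_above (range (\<lambda>x. norm x ^ k * norm (iter_deriv \<alpha> \<phi> x)))"
    using assms by (auto simp: schwartz_def intro: bounded_imp_bdd_above)
  then show ?thesis
    unfolding schwartz_seminorm_def by (intro cSUP_upper2[of _ _ 0]) auto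
qed

lemma tempered_distr_boundE:
  assumes "tempered_distr u"
  obtains C and F :: "(nat \<times> 'n::finite list) set"
  where "finite F" "0 \<le> C" "\<And>\<phi>. \<phi> \<in> schwartz \<Longrightarrow> norm (u \<phi>) \<le> C * (\<Sum>(k,\<alpha>)\<in>F. schwartz_seminorm k \<alpha> \<phi>)"
proof -
  obtain C N where CN: "\<And>\<phi>. \<phi> \<in> schwartz \<Longrightarrow>
      norm (u \<phi>) \<le> C * (\<Sum>k\<le>N. \<Sum>\<alpha>\<in>{\<alpha>. length \<alpha> \<le> N}. schwartz_seminorm k \<alpha> \<phi>)"
    using assms unfolding tempered_distr_def by blast
  let ?F = "{..N} \<times> {\<alpha>::'n list. length \<alpha> \<le> N}"
  have "finite ?F"
    using finite_lists_length_le[of "UNIV :: 'n set" N] by simp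
  moreover have "norm (u \<phi>) \<le> \<bar>C\<bar> * (\<Sum>(k,\<alpha>)\<in>?F. schwartz_seminorm k \<alpha> \<phi>)" if "\<phi> \<in> schwartz" for \<phi>
  proof -
    have "norm (u \<phi>) \<le> C * (\<Sum>(k,\<alpha>)\<in>?F. schwartz_seminorm k \<alpha> \<phi>)"
      using CN[OF that] by (simp add: sum.cartesian_product)
    also have "\<dots> \<le> \<bar>C\<bar> * (\<Sum>(k,\<alpha>)\<in>?F. schwartz_seminorm k \<alpha> \<phi>)"
      by (intro mult_right_mono sum_nonneg) (auto intro: schwartz_seminorm_nonneg that)
    finally show ?thesis .
  qed
  ultimately show ?thesis using that[of ?F "\<bar>C\<bar>"] by simp
qed

lemma tempered_distr_linear:
  assumes "tempered_distr u" "\<phi> \<in> schwartz" "\<psi> \<in> schwartz"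
  shows "u (\<lambda>x. \<phi> x + c * \<psi> x) = u \<phi> + c * u \<psi>"
proof -
  have "(\<lambda>x. c * \<psi> x) \<in> schwartz"
    using schwartz_linear[OF schwartz_zero assms(3), of c] by simp
  then show ?thesis
    using assms by (simp add: tempered_distr_def)
qed

lemma tempered_distr_sum:
  assumes "tempered_distr u" "finite S" "\<And>v. v \<in> S \<Longrightarrow> \<phi> v \<in> schwartz"
  shows "(\<lambda>x. \<Sum>v\<in>S. c v * \<phi> v x) \<in> schwartz \<and> u (\<lambda>x. \<Sum>v\<in>S. c v * \<phi> v x) = (\<Sum>v\<in>S. c v * u (\<phi> v))"
  using assms(2,3)
proof (induction S)
  case empty
  have "u (\<lambda>x. 0 * 0) = 0 * u (\<lambda>x. 0)"
    by (rule assms(1)[unfolded tempered_distr_def, THEN conjunct2, THEN conjunct1, rule_format, OF schwartz_zero])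
  then show ?case by (simp add: schwartz_zero)
next
  case (insert v S)
  then have "(\<lambda>x. (\<Sum>v\<in>S. c v * \<phi> v x) + c v * \<phi> v x) \<in> schwartz"
    "u (\<lambda>x. (\<Sum>v\<in>S. c v * \<phi> v x) + c v * \<phi> v x) = (\<Sum>v\<in>S. c v * u (\<phi> v)) + c v * u (\<phi> v)"
    by (auto intro: schwartz_linear simp: tempered_distr_linear[OF assms(1)])
  then show ?case using insert by (simp add: add.commute)
qed

lemma tf_families_schwartz:
  assumes "G \<in> tf_families"
  shows "G z \<in> schwartz"
  unfolding schwartz_def
proof (intro CollectI conjI allI)
  show "smooth_fun (G z)" using assms by (rule tf_families_smooth)
  fix k \<alpha>
  obtain C N where "0 \<le> C" "\<And>z t. norm t ^ k * norm (iter_deriv \<alpha> (G z) t) \<le> C * (1 + norm z) ^ N"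
    using tf_families_bound[OF tf_families_iter_deriv[OF assms, of \<alpha>], of k] by metis
  then show "bounded (range (\<lambda>x. norm x ^ k * norm (iter_deriv \<alpha> (G z) x)))"
    unfolding bounded_iff by (intro exI[of _ "C * (1 + norm z) ^ N"]) simp
qed

lemma tempered_distr_bound:
  fixes u :: "'n::finite distr"
  assumes u: "tempered_distr u" and G: "G \<in> tf_families"
  shows "\<exists>C N. 0 \<le> C \<and> (\<forall>z. norm (u (G z)) \<le> C * (1 + norm z) ^ N)"
proof -
  obtain C and F :: "(nat \<times> 'n list) set" where F: "finite F" "0 \<le> C"
    "\<And>\<phi>. \<phi> \<in> schwartz \<Longrightarrow> norm (u \<phi>) \<le> C * (\<Sum>(k,\<alpha>)\<in>F. schwartz_seminorm k \<alpha> \<phi>)"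
    using tempered_distr_boundE[OF u] by metis
  have "\<exists>K N. 0 \<le> K \<and> (\<forall>z. schwartz_seminorm k \<alpha> (G z) \<le> K * (1 + norm z) ^ N)" for k \<alpha>
    using tf_families_bound[OF tf_families_iter_deriv[OF G, of \<alpha>], of k] schwartz_seminorm_le by meson
  then obtain K N where K: "\<And>k \<alpha>. 0 \<le> K k \<alpha>" "\<And>k \<alpha> z. schwartz_seminorm k \<alpha> (G z) \<le> K k \<alpha> * (1 + norm z) ^ N k \<alpha>"
    by metis
  define M where "M = (\<Sum>(k,\<alpha>)\<in>F. N k \<alpha>)"
  have "norm (u (G z)) \<le> (C * (\<Sum>(k,\<alpha>)\<in>F. K k \<alpha>)) * (1 + norm z) ^ M" for z
  proof -
    have "(\<Sum>(k,\<alpha>)\<in>F. schwartz_seminorm k \<alpha> (G z)) \<le> (\<Sum>(k,\<alpha>)\<in>F. K k \<alpha> * (1 + norm z) ^ M)"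
    proof (rule sum_mono, clarify)
      fix k \<alpha> assume "(k, \<alpha>) \<in> F"
      then have "N k \<alpha> \<le> M"
        unfolding M_def using F(1) member_le_sum[of "(k, \<alpha>)" F "\<lambda>(k,\<alpha>). N k \<alpha>"] by auto
      then have "K k \<alpha> * (1 + norm z) ^ N k \<alpha> \<le> K k \<alpha> * (1 + norm z) ^ M"
        using K(1) by (intro mult_left_mono power_increasing) auto
      with K(2) show "schwartz_seminorm k \<alpha> (G z) \<le> K k \<alpha> * (1 + norm z) ^ M"
        by (rule order_trans)
    qed
    then have "C * (\<Sum>(k,\<alpha>)\<in>F. schwartz_seminorm k \<alpha> (G z)) \<le> C * (\<Sum>(k,\<alpha>)\<in>F. K k \<alpha> * (1 + norm z) ^ M)"
      using F(2) by (rule mult_left_mono)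
    also have "\<dots> = (C * (\<Sum>(k,\<alpha>)\<in>F. K k \<alpha>)) * (1 + norm z) ^ M"
      by (simp add: sum_distrib_right case_prod_beta)
    finally show ?thesis
      using F(3)[OF tf_families_schwartz[OF G], of z] by simp
  qed
  moreover have "0 \<le> C * (\<Sum>(k,\<alpha>)\<in>F. K k \<alpha>)"
    using F(2) K(1) by (intro mult_nonneg_nonneg sum_nonneg) auto
  ultimately show ?thesis by blast
qed

lemma tempered_distr_tendsto:
  fixes u :: "'n::finite distr"
  assumes u: "tempered_distr u" and sch: "\<And>j. \<phi> j \<in> schwartz" "\<psi> \<in> schwartz"
    and lim: "\<And>k \<alpha>. \<exists>b. b \<longlonglongrightarrow> 0 \<and> (\<forall>j x. norm x ^ k * norm (iter_deriv \<alpha> (\<phi> j) x - iter_deriv \<alpha> \<psi> x) \<le> b j)"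
  shows "(\<lambda>j. u (\<phi> j)) \<longlonglongrightarrow> u \<psi>"
proof -
  obtain C and F :: "(nat \<times> 'n list) set" where F: "finite F" "0 \<le> C"
    "\<And>\<phi>. \<phi> \<in> schwartz \<Longrightarrow> norm (u \<phi>) \<le> C * (\<Sum>(k,\<alpha>)\<in>F. schwartz_seminorm k \<alpha> \<phi>)"
    using tempered_distr_boundE[OF u] by metis
  obtain b where b: "\<And>k \<alpha>. b k \<alpha> \<longlonglongrightarrow> 0"
    "\<And>k \<alpha> j x. norm x ^ k * norm (iter_deriv \<alpha> (\<phi> j) x - iter_deriv \<alpha> \<psi> x) \<le> b k \<alpha> j"
    using lim by metis
  have le: "norm (u (\<phi> j) - u \<psi>) \<le> C * (\<Sum>(k,\<alpha>)\<in>F. b k \<alpha> j)" for j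
  proof -
    have s: "smooth_fun (\<phi> j)" "smooth_fun \<psi>" using sch by (auto simp: schwartz_def)
    have "u (\<phi> j) - u \<psi> = u (\<lambda>x. \<phi> j x + (-1) * \<psi> x)"
      by (subst tempered_distr_linear[OF u sch(1) sch(2)]) simp
    also have "norm \<dots> \<le> C * (\<Sum>(k,\<alpha>)\<in>F. schwartz_seminorm k \<alpha> (\<lambda>x. \<phi> j x + (-1) * \<psi> x))"
      by (intro F schwartz_linear sch)
    also have "\<dots> \<le> C * (\<Sum>(k,\<alpha>)\<in>F. b k \<alpha> j)"
    proof (intro mult_left_mono[OF sum_mono F(2)], clarify)
      fix k \<alpha>
      show "schwartz_seminorm k \<alpha> (\<lambda>x. \<phi> j x + (-1) * \<psi> x) \<le> b k \<alpha> j"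
        by (rule schwartz_seminorm_le, simp only: iter_deriv_linear[OF s]) (use b(2)[where k=k and \<alpha>=\<alpha> and j=j] in simp)
    qed
    finally show ?thesis .
  qed
  have "(\<lambda>j. C * (\<Sum>x\<in>F. b (fst x) (snd x) j)) \<longlonglongrightarrow> C * (\<Sum>x\<in>F. 0)"
    by (intro tendsto_mult_left tendsto_sum b(1))
  then have "(\<lambda>j. C * (\<Sum>(k,\<alpha>)\<in>F. b k \<alpha> j)) \<longlonglongrightarrow> 0"
    by (simp add: case_prod_beta)
  then have "(\<lambda>j. u (\<phi> j) - u \<psi>) \<longlonglongrightarrow> 0"
    by (rule Lim_null_comparison[OF always_eventually, rotated]) (intro allI le)
  then show ?thesis by (rule LIM_zero_cancel)
qed

lemma tempered_distr_continuous:
  fixes u :: "'n::finite distr"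
  assumes u: "tempered_distr u" and G: "G \<in> tf_families"
  shows "continuous_on UNIV (\<lambda>z. u (G z))"
proof (rule continuous_on_sequentiallyI)
  fix s :: "nat \<Rightarrow> (real^'n) \<times> (real^'n)" and z assume s: "s \<longlonglongrightarrow> z"
  show "(\<lambda>j. u (G (s j))) \<longlonglongrightarrow> u (G z)"
  proof (rule tempered_distr_tendsto[OF u tf_families_schwartz[OF G] tf_families_schwartz[OF G]])
    fix k \<alpha>
    obtain C N where "0 \<le> C" "\<And>z z' t. norm t ^ k * norm (iter_deriv \<alpha> (G z) t - iter_deriv \<alpha> (G z') t)
        \<le> C * norm (z - z') * (1 + norm z + norm z') ^ N"
      using tf_families_lipschitz[OF tf_families_iter_deriv[OF G, of \<alpha>], of k] by metis
    moreover have "(\<lambda>j. C * norm (s j - z) * (1 + norm (s j) + norm z) ^ N) \<longlonglongrightarrow> C * norm (z - z) * (1 + norm z + norm z) ^ N"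
      by (intro tendsto_intros s)
    ultimately show "\<exists>b. b \<longlonglongrightarrow> 0 \<and> (\<forall>j x. norm x ^ k * norm (iter_deriv \<alpha> (G (s j)) x - iter_deriv \<alpha> (G z) x) \<le> b j)"
      by (intro exI[of _ "\<lambda>j. C * norm (s j - z) * (1 + norm (s j) + norm z) ^ N"]) simp
  qed
qed

text \<open>Approximating \<open>Z\<close> by simple functions turns the superposition into finite sums, which
  commute with \<open>u\<close> by linearity.\<close>

lemma tempered_distr_superpose:
  fixes u :: "'n::finite distr"
  assumes u: "tempered_distr u" and G: "G \<in> tf_families" and mom: "moments_integrable M w Z"
  shows "integrable M (\<lambda>m. w m * u (G (Z m)))"
    and "u (superpose M w Z G) = (\<integral>m. w m * u (G (Z m)) \<partial>M)"
proof -
  have [measurable]: "w \<in> borel_measurable M" "Z \<in> borel_measurable M"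
    and int_w: "\<And>N. integrable M (\<lambda>m. norm (w m) * (1 + norm (Z m)) ^ N)"
    using mom by (auto simp: moments_integrable_def)
  obtain C0 N0 where C0: "0 \<le> C0" "\<And>z. norm (u (G z)) \<le> C0 * (1 + norm z) ^ N0"
    using tempered_distr_bound[OF u G] by metis
  have uG [measurable]: "(\<lambda>z. u (G z)) \<in> borel_measurable borel"
    by (intro borel_measurable_continuous_onI tempered_distr_continuous u G)
  show "integrable M (\<lambda>m. w m * u (G (Z m)))"
    by (rule moments_integrable_bound(1)[OF mom _ C0(2) C0(1)]) measurable
  \<comment> \<open>The bound of \<open>s j\<close> by twice the norm of \<open>Z\<close> gives all
    dominated convergences below a majorant that does not depend on \<open>j\<close>.\<close>
  obtain s where s: "\<And>j. simple_function M (s j)" "\<And>m. m \<in> space M \<Longrightarrow> (\<lambda>j. s j m) \<longlonglongrightarrow> Z m"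
    "\<And>j m. m \<in> space M \<Longrightarrow> norm (s j m) \<le> 2 * norm (Z m)"
    using borel_measurable_implies_sequence_metric[of Z M 0] by auto metis
  have [measurable]: "s j \<in> borel_measurable M" for j
    using s(1) by (rule borel_measurable_simple_function)
  have mom_s: "moments_integrable M w (s j)" for j
  proof (rule moments_integrable_bounded[OF mom])
    show "1 + norm (s j m) \<le> 2 * (1 + norm (Z m))" if "m \<in> space M" for m
      using s(3)[OF that, of j] by simp
  qed auto
  have "(\<lambda>j. u (superpose M w (s j) G)) \<longlonglongrightarrow> u (superpose M w Z G)"
  proof (rule tempered_distr_tendsto[OF u superpose_schwartz[OF mom_s G] superpose_schwartz[OF mom G]])
    fix k \<alpha>
    let ?H = "\<lambda>z. iter_deriv \<alpha> (G z)"
    have H: "?H \<in> tf_families" by (intro tf_families_iter_deriv G)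
    obtain C N where C: "0 \<le> C" "\<And>z z' t. norm t ^ k * norm (?H z t - ?H z' t) \<le> C * norm (z - z') * (1 + norm z + norm z') ^ N"
      using tf_families_lipschitz[OF H, of k] by metis
    \<comment> \<open>The Lipschitz bound on the difference of the integrands with the power of x
      already absorbed. Its integral therefore bounds the seminorm at all points at once.\<close>
    let ?e = "\<lambda>j m. norm (w m) * (C * norm (s j m - Z m) * (1 + norm (s j m) + norm (Z m)) ^ N)"
    define b where "b j = (\<integral>m. ?e j m \<partial>M)" for j
    have bound: "norm (?e j m)
        \<le> (3 * C * 3 ^ N) * (norm (w m) * (1 + norm (Z m)) ^ Suc N)" if "m \<in> space M" for m j
    proof -
      have "norm (s j m - Z m) \<le> 3 * (1 + norm (Z m))"
        using s(3)[OF that, of j] by (intro order_trans[OF norm_triangle_ineq4]) simp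
      moreover have "(1 + norm (s j m) + norm (Z m)) ^ N \<le> (3 * (1 + norm (Z m))) ^ N"
        using s(3)[OF that, of j] by (intro power_mono) auto
      moreover define X where "X = 1 + norm (Z m)"
      ultimately have "norm (s j m - Z m) * (1 + norm (s j m) + norm (Z m)) ^ N \<le> (3 * X) * (3 * X) ^ N"
        by (intro mult_mono) auto
      then have "(norm (w m) * C) * (norm (s j m - Z m) * (1 + norm (s j m) + norm (Z m)) ^ N)
          \<le> (norm (w m) * C) * ((3 * X) * (3 * X) ^ N)"
        using C(1) by (intro mult_left_mono) auto
      then show ?thesis
        unfolding X_def[symmetric] using C(1) by (simp add: abs_mult power_mult_distrib mult_ac)
    qed
    have int_dom: "integrable M (\<lambda>m. (3 * C * 3 ^ N) * (norm (w m) * (1 + norm (Z m)) ^ Suc N))"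
      by (intro integrable_mult_right int_w)
    have "b \<longlonglongrightarrow> (\<integral>m. 0 \<partial>M)"
      unfolding b_def[abs_def]
    proof (rule integral_dominated_convergence[OF _ _ int_dom])
      show "AE m in M. (\<lambda>j. ?e j m) \<longlonglongrightarrow> 0"
      proof (rule AE_I2)
        fix m assume "m \<in> space M"
        then have "(\<lambda>j. ?e j m)
            \<longlonglongrightarrow> norm (w m) * (C * norm (Z m - Z m) * (1 + norm (Z m) + norm (Z m)) ^ N)"
          by (intro tendsto_intros s)
        then show "(\<lambda>j. ?e j m) \<longlonglongrightarrow> 0" by simp
      qed
    qed (use bound in auto)
    moreover have "norm x ^ k * norm (iter_deriv \<alpha> (superpose M w (s j) G) x - iter_deriv \<alpha> (superpose M w Z G) x) \<le> b j" for j x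
    proof -
      have "iter_deriv \<alpha> (superpose M w (s j) G) x - iter_deriv \<alpha> (superpose M w Z G) x
          = (\<integral>m. w m * (?H (s j m) x - ?H (Z m) x) \<partial>M)"
        unfolding superpose_iter_deriv[OF mom_s G] superpose_iter_deriv[OF mom G] unfolding superpose_def
        by (simp add: right_diff_distrib Bochner_Integration.integral_diff superpose_integrable[OF mom_s H] superpose_integrable[OF mom H])
      then have "norm x ^ k * norm (iter_deriv \<alpha> (superpose M w (s j) G) x - iter_deriv \<alpha> (superpose M w Z G) x)
          = norm (\<integral>m. complex_of_real (norm x ^ k) * (w m * (?H (s j m) x - ?H (Z m) x)) \<partial>M)"
        by (simp add: norm_mult norm_power)
      also have "\<dots> \<le> b j"
        unfolding b_def
      proof (rule order_trans[OF integral_norm_bound integral_mono])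
        have "integrable M (\<lambda>m. w m * ?H (s j m) x - w m * ?H (Z m) x)"
          by (intro Bochner_Integration.integrable_diff superpose_integrable mom mom_s H)
        then show "integrable M (\<lambda>m. norm (complex_of_real (norm x ^ k) * (w m * (?H (s j m) x - ?H (Z m) x))))"
          by (intro integrable_norm integrable_mult_right) (simp add: right_diff_distrib)
        show "integrable M (\<lambda>m. ?e j m)"
        proof (rule Bochner_Integration.integrable_bound[OF int_dom])
          show "AE m in M. norm (?e j m)
              \<le> norm ((3 * C * 3 ^ N) * (norm (w m) * (1 + norm (Z m)) ^ Suc N))"
            by (intro AE_I2 order_trans[OF bound]) auto
        qed measurable
        fix m assume "m \<in> space M"
        show "norm (complex_of_real (norm x ^ k) * (w m * (?H (s j m) x - ?H (Z m) x)))
            \<le> ?e j m"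
          using mult_left_mono[OF C(2)[of x "s j m" "Z m"], of "norm (w m)"]
          by (simp add: norm_mult norm_power mult_ac)
      qed
      finally show ?thesis .
    qed
    ultimately show "\<exists>b. b \<longlonglongrightarrow> 0 \<and> (\<forall>j x. norm x ^ k * norm (iter_deriv \<alpha> (superpose M w (s j) G) x - iter_deriv \<alpha> (superpose M w Z G) x) \<le> b j)"
      by (intro exI[of _ b]) simp
  qed
  moreover have "u (superpose M w (s j) G) = (\<integral>m. w m * u (G (s j m)) \<partial>M)" for j
  proof -
    let ?S = "s j ` space M"
    have fin: "finite ?S" using s(1)[of j] by (rule simple_functionD)
    have meas [measurable]: "s j -` {v} \<inter> space M \<in> sets M" for v
      using s(1)[of j] by (rule simple_functionD)
    have int: "integrable M (\<lambda>m. w m * indicator (s j -` {v} \<inter> space M) m)" for v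
      by (rule Bochner_Integration.integrable_bound[OF int_w[of 0]]) (auto simp: indicator_def)
    define c where "c v = (\<integral>m. w m * indicator (s j -` {v} \<inter> space M) m \<partial>M)" for v
    have finite_sum: "(\<integral>m. w m * f (s j m) \<partial>M) = (\<Sum>v\<in>?S. c v * f v)" for f :: "_ \<Rightarrow> complex"
    proof -
      have "(\<integral>m. w m * f (s j m) \<partial>M) = (\<integral>m. (\<Sum>v\<in>?S. w m * indicator (s j -` {v} \<inter> space M) m * f v) \<partial>M)"
      proof (rule Bochner_Integration.integral_cong[OF refl])
        fix m assume m: "m \<in> space M"
        have "(\<Sum>v\<in>?S. w m * indicator (s j -` {v} \<inter> space M) m * f v) = (\<Sum>v\<in>?S. if v = s j m then w m * f (s j m) else 0)"
          using m by (intro sum.cong refl) (auto simp: indicator_def)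
        then show "w m * f (s j m) = (\<Sum>v\<in>?S. w m * indicator (s j -` {v} \<inter> space M) m * f v)"
          using fin m by simp
      qed
      also have "\<dots> = (\<Sum>v\<in>?S. c v * f v)"
        by (simp add: c_def int)
      finally show ?thesis .
    qed
    have "superpose M w (s j) G = (\<lambda>t. \<Sum>v\<in>?S. c v * G v t)"
      unfolding superpose_def using finite_sum[of "\<lambda>v. G v _"] by (intro ext)
    then have "u (superpose M w (s j) G) = (\<Sum>v\<in>?S. c v * u (G v))"
      using tempered_distr_sum[OF u fin, of G c] tf_families_schwartz[OF G] by simp
    then show ?thesis
      using finite_sum[of "\<lambda>v. u (G v)"] by simp
  qed
  ultimately have "(\<lambda>j. \<integral>m. w m * u (G (s j m)) \<partial>M) \<longlonglongrightarrow> u (superpose M w Z G)"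
    by simp
  moreover have "(\<lambda>j. \<integral>m. w m * u (G (s j m)) \<partial>M) \<longlonglongrightarrow> (\<integral>m. w m * u (G (Z m)) \<partial>M)"
  proof (rule integral_dominated_convergence)
    show "integrable M (\<lambda>m. (C0 * 2 ^ N0) * (norm (w m) * (1 + norm (Z m)) ^ N0))"
      by (intro integrable_mult_right int_w)
    show "AE m in M. (\<lambda>j. w m * u (G (s j m))) \<longlonglongrightarrow> w m * u (G (Z m))"
    proof (rule AE_I2)
      fix m assume "m \<in> space M"
      then show "(\<lambda>j. w m * u (G (s j m))) \<longlonglongrightarrow> w m * u (G (Z m))"
        by (intro tendsto_mult_left continuous_on_tendsto_compose[OF tempered_distr_continuous[OF u G]] s) auto
    qed
    show "AE m in M. norm (w m * u (G (s j m))) \<le> (C0 * 2 ^ N0) * (norm (w m) * (1 + norm (Z m)) ^ N0)" for j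
    proof (rule AE_I2)
      fix m assume m: "m \<in> space M"
      have "norm (u (G (s j m))) \<le> C0 * (1 + norm (s j m)) ^ N0" by (rule C0)
      moreover define X where "X = 1 + norm (Z m)"
      have "C0 * (1 + norm (s j m)) ^ N0 \<le> C0 * (2 * X) ^ N0"
        unfolding X_def using s(3)[OF m, of j] C0(1) by (intro mult_left_mono power_mono) auto
      ultimately have "norm (w m) * norm (u (G (s j m))) \<le> norm (w m) * (C0 * (2 * X) ^ N0)"
        by (intro mult_left_mono) auto
      then show "norm (w m * u (G (s j m))) \<le> (C0 * 2 ^ N0) * (norm (w m) * (1 + norm (Z m)) ^ N0)"
        unfolding X_def[symmetric] by (simp add: norm_mult power_mult_distrib mult_ac)
    qed
  qed measurable
  ultimately show "u (superpose M w Z G) = (\<integral>m. w m * u (G (Z m)) \<partial>M)"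
    by (rule LIMSEQ_unique)
qed


section \<open>Fourier inversion\<close>

text \<open>Each factor 1 + |x|^2 dominates 1 + x_i^2 for one coordinate, so the function lies below
  a product of integrable functions of one variable.\<close>

lemma integrable_inverse_one_plus_norm_power:
  "integrable lborel (\<lambda>x::real^'n. inverse ((1 + norm x ^ 2) ^ CARD('n)))"
proof (rule integrableI_bounded)
  let ?f = "\<lambda>x::real. inverse (1 + x\<^sup>2)"
  have f: "integrable lborel ?f"
    using integrable_inverse_1_plus_square by (simp add: set_integrable_def einterval_def)
  have "(\<integral>\<^sup>+x. ennreal (inverse ((1 + norm x ^ 2) ^ CARD('n))) \<partial>(lborel :: (real^'n) measure))
      \<le> (\<integral>\<^sup>+x. (\<Prod>b\<in>Basis. ennreal (?f (x \<bullet> b))) \<partial>(lborel :: (real^'n) measure))"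
  proof (rule nn_integral_mono)
    fix x :: "real^'n"
    have "(\<Prod>b\<in>Basis. 1 + (x \<bullet> b)\<^sup>2) \<le> (\<Prod>b\<in>(Basis :: (real^'n) set). 1 + norm x ^ 2)"
      using Basis_le_norm[of _ x] by (intro prod_mono conjI add_left_mono) (auto simp: abs_le_square_iff[symmetric])
    then have "inverse ((1 + norm x ^ 2) ^ CARD('n)) \<le> inverse (\<Prod>b\<in>Basis. 1 + (x \<bullet> b)\<^sup>2)"
      by (intro le_imp_inverse_le) (auto intro!: prod_pos simp: add_pos_nonneg)
    then show "ennreal (inverse ((1 + norm x ^ 2) ^ CARD('n))) \<le> (\<Prod>b\<in>Basis. ennreal (?f (x \<bullet> b)))"
      by (simp add: prod_ennreal prod_inversef[symmetric] o_def ennreal_leI)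
  qed
  also have "\<dots> = (\<Prod>b\<in>(Basis :: (real^'n) set). \<integral>\<^sup>+x. ennreal (?f x) \<partial>lborel)"
    by (rule nn_integral_lborel_prod) auto
  also have "\<dots> = ennreal ((\<integral>x. ?f x \<partial>lborel) ^ CARD('n))"
    using f by (simp add: nn_integral_eq_integral ennreal_power)
  finally show "(\<integral>\<^sup>+x. ennreal (norm (inverse ((1 + norm x ^ 2) ^ CARD('n)))) \<partial>(lborel :: (real^'n) measure)) < \<infinity>"
    by (simp add: le_less_trans)
qed measurable

text \<open>Decay without any condition on derivatives: this is all that is required of a weight,
  and it covers both Schwartz functions and the Fourier transforms of test functions.\<close>

definition rapidly_decreasing :: "(real^'n \<Rightarrow> complex) \<Rightarrow> bool" where
  "rapidly_decreasing \<phi> \<longleftrightarrow> \<phi> \<in> borel_measurable borel \<and> (\<forall>k. \<exists>B. \<forall>x. norm x ^ k * norm (\<phi> x) \<le> B)"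

lemma schwartz_rapidly_decreasing: "\<phi> \<in> schwartz \<Longrightarrow> rapidly_decreasing \<phi>"
  using schwartz_boundE[of \<phi> _ "[]"]
  by (auto simp: rapidly_decreasing_def schwartz_def smooth_fun_measurable) blast

lemma rapidly_decreasing_moments:
  fixes \<phi> :: "real^'n \<Rightarrow> complex"
  assumes "rapidly_decreasing \<phi>"
  shows "moments_integrable lborel \<phi> (\<lambda>x. x)"
  unfolding moments_integrable_def
proof (intro conjI allI)
  show m: "\<phi> \<in> borel_measurable lborel"
    using assms by (simp add: rapidly_decreasing_def)
  fix N
  \<comment> \<open>The exponent 2 CARD('n) pays for the integrable majorant and \<open>N\<close>
    for the moment.\<close>
  let ?L = "2 * CARD('n) + N"
  obtain B0 where B0: "\<And>x. norm x ^ 0 * norm (\<phi> x) \<le> B0"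
    using assms unfolding rapidly_decreasing_def by meson
  obtain B1 where B1: "\<And>x. norm x ^ ?L * norm (\<phi> x) \<le> B1"
    using assms unfolding rapidly_decreasing_def by meson
  have le: "norm (\<phi> x) * (1 + norm x) ^ N \<le> (2 ^ ?L * (B0 + B1)) * inverse ((1 + norm x ^ 2) ^ CARD('n))" for x
  proof -
    have "(1 + norm x ^ 2) ^ CARD('n) \<le> ((1 + norm x) ^ 2) ^ CARD('n)"
      by (intro power_mono) (auto simp: power2_eq_square algebra_simps)
    then have "(1 + norm x ^ 2) ^ CARD('n) * (norm (\<phi> x) * (1 + norm x) ^ N)
        \<le> ((1 + norm x) ^ 2) ^ CARD('n) * (norm (\<phi> x) * (1 + norm x) ^ N)"
      by (intro mult_right_mono) auto
    also have "\<dots> = (1 + norm x) ^ ?L * norm (\<phi> x)"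
      by (simp add: power_mult[symmetric] power_add mult_ac)
    also have "(1 + norm x) ^ ?L \<le> 2 ^ ?L * (1 + norm x ^ ?L)"
    proof (cases "norm x \<le> 1")
      case True
      then have "(1 + norm x) ^ ?L \<le> 2 ^ ?L * 1"
        by (simp add: power_mono)
      also have "\<dots> \<le> 2 ^ ?L * (1 + norm x ^ ?L)"
        by (intro mult_left_mono) auto
      finally show ?thesis .
    next
      case False
      then have "(1 + norm x) ^ ?L \<le> (2 * norm x) ^ ?L"
        by (intro power_mono) auto
      also have "\<dots> \<le> 2 ^ ?L * (1 + norm x ^ ?L)"
        by (simp add: power_mult_distrib)
      finally show ?thesis .
    qed
    then have "(1 + norm x) ^ ?L * norm (\<phi> x) \<le> 2 ^ ?L * (1 + norm x ^ ?L) * norm (\<phi> x)"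
      by (rule mult_right_mono) simp
    also have "\<dots> = 2 ^ ?L * (norm (\<phi> x) + norm x ^ ?L * norm (\<phi> x))"
      by (simp add: algebra_simps)
    also have "\<dots> \<le> 2 ^ ?L * (B0 + B1)"
      using B0[of x] B1[of x] by (intro mult_left_mono add_mono) auto
    finally have "norm (\<phi> x) * (1 + norm x) ^ N * (1 + norm x ^ 2) ^ CARD('n) \<le> 2 ^ ?L * (B0 + B1)"
      by (simp only: mult.commute)
    moreover have "0 < (1 + norm x ^ 2) ^ CARD('n)"
      by (simp add: add_pos_nonneg)
    ultimately show ?thesis
      unfolding divide_inverse[symmetric] by (simp only: pos_le_divide_eq)
  qed
  show "integrable lborel (\<lambda>x. norm (\<phi> x) * (1 + norm x) ^ N)"
  proof (rule Bochner_Integration.integrable_bound[OF integrable_mult_right[OF integrable_inverse_one_plus_norm_power]])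
    show "AE x in lborel. norm (norm (\<phi> x) * (1 + norm x) ^ N) \<le> norm ((2 ^ ?L * (B0 + B1)) * inverse ((1 + norm x ^ 2) ^ CARD('n)))"
    proof (rule AE_I2)
      fix x
      have "norm (norm (\<phi> x) * (1 + norm x) ^ N) = norm (\<phi> x) * (1 + norm x) ^ N"
        by (simp add: abs_mult)
      also have "\<dots> \<le> norm ((2 ^ ?L * (B0 + B1)) * inverse ((1 + norm x ^ 2) ^ CARD('n)))"
        using le[of x] by (rule order_trans) (simp only: real_norm_def abs_ge_self)
      finally show "norm (norm (\<phi> x) * (1 + norm x) ^ N) \<le> norm ((2 ^ ?L * (B0 + B1)) * inverse ((1 + norm x ^ 2) ^ CARD('n)))" .
    qed
  qed (use m in measurable)
qed simp

lemma rapidly_decreasing_integrable: "rapidly_decreasing \<phi> \<Longrightarrow> integrable lborel \<phi>"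
  using rapidly_decreasing_moments[of \<phi>]
  by (auto simp: moments_integrable_def integrable_norm_iff dest: spec[of _ 0])

lemma lborel_integral_affine:
  fixes f :: "'a::euclidean_space \<Rightarrow> complex"
  assumes "c \<noteq> 0" "f \<in> borel_measurable borel"
  shows "(\<integral>x. f x \<partial>lborel) = \<bar>c\<bar> ^ DIM('a) *\<^sub>R (\<integral>x. f (t + c *\<^sub>R x) \<partial>lborel)"
  using assms
  by (subst lborel_affine[OF assms(1), of t]) (simp add: integral_density integral_distr)

text \<open>The integral of \<open>\<phi> (t - m)\<close> over all m does not depend on t.
  Differentiating this constant at t = 0 under the integral gives the claim, and the superposition
  calculus applies because m may be restricted to a ball.\<close>

lemma integral_partial_deriv:
  assumes \<phi>: "\<phi> \<in> test_functions"
  shows "(\<integral>t. partial_deriv i \<phi> t \<partial>lborel) = 0"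
proof -
  let ?G = "\<lambda>z t. \<phi> (t - fst z) * fourier_char (snd z) t"
  obtain R where R: "R > 0" "\<And>x. \<phi> x \<noteq> 0 \<Longrightarrow> norm x \<le> R"
    using test_functions_supportE[OF \<phi>] by metis
  have R': "partial_deriv i \<phi> x \<noteq> 0 \<Longrightarrow> norm x \<le> R" for x
  proof (rule ccontr)
    assume *: "partial_deriv i \<phi> x \<noteq> 0" "\<not> norm x \<le> R"
    have "open (- cball 0 R)" by auto
    then have "(\<phi> has_derivative (\<lambda>h. 0)) (at x)"
      using * R(2) by (intro has_derivative_transform_within_open[OF has_derivative_const[of 0], of "- cball 0 R"]) force+
    with *(1) show False by (simp add: partial_deriv_eq)
  qed
  have meas [measurable]: "\<phi> \<in> borel_measurable borel" "partial_deriv i \<phi> \<in> borel_measurable borel"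
    by (intro smooth_fun_measurable test_functions_smooth test_functions_partial_deriv \<phi>)+
  \<comment> \<open>The additional radius 1 makes the ball contain the support of m to
    \<open>\<phi> (t - m)\<close> for every t in the unit ball, so the superposition is constant
    near 0 and not only at 0.\<close>
  define w where "w m = (indicator (cball 0 (R + 1)) m :: complex)" for m :: "real^'a"
  define Z where "Z m = (m, 0 :: real^'a)" for m :: "real^'a"
  have G: "?G \<in> tf_families" by (rule tf_families.shift[OF \<phi>])
  have mom: "moments_integrable lborel w Z"
    unfolding moments_integrable_def
  proof (intro conjI allI)
    have "Z \<in> borel_measurable borel"
      unfolding Z_def by (intro borel_measurable_continuous_onI continuous_intros)
    then show "Z \<in> borel_measurable lborel" by simp
    show "w \<in> borel_measurable lborel"
      unfolding w_def[abs_def] by (rule borel_measurable_indicator) simp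
    have "compact (cball 0 (R + 1) :: (real^'a) set)" by simp
    then have *: "integrable lborel (\<lambda>m::real^'a. indicator (cball 0 (R + 1)) m *\<^sub>R (1 + norm m) ^ N)" for N
      by (rule borel_integrable_compact) (intro continuous_intros)
    show "integrable lborel (\<lambda>m. norm (w m) * (1 + norm (Z m)) ^ N)" for N
    proof -
      have "(\<lambda>m. norm (w m) * (1 + norm (Z m)) ^ N) = (\<lambda>m. indicator (cball 0 (R + 1)) m *\<^sub>R (1 + norm m) ^ N)"
        by (auto simp: w_def Z_def indicator_def)
      then show ?thesis using * by simp
    qed
  qed
  have reflect: "(\<integral>m. \<psi> (t - m) \<partial>lborel) = (\<integral>s. \<psi> s \<partial>lborel)" if "\<psi> \<in> borel_measurable borel" for \<psi> :: "real^'a \<Rightarrow> complex" and t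
    using lborel_integral_affine[of "-1" \<psi> t] that by simp
  have "superpose lborel w Z ?G t = (\<integral>s. \<phi> s \<partial>lborel)" if "t \<in> ball 0 1" for t
  proof -
    have "superpose lborel w Z ?G t = (\<integral>m. \<phi> (t - m) \<partial>lborel)"
      unfolding superpose_def
    proof (rule Bochner_Integration.integral_cong[OF refl])
      fix m
      show "w m * ?G (Z m) t = \<phi> (t - m)"
      proof (cases "\<phi> (t - m) = 0")
        case False
        have "norm m \<le> norm (t - m) + norm t"
          by (metis norm_minus_commute norm_triangle_sub add.commute)
        with R(2)[OF False] that show ?thesis
          by (auto simp: w_def Z_def indicator_def)
      qed (simp add: Z_def)
    qed
    then show ?thesis by (simp add: reflect)
  qed
  then have "(superpose lborel w Z ?G has_derivative (\<lambda>h. 0)) (at 0)"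
    by (intro has_derivative_transform_within_open[OF has_derivative_const, of "ball 0 1"]) auto
  then have "0 = partial_deriv i (superpose lborel w Z ?G) 0"
    by (simp add: partial_deriv_eq)
  also have "\<dots> = superpose lborel w Z (\<lambda>z. partial_deriv i (?G z)) 0"
    using superpose_iter_deriv[OF mom G, of "[i]"] by simp
  also have "\<dots> = (\<integral>m. partial_deriv i \<phi> (0 - m) \<partial>lborel)"
    unfolding superpose_def
  proof (rule Bochner_Integration.integral_cong[OF refl])
    fix m
    have "((\<lambda>t. \<phi> (t - m)) has_derivative (dir_deriv \<phi> (0 - m))) (at 0)"
      by (rule has_derivative_compose[OF _ smooth_fun_has_derivative[OF test_functions_smooth[OF \<phi>]], of "\<lambda>t. t - m" "\<lambda>h. h" 0 UNIV])
         (auto intro!: derivative_eq_intros)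
    from partial_deriv_eq[OF this, of i]
    have "partial_deriv i (?G (Z m)) 0 = partial_deriv i \<phi> (0 - m)"
      by (simp add: Z_def fourier_char_def axis_def if_distrib[of complex_of_real] if_distrib[of "\<lambda>x. x * _"] cong: if_cong)
    moreover have "partial_deriv i \<phi> (0 - m) \<noteq> 0 \<Longrightarrow> m \<in> cball 0 (R + 1)"
      using R'[of "- m"] by auto
    ultimately show "w m * partial_deriv i (?G (Z m)) 0 = partial_deriv i \<phi> (0 - m)"
      by (auto simp: w_def indicator_def)
  qed
  finally show ?thesis by (simp only: reflect[OF meas(2)])
qed

lemma fourier_eq: "fourier \<phi> \<xi> = (\<integral>t. \<phi> t * fourier_char \<xi> t \<partial>lborel)"
  by (simp add: fourier_def fourier_char_def)

lemma fourier_partial_deriv: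
  assumes \<phi>: "\<phi> \<in> test_functions"
  shows "fourier (partial_deriv i \<phi>) \<xi> = 2 * complex_of_real pi * \<i> * complex_of_real (\<xi> $ i) * fourier \<phi> \<xi>"
proof -
  let ?c = "- 2 * complex_of_real pi * \<i> * complex_of_real (\<xi> $ i)"
  have "partial_deriv i (\<lambda>t. \<phi> t * fourier_char \<xi> t) x
      = ?c * (\<phi> x * fourier_char \<xi> x) + partial_deriv i \<phi> x * fourier_char \<xi> x" for x
    using partial_deriv_eq[OF has_derivative_mult[OF smooth_fun_has_derivative[OF test_functions_smooth[OF \<phi>], of x]
        has_derivative_fourier_char[of \<xi> x]], of i] partial_deriv_eq[OF smooth_fun_has_derivative[OF test_functions_smooth[OF \<phi>], of x], of i]
    by (simp add: inner_axis' algebra_simps)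
  then have "(\<integral>x. ?c * (\<phi> x * fourier_char \<xi> x) + partial_deriv i \<phi> x * fourier_char \<xi> x \<partial>lborel) = 0"
    using integral_partial_deriv[OF test_functions_mult[OF \<phi> smooth_fun_char], of i \<xi>] by simp
  moreover have "integrable lborel (\<lambda>x. \<phi> x * fourier_char \<xi> x)" "integrable lborel (\<lambda>x. partial_deriv i \<phi> x * fourier_char \<xi> x)"
    by (intro test_functions_integrable test_functions_mult test_functions_partial_deriv \<phi> smooth_fun_char)+
  ultimately have "?c * fourier \<phi> \<xi> + fourier (partial_deriv i \<phi>) \<xi> = 0"
    unfolding fourier_eq by (simp only: Bochner_Integration.integral_add integral_mult_right_zero integrable_mult_right)
  then show ?thesis by (simp add: eq_neg_iff_add_eq_0 add.commute)
qed

lemma norm_fourier_le: "norm (fourier \<phi> \<xi>) \<le> (\<integral>t. norm (\<phi> t) \<partial>lborel)"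
  unfolding fourier_eq by (rule order_trans[OF integral_norm_bound]) (simp add: norm_mult)

lemma fourier_measurable:
  assumes [measurable]: "\<phi> \<in> borel_measurable borel"
  shows "fourier \<phi> \<in> borel_measurable borel"
  unfolding fourier_eq[abs_def] by measurable

lemma fourier_rapidly_decreasing:
  fixes \<phi> :: "real^'n \<Rightarrow> complex"
  assumes \<phi>: "\<phi> \<in> test_functions"
  shows "rapidly_decreasing (fourier \<phi>)"
  unfolding rapidly_decreasing_def
proof (intro conjI allI)
  show "fourier \<phi> \<in> borel_measurable borel"
    by (intro fourier_measurable smooth_fun_measurable test_functions_smooth \<phi>)
  fix k
  \<comment> \<open>Differentiating k times in one direction yields decay in the corresponding
    coordinate only; the largest coordinate then controls the norm up to the factor
    CARD('n).\<close>
  have eq: "fourier (iter_deriv (replicate m i) \<phi>) \<xi> = (2 * complex_of_real pi * \<i> * complex_of_real (\<xi> $ i)) ^ m * fourier \<phi> \<xi>" for m i \<xi>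
    by (induction m) (simp_all add: fourier_partial_deriv test_functions_iter_deriv \<phi> mult_ac)
  define B where "B i = (\<integral>t. norm (iter_deriv (replicate k i) \<phi> t) \<partial>lborel)" for i
  have le: "\<bar>\<xi> $ i\<bar> ^ k * norm (fourier \<phi> \<xi>) \<le> B i" for \<xi> i
  proof -
    have "\<bar>\<xi> $ i\<bar> ^ k * norm (fourier \<phi> \<xi>) \<le> (2 * pi * \<bar>\<xi> $ i\<bar>) ^ k * norm (fourier \<phi> \<xi>)"
      using pi_gt3 by (intro mult_right_mono power_mono mult_le_cancel_right1[THEN iffD2]) auto
    also have "\<dots> = norm (fourier (iter_deriv (replicate k i) \<phi>) \<xi>)"
      unfolding eq by (simp add: norm_mult norm_power abs_mult)
    also have "\<dots> \<le> B i" unfolding B_def by (rule norm_fourier_le)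
    finally show ?thesis .
  qed
  show "\<exists>B. \<forall>\<xi>. norm \<xi> ^ k * norm (fourier \<phi> \<xi>) \<le> B"
  proof (intro exI allI)
    fix \<xi> :: "real^'n"
    obtain i where i: "\<And>j. \<bar>\<xi> $ j\<bar> \<le> \<bar>\<xi> $ i\<bar>"
    proof -
      have "Max (range (\<lambda>j. \<bar>\<xi> $ j\<bar>)) \<in> range (\<lambda>j. \<bar>\<xi> $ j\<bar>)"
        by (intro Max_in) auto
      then obtain i where "Max (range (\<lambda>j. \<bar>\<xi> $ j\<bar>)) = \<bar>\<xi> $ i\<bar>"
        by (rule imageE)
      then show ?thesis using that Max_ge[of "range (\<lambda>j. \<bar>\<xi> $ j\<bar>)"] by (auto simp del: Max_ge_iff)
    qed
    have "norm \<xi> \<le> (\<Sum>j\<in>UNIV. \<bar>\<xi> $ j\<bar>)" by (rule norm_le_l1_cart)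
    also have "\<dots> \<le> (\<Sum>j\<in>(UNIV::'n set). \<bar>\<xi> $ i\<bar>)" by (intro sum_mono i)
    finally have "norm \<xi> ^ k * norm (fourier \<phi> \<xi>) \<le> (CARD('n) * \<bar>\<xi> $ i\<bar>) ^ k * norm (fourier \<phi> \<xi>)"
      by (intro mult_right_mono power_mono) auto
    also have "\<dots> = CARD('n) ^ k * (\<bar>\<xi> $ i\<bar> ^ k * norm (fourier \<phi> \<xi>))"
      by (simp add: power_mult_distrib)
    \<comment> \<open>The index of the largest coordinate depends on the frequency, so the bound has
      to contain all the \<open>B i\<close>.\<close>
    also have "\<dots> \<le> CARD('n) ^ k * (\<Sum>i\<in>UNIV. B i)"
      using le[of \<xi> i] member_le_sum[of i UNIV B] by (intro mult_left_mono) (auto simp: B_def)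
    finally show "norm \<xi> ^ k * norm (fourier \<phi> \<xi>) \<le> CARD('n) ^ k * (\<Sum>i\<in>UNIV. B i)" .
  qed
qed

lemma fourier_integrable: "\<phi> \<in> test_functions \<Longrightarrow> integrable lborel (fourier \<phi>)"
  by (intro rapidly_decreasing_integrable fourier_rapidly_decreasing)


section \<open>Gaussians and the inversion formula\<close>

lemma integrable_pair_product:
  fixes f :: "'a::euclidean_space \<Rightarrow> complex" and g :: "'b::euclidean_space \<Rightarrow> complex"
  assumes f: "integrable lborel f" and g: "integrable lborel g"
  shows "integrable (lborel \<Otimes>\<^sub>M lborel) (\<lambda>(x, y). f x * g y)"
proof (rule integrableI_bounded)
  have [measurable]: "f \<in> borel_measurable borel" "g \<in> borel_measurable borel"
    using borel_measurable_integrable[OF f] borel_measurable_integrable[OF g] by simp_all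
  show "(\<lambda>(x, y). f x * g y) \<in> borel_measurable (lborel \<Otimes>\<^sub>M lborel)"
    by measurable
  have "(\<integral>\<^sup>+z. ennreal (norm (case z of (x, y) \<Rightarrow> f x * g y)) \<partial>(lborel \<Otimes>\<^sub>M lborel))
      = (\<integral>\<^sup>+x. \<integral>\<^sup>+y. ennreal (norm (f x)) * ennreal (norm (g y)) \<partial>lborel \<partial>lborel)"
    by (subst lborel.nn_integral_fst[symmetric]) (simp_all add: norm_mult ennreal_mult)
  also have "\<dots> = (\<integral>\<^sup>+x. ennreal (norm (f x)) \<partial>lborel) * (\<integral>\<^sup>+y. ennreal (norm (g y)) \<partial>lborel)"
    by (simp add: nn_integral_cmult nn_integral_multc)
  also have "\<dots> < \<infinity>"
    using f g by (simp add: integrable_iff_bounded ennreal_mult_less_top)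
  finally show "(\<integral>\<^sup>+z. ennreal (norm (case z of (x, y) \<Rightarrow> f x * g y)) \<partial>(lborel \<Otimes>\<^sub>M lborel)) < \<infinity>" .
qed

lemma
  fixes f :: "'a::euclidean_space \<Rightarrow> real \<Rightarrow> complex"
  assumes "\<And>b. b \<in> Basis \<Longrightarrow> integrable lborel (f b)"
  shows integrable_lborel_prod: "integrable lborel (\<lambda>x::'a. \<Prod>b\<in>Basis. f b (x \<bullet> b))"
    and integral_lborel_prod: "(\<integral>x. (\<Prod>b\<in>Basis. f b (x \<bullet> b)) \<partial>lborel) = (\<Prod>b\<in>Basis. \<integral>x. f b x \<partial>lborel)"
proof -
  interpret product_sigma_finite "\<lambda>_::'a. lborel :: real measure"
    by standard
  have [measurable]: "f b \<in> borel_measurable borel" if "b \<in> Basis" for b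
    using borel_measurable_integrable[OF assms[OF that]] by simp
  have eq: "(\<Prod>b\<in>Basis. f b ((\<Sum>b'\<in>Basis. x b' *\<^sub>R b') \<bullet> b)) = (\<Prod>b\<in>Basis. f b (x b))" for x :: "'a \<Rightarrow> real"
    by (intro prod.cong refl) (simp add: inner_sum_left inner_Basis if_distrib cong: if_cong)
  have [measurable]: "(\<lambda>x. \<Sum>b\<in>Basis. x b *\<^sub>R b) \<in> (\<Pi>\<^sub>M b\<in>(Basis::'a set). lborel) \<rightarrow>\<^sub>M (borel :: 'a measure)"
    by measurable
  have [measurable]: "(\<lambda>x::'a. \<Prod>b\<in>Basis. f b (x \<bullet> b)) \<in> borel_measurable borel"
    by measurable
  show "integrable lborel (\<lambda>x::'a. \<Prod>b\<in>Basis. f b (x \<bullet> b))"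
    unfolding lborel_eq[where 'a='a]
    by (subst integrable_distr_eq) (auto simp: eq intro!: product_integrable_prod assms)
  show "(\<integral>x. (\<Prod>b\<in>Basis. f b (x \<bullet> b)) \<partial>lborel) = (\<Prod>b\<in>Basis. \<integral>x. f b x \<partial>lborel)"
    unfolding lborel_eq[where 'a='a]
    by (subst integral_distr) (auto simp: eq intro!: product_integral_prod assms)
qed

lemma integrable_gauss_real: "c \<noteq> 0 \<Longrightarrow> integrable lborel (\<lambda>x::real. exp (- pi * (c * x)\<^sup>2))"
proof -
  assume "c \<noteq> 0"
  then have "integrable lborel (\<lambda>x. std_normal_density (0 + (sqrt (2 * pi) * c) * x))"
    by (intro lborel_integrable_real_affine) auto
  then have "integrable lborel (\<lambda>x. sqrt (2 * pi) * std_normal_density ((sqrt (2 * pi) * c) * x))"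
    by (intro integrable_mult_right) simp
  moreover have "sqrt (2 * pi) * std_normal_density ((sqrt (2 * pi) * c) * x) = exp (- pi * (c * x)\<^sup>2)" for x
    by (simp add: std_normal_density_def power_mult_distrib)
  ultimately show ?thesis by simp
qed

lemma integral_gauss_char_real:
  "(\<integral>x. exp (- 2 * complex_of_real pi * \<i> * complex_of_real (x * \<tau>)) * complex_of_real (exp (- pi * x\<^sup>2)) \<partial>lborel)
    = complex_of_real (exp (- pi * \<tau>\<^sup>2))"
proof -
  define s where "s = sqrt (2 * pi)"
  have s: "s > 0" "s * s = 2 * pi" by (auto simp: s_def)
  \<comment> \<open>The substitution x to s x with s^2 = 2 pi turns the standard normal density into
    exp (-pi x^2). This value of \<open>t\<close> then makes the phase -2 pi x \<tau> and the result
    exp (-pi \<tau>^2).\<close>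
  define t where "t = - s * \<tau>"
  have "complex_of_real (exp (- (t\<^sup>2) / 2)) = char std_normal_distribution t"
    by (simp add: char_std_normal_distribution)
  also have "\<dots> = (\<integral>x. std_normal_density x *\<^sub>R iexp (t * x) \<partial>lborel)"
    unfolding char_def by (rule integral_density) auto
  also have "\<dots> = \<bar>s\<bar> *\<^sub>R (\<integral>x. std_normal_density (0 + s * x) *\<^sub>R iexp (t * (0 + s * x)) \<partial>lborel)"
    using s by (intro lborel_integral_real_affine) auto
  also have "\<dots> = (\<integral>x. s *\<^sub>R (std_normal_density (s * x) *\<^sub>R iexp (t * (s * x))) \<partial>lborel)"
    using s by (simp only: scaleR_conv_of_real integral_mult_right_zero abs_of_pos add_0)
  also have "\<dots> = (\<integral>x. exp (- 2 * complex_of_real pi * \<i> * complex_of_real (x * \<tau>)) * complex_of_real (exp (- pi * x\<^sup>2)) \<partial>lborel)"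
  proof (rule Bochner_Integration.integral_cong[OF refl])
    fix x :: real
    have "s * std_normal_density (s * x) = exp (- pi * x\<^sup>2)"
      using s by (simp add: std_normal_density_def s_def[symmetric] power_mult_distrib power2_eq_square[of s])
    then have "complex_of_real s * complex_of_real (std_normal_density (s * x)) = complex_of_real (exp (- pi * x\<^sup>2))"
      by (simp only: of_real_mult[symmetric])
    moreover have "iexp (t * (s * x)) = exp (- 2 * complex_of_real pi * \<i> * complex_of_real (x * \<tau>))"
    proof -
      have "t * (s * x) = - (2 * pi) * (x * \<tau>)"
        using s(2) by (simp add: t_def)
      then show ?thesis by (simp add: mult_ac)
    qed
    ultimately show "s *\<^sub>R (std_normal_density (s * x) *\<^sub>R iexp (t * (s * x)))
        = exp (- 2 * complex_of_real pi * \<i> * complex_of_real (x * \<tau>)) * complex_of_real (exp (- pi * x\<^sup>2))"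
      by (simp only: scaleR_conv_of_real mult.assoc[symmetric]) (simp add: mult.commute)
  qed
  also have "- (t\<^sup>2) / 2 = - pi * \<tau>\<^sup>2"
    using s by (simp add: t_def power2_eq_square)
  finally show ?thesis by simp
qed

text \<open>The normalisation under which the Gaussian is its own Fourier transform for the kernel
  used here; in particular its integral is 1.\<close>

definition gaussian :: "'a::euclidean_space \<Rightarrow> complex" where
  "gaussian x = complex_of_real (exp (- pi * norm x ^ 2))"

lemma gaussian_prod: "gaussian x = (\<Prod>b\<in>Basis. complex_of_real (exp (- pi * (x \<bullet> b)\<^sup>2)))"
proof -
  have "norm x ^ 2 = (\<Sum>b\<in>Basis. (x \<bullet> b)\<^sup>2)"
    unfolding power2_norm_eq_inner by (subst euclidean_inner) (simp add: power2_eq_square)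
  then show ?thesis
    by (simp add: gaussian_def sum_distrib_left exp_sum sum_negf[symmetric] flip: of_real_prod)
qed

lemma gaussian_measurable [measurable]: "gaussian \<in> borel_measurable borel"
  unfolding gaussian_def[abs_def] by measurable

lemma norm_gaussian_le_1: "norm (gaussian x) \<le> 1"
  by (simp add: gaussian_def)

lemma integrable_gaussian:
  assumes "c \<noteq> 0"
  shows "integrable lborel (\<lambda>x. gaussian (c *\<^sub>R x))"
  unfolding gaussian_prod using integrable_lborel_prod[of "\<lambda>b x. complex_of_real (exp (- pi * (c * x)\<^sup>2))"] integrable_gauss_real[OF assms]
  by simp

lemma fourier_gaussian: "fourier gaussian \<xi> = gaussian \<xi>"
proof -
  let ?f = "\<lambda>b x. exp (- 2 * complex_of_real pi * \<i> * complex_of_real (x * (\<xi> \<bullet> b))) * complex_of_real (exp (- pi * x\<^sup>2))"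
  have int: "integrable lborel (?f b)" for b
  proof (rule Bochner_Integration.integrable_bound[OF integrable_gauss_real[of 1]])
    show "AE x in lborel. norm (?f b x) \<le> norm (exp (- pi * (1 * x)\<^sup>2))"
      by (simp add: norm_mult norm_exp_eq_Re)
  qed auto
  have "fourier_char \<xi> t = (\<Prod>b\<in>Basis. exp (- 2 * complex_of_real pi * \<i> * complex_of_real ((t \<bullet> b) * (\<xi> \<bullet> b))))" for t
    unfolding fourier_char_def euclidean_inner[of t \<xi>] of_real_sum sum_distrib_left by (rule exp_sum) simp
  then have "gaussian t * fourier_char \<xi> t = (\<Prod>b\<in>Basis. ?f b (t \<bullet> b))" for t
    by (simp only: gaussian_prod prod.distrib mult.commute)
  then have "fourier gaussian \<xi> = (\<Prod>b\<in>Basis. \<integral>x. ?f b x \<partial>lborel)"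
    unfolding fourier_eq using integral_lborel_prod[of ?f] int by simp
  then show ?thesis
    by (simp only: integral_gauss_char_real gaussian_prod)
qed

text \<open>Without damping the double integral is not absolutely convergent. With the Gaussian
  factor Fubini applies, and the frequency integral becomes an approximate identity of width
  \<epsilon>, scaled away in the last substitution.\<close>

lemma fourier_inversion_gaussian:
  fixes \<phi> :: "real^'n \<Rightarrow> complex"
  assumes \<phi>: "\<phi> \<in> test_functions" and "0 < \<epsilon>"
  shows "(\<integral>\<eta>. fourier \<phi> \<eta> * fourier_char (- \<eta>) t * gaussian (\<epsilon> *\<^sub>R \<eta>) \<partial>lborel)
    = (\<integral>x. \<phi> (t + \<epsilon> *\<^sub>R x) * gaussian x \<partial>lborel)"
proof -
  have [measurable]: "\<phi> \<in> borel_measurable borel"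
    by (intro smooth_fun_measurable test_functions_smooth \<phi>)
  let ?h = "\<lambda>\<eta> s. \<phi> s * fourier_char \<eta> s * fourier_char (- \<eta>) t * gaussian (\<epsilon> *\<^sub>R \<eta>)"
  have int: "integrable (lborel \<Otimes>\<^sub>M lborel) (case_prod ?h)"
  proof (rule Bochner_Integration.integrable_bound[OF integrable_pair_product[OF integrable_gaussian test_functions_integrable[OF \<phi>]]])
    show "\<epsilon> \<noteq> 0" using assms by simp
    show "AE z in lborel \<Otimes>\<^sub>M lborel. norm (case_prod ?h z) \<le> norm (case z of (x, y) \<Rightarrow> gaussian (\<epsilon> *\<^sub>R x) * \<phi> y)"
      by (rule AE_I2) (auto simp: norm_mult)
  qed measurable
  have "(\<integral>\<eta>. fourier \<phi> \<eta> * fourier_char (- \<eta>) t * gaussian (\<epsilon> *\<^sub>R \<eta>) \<partial>lborel) = (\<integral>\<eta>. \<integral>s. ?h \<eta> s \<partial>lborel \<partial>lborel)"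
    by (simp add: fourier_eq mult.assoc flip: integral_mult_left_zero)
  also have "\<dots> = (\<integral>s. \<integral>\<eta>. ?h \<eta> s \<partial>lborel \<partial>lborel)"
    using lborel_pair.Fubini_integral[OF int] by simp
  also have "\<dots> = (\<integral>s. \<phi> s * ((1 / \<epsilon>) ^ CARD('n) *\<^sub>R gaussian ((1 / \<epsilon>) *\<^sub>R (s - t))) \<partial>lborel)"
  proof (rule Bochner_Integration.integral_cong[OF refl])
    fix s
    have "(\<integral>\<eta>. ?h \<eta> s \<partial>lborel) = (\<integral>\<eta>. \<phi> s * (fourier_char \<eta> (s - t) * gaussian (\<epsilon> *\<^sub>R \<eta>)) \<partial>lborel)"
      by (simp add: fourier_char_minus fourier_char_add_right[symmetric] mult.assoc)
    also have "\<dots> = \<phi> s * (\<integral>\<eta>. fourier_char \<eta> (s - t) * gaussian (\<epsilon> *\<^sub>R \<eta>) \<partial>lborel)"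
      by simp
    also have "(\<integral>\<eta>. fourier_char \<eta> (s - t) * gaussian (\<epsilon> *\<^sub>R \<eta>) \<partial>lborel)
        = \<bar>1 / \<epsilon>\<bar> ^ DIM(real^'n) *\<^sub>R (\<integral>x. fourier_char (0 + (1 / \<epsilon>) *\<^sub>R x) (s - t) * gaussian (\<epsilon> *\<^sub>R (0 + (1 / \<epsilon>) *\<^sub>R x)) \<partial>lborel)"
      using \<open>0 < \<epsilon>\<close> by (intro lborel_integral_affine) auto
    also have "(\<integral>x. fourier_char (0 + (1 / \<epsilon>) *\<^sub>R x) (s - t) * gaussian (\<epsilon> *\<^sub>R (0 + (1 / \<epsilon>) *\<^sub>R x)) \<partial>lborel)
        = fourier gaussian ((1 / \<epsilon>) *\<^sub>R (s - t))"
      unfolding fourier_eq using \<open>0 < \<epsilon>\<close> by (simp add: fourier_char_def mult_ac inner_commute)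
    finally show "(\<integral>\<eta>. ?h \<eta> s \<partial>lborel) = \<phi> s * ((1 / \<epsilon>) ^ CARD('n) *\<^sub>R gaussian ((1 / \<epsilon>) *\<^sub>R (s - t)))"
      using \<open>0 < \<epsilon>\<close> by (simp add: fourier_gaussian)
  qed
  also have "\<dots> = \<bar>\<epsilon>\<bar> ^ DIM(real^'n) *\<^sub>R (\<integral>x. \<phi> (t + \<epsilon> *\<^sub>R x) * ((1 / \<epsilon>) ^ CARD('n) *\<^sub>R gaussian ((1 / \<epsilon>) *\<^sub>R ((t + \<epsilon> *\<^sub>R x) - t))) \<partial>lborel)"
    using \<open>0 < \<epsilon>\<close> by (intro lborel_integral_affine) auto
  also have "\<dots> = (\<integral>x. \<phi> (t + \<epsilon> *\<^sub>R x) * gaussian x \<partial>lborel)"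
    using \<open>0 < \<epsilon>\<close> by (simp add: power_one_over)
  finally show ?thesis .
qed

text \<open>Let the damping tend to 0 in the preceding identity. The left side converges because
  \<open>fourier \<phi>\<close> is integrable, the right side because \<phi> is bounded and
  continuous.\<close>

lemma fourier_inversion:
  fixes \<phi> :: "real^'n \<Rightarrow> complex"
  assumes \<phi>: "\<phi> \<in> test_functions"
  shows "\<phi> t = (\<integral>\<eta>. fourier \<phi> \<eta> * fourier_char (- \<eta>) t \<partial>lborel)"
proof (rule LIMSEQ_unique)
  let ?e = "\<lambda>k. inverse (real (Suc k))"
  have [measurable]: "\<phi> \<in> borel_measurable borel"
    by (intro smooth_fun_measurable test_functions_smooth \<phi>)
  note int = fourier_integrable[OF \<phi>]
  have [measurable]: "fourier \<phi> \<in> borel_measurable borel"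
    using borel_measurable_integrable[OF int] by simp
  have e0: "?e \<longlonglongrightarrow> 0" by (rule LIMSEQ_inverse_real_of_nat)
  have cont: "continuous_on UNIV \<phi>" "continuous_on UNIV (gaussian :: real^'n \<Rightarrow> complex)"
    by (intro smooth_fun_continuous test_functions_smooth \<phi>) (unfold gaussian_def[abs_def], intro continuous_intros)
  obtain B where B: "\<And>x. norm (\<phi> x) \<le> B"
    using test_functions_boundedE[OF \<phi>] by metis
  show "(\<lambda>k. \<integral>\<eta>. fourier \<phi> \<eta> * fourier_char (- \<eta>) t * gaussian (?e k *\<^sub>R \<eta>) \<partial>lborel)
      \<longlonglongrightarrow> (\<integral>\<eta>. fourier \<phi> \<eta> * fourier_char (- \<eta>) t \<partial>lborel)"
  proof (rule integral_dominated_convergence[OF _ _ integrable_norm[OF int]])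
    show "AE \<eta> in lborel. (\<lambda>k. fourier \<phi> \<eta> * fourier_char (- \<eta>) t * gaussian (?e k *\<^sub>R \<eta>)) \<longlonglongrightarrow> fourier \<phi> \<eta> * fourier_char (- \<eta>) t"
    proof (rule AE_I2)
      fix \<eta> :: "real^'n"
      have "(\<lambda>k. ?e k *\<^sub>R \<eta>) \<longlonglongrightarrow> 0 *\<^sub>R \<eta>"
        by (intro tendsto_intros e0)
      then have "(\<lambda>k. gaussian (?e k *\<^sub>R \<eta>)) \<longlonglongrightarrow> gaussian (0 *\<^sub>R \<eta>)"
        by (rule continuous_on_tendsto_compose[OF cont(2)]) auto
      then have "(\<lambda>k. fourier \<phi> \<eta> * fourier_char (- \<eta>) t * gaussian (?e k *\<^sub>R \<eta>)) \<longlonglongrightarrow> fourier \<phi> \<eta> * fourier_char (- \<eta>) t * gaussian (0 *\<^sub>R \<eta>)"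
        by (rule tendsto_mult_left)
      then show "(\<lambda>k. fourier \<phi> \<eta> * fourier_char (- \<eta>) t * gaussian (?e k *\<^sub>R \<eta>)) \<longlonglongrightarrow> fourier \<phi> \<eta> * fourier_char (- \<eta>) t"
        by (simp add: gaussian_def)
    qed
    show "AE \<eta> in lborel. norm (fourier \<phi> \<eta> * fourier_char (- \<eta>) t * gaussian (?e k *\<^sub>R \<eta>)) \<le> norm (fourier \<phi> \<eta>)" for k
    proof (rule AE_I2)
      fix \<eta> :: "real^'n"
      show "norm (fourier \<phi> \<eta> * fourier_char (- \<eta>) t * gaussian (?e k *\<^sub>R \<eta>)) \<le> norm (fourier \<phi> \<eta>)"
        using mult_left_mono[OF norm_gaussian_le_1[of "?e k *\<^sub>R \<eta>"], of "norm (fourier \<phi> \<eta>)"] by (simp add: norm_mult)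
    qed
  qed measurable
  have "(\<lambda>k. \<integral>x. \<phi> (t + ?e k *\<^sub>R x) * gaussian x \<partial>lborel) \<longlonglongrightarrow> (\<integral>x. \<phi> t * gaussian (x :: real^'n) \<partial>lborel)"
  proof (rule integral_dominated_convergence)
    show "integrable lborel (\<lambda>x::real^'n. B * norm (gaussian x))"
      using integrable_gaussian[of 1] by (intro integrable_mult_right integrable_norm) simp
    show "AE x in lborel. (\<lambda>k. \<phi> (t + ?e k *\<^sub>R x) * gaussian x) \<longlonglongrightarrow> \<phi> t * gaussian x"
    proof (rule AE_I2)
      fix x :: "real^'n"
      have "(\<lambda>k. t + ?e k *\<^sub>R x) \<longlonglongrightarrow> t + 0 *\<^sub>R x"
        by (intro tendsto_intros e0)
      then have "(\<lambda>k. \<phi> (t + ?e k *\<^sub>R x)) \<longlonglongrightarrow> \<phi> t"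
        by (intro continuous_on_tendsto_compose[OF cont(1)]) auto
      then show "(\<lambda>k. \<phi> (t + ?e k *\<^sub>R x) * gaussian x) \<longlonglongrightarrow> \<phi> t * gaussian x"
        by (rule tendsto_mult_right)
    qed
    show "AE x in lborel. norm (\<phi> (t + ?e k *\<^sub>R x) * gaussian x) \<le> B * norm (gaussian x)" for k
      using B by (intro AE_I2) (simp add: norm_mult mult_right_mono)
  qed measurable
  \<comment> \<open>The total mass of the Gaussian is the value of its Fourier transform at
    0.\<close>
  moreover have "(\<integral>x. gaussian x \<partial>(lborel :: (real^'n) measure)) = gaussian (0 :: real^'n)"
    using fourier_gaussian[of "0 :: real^'n"] by (simp add: fourier_eq)
  then have "(\<integral>x. \<phi> t * gaussian (x :: real^'n) \<partial>lborel) = \<phi> t"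
    by (simp add: gaussian_def)
  ultimately show "(\<lambda>k. \<integral>\<eta>. fourier \<phi> \<eta> * fourier_char (- \<eta>) t * gaussian (?e k *\<^sub>R \<eta>) \<partial>lborel) \<longlonglongrightarrow> \<phi> t"
    by (subst fourier_inversion_gaussian[OF \<phi>]) auto
qed


section \<open>Distributions given by functions\<close>

text \<open>Lebesgue differentiation: at almost every x the value of \<open>w\<close> is the limit
  of its averages over small cubes with corner x, and these averages are 0.\<close>

lemma set_integral_zero_imp_AE_zero:
  fixes w :: "'a::euclidean_space \<Rightarrow> complex"
  assumes int: "\<And>a b. set_integrable lborel (cbox a b) w"
    and zero: "\<And>a b. (\<integral>x\<in>cbox a b. w x \<partial>lborel) = 0"
  shows "AE x in lborel. w x = 0"
proof -
  have "w integrable_on cbox a b" "integral (cbox a b) w = 0" for a b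
    using set_borel_integral_eq_integral[OF int[of a b]] zero[of a b] by simp_all
  then have int': "\<And>a b. w integrable_on cbox a b" and zero': "\<And>a b. integral (cbox a b) w = 0"
    by auto
  obtain N where N: "negligible N" "\<And>x e. \<lbrakk>x \<notin> N; 0 < e\<rbrakk> \<Longrightarrow>
      \<exists>d>0. \<forall>h. 0 < h \<and> h < d \<longrightarrow> norm (integral (cbox x (x + h *\<^sub>R One)) w /\<^sub>R h ^ DIM('a) - w x) < e"
    using integrable_ccontinuous_explicit[OF int'] by blast
  have "w x = 0" if x: "x \<notin> N" for x
  proof (rule ccontr)
    assume "w x \<noteq> 0"
    then obtain d :: real where d: "d > 0" "\<forall>h>0. \<not> h < d"
      using N(2)[OF x, of "norm (w x)"] by (auto simp: zero')
    show False using d(1) d(2)[rule_format, of "d / 2"] by simp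
  qed
  moreover have "AE x in lebesgue. x \<notin> N"
    using N(1) by (intro AE_not_in) (simp add: negligible_iff_null_sets)
  ultimately have "AE x in lebesgue. w x = 0"
    by (auto elim!: eventually_mono)
  then show ?thesis by (simp add: AE_completion_iff)
qed

text \<open>Mollification: if \<open>w\<close> annihilates all translates and dilates of a test function \<open>\<rho>\<close> of
  integral \<open>1\<close>, then it annihilates their averages over a box, which converge to its indicator.\<close>

lemma AE_zero_of_annihilates_schwartz:
  fixes w \<rho> :: "real^'n \<Rightarrow> complex"
  assumes [measurable]: "w \<in> borel_measurable borel"
    and int_w: "\<And>\<phi>. \<phi> \<in> schwartz \<Longrightarrow> integrable lborel (\<lambda>x. w x * \<phi> x)"
    and ann: "\<And>\<phi>. \<phi> \<in> schwartz \<Longrightarrow> (\<integral>x. w x * \<phi> x \<partial>lborel) = 0"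
    and \<rho>: "\<rho> \<in> test_functions" and one: "(\<integral>x. \<rho> x \<partial>lborel) = 1"
  shows "AE x in lborel. w x = 0"
proof -
  have [measurable]: "cball c R \<in> sets borel" "cbox a b \<in> sets borel" for c a b :: "real^'n" and R
    by simp_all
  have \<rho>_int: "integrable lborel \<rho>" by (rule test_functions_integrable[OF \<rho>])
  have [measurable]: "\<rho> \<in> borel_measurable borel"
    by (intro smooth_fun_measurable test_functions_smooth \<rho>)
  have affine: "(\<lambda>x. \<rho> (d *\<^sub>R x + c)) \<in> test_functions" if "d \<noteq> 0" for d c
  proof -
    have "(1 / d) *\<^sub>R mat 1 ** d *\<^sub>R mat 1 = (mat 1 :: real^'n^'n)"
      using that by (simp add: scaleR_matrix_vector_assoc matrix_scalar_ac scalar_matrix_assoc)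
    from test_functions_affine[OF \<rho> this, of c] show ?thesis
      by (simp add: scaleR_matrix_vector_assoc[symmetric])
  qed
  \<comment> \<open>Local integrability is not assumed of \<open>w\<close>. Stretching \<rho> around
    a point \<open>c\<close> where it does not vanish keeps it above half of its modulus there on
    the whole ball, so \<open>w\<close> times a test function dominates \<open>w\<close> on the
    ball.\<close>
  have loc: "integrable lborel (\<lambda>x. w x * indicator (cball 0 R) x)" for R
  proof -
    obtain c where c: "\<rho> c \<noteq> 0"
    proof (rule ccontr)
      assume "\<not> thesis"
      then have "\<And>x. \<rho> x = 0" using that by blast
      then show False using one by simp
    qed
    have "isCont \<rho> c"
      using smooth_fun_continuous[OF test_functions_smooth[OF \<rho>], of UNIV] by (simp add: continuous_on_eq_continuous_at)
    then obtain r where r: "r > 0" "\<And>x. dist x c < r \<Longrightarrow> dist (\<rho> x) (\<rho> c) < norm (\<rho> c) / 2"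
      using c unfolding continuous_at_eps_delta by (metis half_gt_zero zero_less_norm_iff)
    \<comment> \<open>The radius \<open>R\<close> is arbitrary, possibly not positive;
      \<open>q\<close> is positive in all cases and bounds the norm on the ball.\<close>
    define q where "q = \<bar>R\<bar> + 1"
    have q: "q > 0" by (simp add: q_def)
    define d where "d = r / (2 * q)"
    have d: "d > 0" using r q by (simp add: d_def)
    have low: "norm (\<rho> c) / 2 \<le> norm (\<rho> (d *\<^sub>R x + c))" if "x \<in> cball 0 R" for x
    proof -
      have "d * norm x \<le> d * q" using that d by (intro mult_left_mono) (auto simp: q_def)
      also have "\<dots> = r / 2" using q by (simp add: d_def)
      also have "\<dots> < r" using r by simp
      finally have "dist (d *\<^sub>R x + c) c < r" using d by (simp add: dist_norm)
      from r(2)[OF this] have "norm (\<rho> c - \<rho> (d *\<^sub>R x + c)) < norm (\<rho> c) / 2"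
        by (simp add: dist_norm norm_minus_commute)
      then show ?thesis
        using norm_triangle_ineq2[of "\<rho> c" "\<rho> (d *\<^sub>R x + c)"] by linarith
    qed
    have "integrable lborel (\<lambda>x. w x * \<rho> (d *\<^sub>R x + c))"
      using d by (intro int_w test_functions_schwartz affine) simp
    then have "integrable lborel (\<lambda>x. (2 / norm (\<rho> c)) * norm (w x * \<rho> (d *\<^sub>R x + c)))"
      by (intro integrable_mult_right integrable_norm)
    then show ?thesis
    proof (rule Bochner_Integration.integrable_bound)
      show "AE x in lborel. norm (w x * indicator (cball 0 R) x) \<le> norm ((2 / norm (\<rho> c)) * norm (w x * \<rho> (d *\<^sub>R x + c)))"
      proof (rule AE_I2)
        fix x
        show "norm (w x * indicator (cball 0 R) x) \<le> norm ((2 / norm (\<rho> c)) * norm (w x * \<rho> (d *\<^sub>R x + c)))"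
        proof (cases "x \<in> cball 0 R")
          case True
          have "norm (w x) * (norm (\<rho> c) / 2) \<le> norm (w x) * norm (\<rho> (d *\<^sub>R x + c))"
            by (intro mult_left_mono low True) simp
          then show ?thesis using c True by (simp add: norm_mult field_simps)
        qed simp
      qed
    qed measurable
  qed
  have box: "set_integrable lborel (cbox a b) w" for a b
  proof -
    obtain R where R: "cbox a b \<subseteq> cball 0 R"
      using bounded_pos[THEN iffD1, OF bounded_cbox[of a b]] by (metis mem_cball_0 subsetI)
    show ?thesis
      unfolding set_integrable_def
    proof (rule Bochner_Integration.integrable_bound[OF loc[of R]])
      show "AE x in lborel. norm (indicator (cbox a b) x *\<^sub>R w x) \<le> norm (w x * indicator (cball 0 R) x)"
        by (rule AE_I2) (use subsetD[OF R] in \<open>auto simp: indicator_def\<close>)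
    qed measurable
  qed
  show ?thesis
  proof (rule set_integral_zero_imp_AE_zero[OF box])
    fix a b :: "real^'n"
    let ?e = "\<lambda>k. inverse (real (Suc k))"
    let ?Q = "\<lambda>x. indicator (cbox a b) x :: complex"
    obtain R where R: "\<And>x. x \<in> cbox a b \<Longrightarrow> norm x \<le> R" "R > 0"
      using bounded_pos[THEN iffD1, OF bounded_cbox[of a b]] by blast
    obtain S where S: "S > 0" "\<And>x. \<rho> x \<noteq> 0 \<Longrightarrow> norm x \<le> S"
      using test_functions_supportE[OF \<rho>] by metis
    obtain B where B: "B > 0" "\<And>x. norm (\<rho> x) \<le> B"
      using test_functions_boundedE[OF \<rho>] by metis
    \<comment> \<open>As all scales are at most 1, this one ball contains the supports of all
      mollified indicators and gives a common majorant.\<close>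
    define K where "K = cball (0::real^'n) (R + S)"
    define m where "m k x = (\<integral>s. \<rho> s * ?Q (x - ?e k *\<^sub>R s) \<partial>lborel)" for k x
    have e: "0 < ?e k" "?e k \<le> 1" for k by (auto simp: inverse_le_1_iff)
    have supp: "x \<in> K" if "\<rho> s \<noteq> 0" "x - ?e k *\<^sub>R s \<in> cbox a b" for x s k
    proof -
      have "norm x \<le> norm (x - ?e k *\<^sub>R s) + norm (?e k *\<^sub>R s)"
        by (metis add.commute diff_add_cancel norm_triangle_ineq)
      also have "norm (?e k *\<^sub>R s) \<le> 1 * norm s"
        unfolding norm_scaleR using e[of k] by (intro mult_right_mono) auto
      finally show ?thesis
        using R(1)[OF that(2)] S(2)[OF that(1)] by (simp add: K_def)
    qed
    have mollified: "(\<integral>x. w x * m k x \<partial>lborel) = 0" for k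
    proof -
      \<comment> \<open>Integrated in x first, \<open>?F\<close> gives 0 by the annihilation of
        \<rho> moved to y and shrunk. Integrated in y first, it gives \<open>m k x\<close> up to the
        volume factor of the scaling.\<close>
      let ?F = "\<lambda>y x. ?Q y * (w x * \<rho> ((1 / ?e k) *\<^sub>R (x - y)))"
      have int: "integrable (lborel \<Otimes>\<^sub>M lborel) (case_prod ?F)"
      proof (rule Bochner_Integration.integrable_bound)
        have "integrable lborel (\<lambda>x. complex_of_real (indicator (cbox a b) x))"
          by (intro integrable_of_real integrable_real_indicator) (use emeasure_lborel_cbox_finite[of a b] in simp_all)
        then have "integrable lborel ?Q"
          by (simp add: of_real_indicator)
        then show "integrable (lborel \<Otimes>\<^sub>M lborel) (\<lambda>(y, x). (complex_of_real B * ?Q y) * (w x * indicator K x))"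
          unfolding K_def by (intro integrable_pair_product integrable_mult_right loc)
        show "AE z in lborel \<Otimes>\<^sub>M lborel. norm (case_prod ?F z) \<le> norm (case z of (y, x) \<Rightarrow> (complex_of_real B * ?Q y) * (w x * indicator K x))"
        proof (rule AE_I2, clarify)
          fix y x
          show "norm (?F y x) \<le> norm ((complex_of_real B * ?Q y) * (w x * indicator K x))"
          proof (cases "y \<in> cbox a b \<and> \<rho> ((1 / ?e k) *\<^sub>R (x - y)) \<noteq> 0")
            case True
            have "x - ?e k *\<^sub>R ((1 / ?e k) *\<^sub>R (x - y)) = y"
              using e[of k] by simp
            then have "x \<in> K" using supp[of "(1 / ?e k) *\<^sub>R (x - y)" x k] True by simp
            moreover have "norm (w x) * norm (\<rho> ((1 / ?e k) *\<^sub>R (x - y))) \<le> norm (w x) * B"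
              by (intro mult_left_mono B) simp
            ultimately show ?thesis
              using True B(1) by (simp add: norm_mult mult_ac)
          qed auto
        qed
      qed measurable
      have inner: "(\<integral>x. ?F y x \<partial>lborel) = 0" for y
      proof -
        have "(\<lambda>x. \<rho> ((1 / ?e k) *\<^sub>R x + (- ((1 / ?e k) *\<^sub>R y)))) \<in> schwartz"
          using e[of k] by (intro test_functions_schwartz affine) auto
        then have "(\<integral>x. w x * \<rho> ((1 / ?e k) *\<^sub>R (x - y)) \<partial>lborel) = 0"
          using ann by (simp add: scaleR_diff_right)
        then show ?thesis by simp
      qed
      have "(\<integral>y. ?F y x \<partial>lborel) = complex_of_real (?e k ^ CARD('n)) * (w x * m k x)" for x
      proof -
        have "(\<integral>y. ?F y x \<partial>lborel) = \<bar>- ?e k\<bar> ^ DIM(real^'n) *\<^sub>R (\<integral>s. ?F (x + (- ?e k) *\<^sub>R s) x \<partial>lborel)"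
          using e[of k] by (intro lborel_integral_affine) auto
        also have "(\<lambda>s. ?F (x + (- ?e k) *\<^sub>R s) x) = (\<lambda>s. w x * (\<rho> s * ?Q (x - ?e k *\<^sub>R s)))"
          using e[of k] by (simp add: mult_ac)
        finally show ?thesis
          by (simp add: m_def scaleR_conv_of_real)
      qed
      then have "complex_of_real (?e k ^ CARD('n)) * (\<integral>x. w x * m k x \<partial>lborel) = (\<integral>x. \<integral>y. ?F y x \<partial>lborel \<partial>lborel)"
        by (simp only: integral_mult_right_zero)
      also have "\<dots> = (\<integral>y. \<integral>x. ?F y x \<partial>lborel \<partial>lborel)"
        using lborel_pair.Fubini_integral[OF int] by simp
      also have "\<dots> = 0" by (simp only: inner integral_zero)
      finally have "complex_of_real (?e k ^ CARD('n)) * (\<integral>x. w x * m k x \<partial>lborel) = 0" .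
      moreover have "complex_of_real (?e k ^ CARD('n)) \<noteq> 0"
        using e(1)[of k] by (simp only: of_real_eq_0_iff power_eq_0_iff) linarith
      ultimately show ?thesis by (simp only: mult_eq_0_iff) simp
    qed
    have m_meas [measurable]: "m k \<in> borel_measurable borel" for k
      unfolding m_def[abs_def] by measurable
    have "(\<lambda>k. \<integral>x. w x * m k x \<partial>lborel) \<longlonglongrightarrow> (\<integral>x. w x * ?Q x \<partial>lborel)"
    proof (rule integral_dominated_convergence)
      show "integrable lborel (\<lambda>x. norm (w x * indicator K x) * (\<integral>s. norm (\<rho> s) \<partial>lborel))"
        unfolding K_def by (intro integrable_mult_left integrable_norm loc)
      show "AE x in lborel. (\<lambda>k. w x * m k x) \<longlonglongrightarrow> w x * ?Q x"
      proof -
        \<comment> \<open>Off the boundary of the box the indicator is locally constant, so the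
          mollified indicators converge there; the boundary is a null set.\<close>
        have "AE x in lborel. x \<notin> cbox a b - box a b"
          by (intro AE_not_in null_sets_cbox_Diff_box)
        then show ?thesis
        proof eventually_elim
          case (elim x)
          have "(\<lambda>k. m k x) \<longlonglongrightarrow> (\<integral>s. \<rho> s * ?Q x \<partial>lborel)"
            unfolding m_def
          proof (rule integral_dominated_convergence[OF _ _ integrable_norm[OF \<rho>_int]])
            show "AE s in lborel. (\<lambda>k. \<rho> s * ?Q (x - ?e k *\<^sub>R s)) \<longlonglongrightarrow> \<rho> s * ?Q x"
            proof (rule AE_I2)
              fix s
              have "(\<lambda>k. x - ?e k *\<^sub>R s) \<longlonglongrightarrow> x - 0 *\<^sub>R s"
                by (intro tendsto_intros LIMSEQ_inverse_real_of_nat)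
              then have lim: "(\<lambda>k. x - ?e k *\<^sub>R s) \<longlonglongrightarrow> x" by simp
              have "x \<in> box a b \<or> x \<in> - cbox a b" using elim by auto
              then have "\<forall>\<^sub>F k in sequentially. ?Q (x - ?e k *\<^sub>R s) = ?Q x"
              proof
                assume x: "x \<in> box a b"
                have "\<forall>\<^sub>F k in sequentially. x - ?e k *\<^sub>R s \<in> box a b"
                  by (rule topological_tendstoD[OF lim open_box x])
                then show ?thesis
                  by eventually_elim (use x box_subset_cbox in \<open>auto simp: indicator_def subset_eq\<close>)
              next
                assume x: "x \<in> - cbox a b"
                have "\<forall>\<^sub>F k in sequentially. x - ?e k *\<^sub>R s \<in> - cbox a b"
                  by (rule topological_tendstoD[OF lim _ x]) (simp add: open_Compl closed_cbox)
                then show ?thesis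
                  by eventually_elim (use x in \<open>auto simp: indicator_def\<close>)
              qed
              then have "(\<lambda>k. ?Q (x - ?e k *\<^sub>R s)) \<longlonglongrightarrow> ?Q x"
                by (rule tendsto_eventually)
              then show "(\<lambda>k. \<rho> s * ?Q (x - ?e k *\<^sub>R s)) \<longlonglongrightarrow> \<rho> s * ?Q x"
                by (rule tendsto_mult_left)
            qed
            show "AE s in lborel. norm (\<rho> s * ?Q (x - ?e k *\<^sub>R s)) \<le> norm (\<rho> s)" for k
              by (rule AE_I2) (auto simp: indicator_def)
          qed measurable
          then have "(\<lambda>k. m k x) \<longlonglongrightarrow> ?Q x" using one by simp
          then show ?case by (rule tendsto_mult_left)
        qed
      qed
      show "AE x in lborel. norm (w x * m k x) \<le> norm (w x * indicator K x) * (\<integral>s. norm (\<rho> s) \<partial>lborel)" for k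
      proof (rule AE_I2)
        fix x
        show "norm (w x * m k x) \<le> norm (w x * indicator K x) * (\<integral>s. norm (\<rho> s) \<partial>lborel)"
        proof (cases "x \<in> K")
          case True
          have "norm (m k x) \<le> (\<integral>s. norm (\<rho> s * ?Q (x - ?e k *\<^sub>R s)) \<partial>lborel)"
            unfolding m_def by (rule integral_norm_bound)
          also have "\<dots> \<le> (\<integral>s. norm (\<rho> s) \<partial>lborel)"
            by (rule integral_mono_AE')
               (use \<rho>_int in \<open>auto simp: indicator_def\<close>)
          finally show ?thesis using True by (simp add: norm_mult mult_left_mono)
        next
          case False
          then have "\<rho> s * ?Q (x - ?e k *\<^sub>R s) = 0" for s
            using supp[of s x k] by (auto simp: indicator_def)
          then have "m k x = 0" by (simp only: m_def Bochner_Integration.integral_zero)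
          then show ?thesis by (simp add: False)
        qed
      qed
    qed measurable
    then have "(\<integral>x. w x * ?Q x \<partial>lborel) = 0"
      unfolding mollified by (simp add: LIMSEQ_const_iff)
    then show "(\<integral>x\<in>cbox a b. w x \<partial>lborel) = 0"
      by (simp add: set_lebesgue_integral_def scaleR_conv_of_real mult.commute of_real_indicator)
  qed
qed

text \<open>The mollifier \<rho> is left as a parameter, so that the squared modulus of the
  normalised window can be inserted for it later.\<close>

lemma represents_unique:
  fixes h h' \<rho> :: "real^'n \<Rightarrow> complex"
  assumes "represents h u" "represents h' u" "\<rho> \<in> test_functions" "(\<integral>x. \<rho> x \<partial>lborel) = 1"
  shows "AE x in lborel. h x = h' x"
proof -
  have "AE x in lborel. h x - h' x = 0"
  proof (rule AE_zero_of_annihilates_schwartz[OF _ _ _ assms(3,4)])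
    show "(\<lambda>x. h x - h' x) \<in> borel_measurable borel"
      using assms(1,2) by (auto simp: represents_def)
    fix \<phi> :: "real^'n \<Rightarrow> complex" assume \<phi>: "\<phi> \<in> schwartz"
    have *: "integrable lborel (\<lambda>x. h x * \<phi> x)" "integrable lborel (\<lambda>x. h' x * \<phi> x)"
      "(\<integral>x. h x * \<phi> x \<partial>lborel) = (\<integral>x. h' x * \<phi> x \<partial>lborel)"
      using assms(1,2) \<phi> by (auto simp: represents_def)
    then show "integrable lborel (\<lambda>x. (h x - h' x) * \<phi> x)" "(\<integral>x. (h x - h' x) * \<phi> x \<partial>lborel) = 0"
      by (simp_all add: left_diff_distrib)
  qed
  then show ?thesis by (auto elim!: eventually_mono)
qed

lemma distr_Lp_norm_eq:
  fixes h \<rho> :: "real^'n \<Rightarrow> complex"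
  assumes "1 \<le> p" "represents h u" "\<rho> \<in> test_functions" "(\<integral>x. \<rho> x \<partial>lborel) = 1"
  shows "distr_Lp_norm p u = Lp_norm p (\<lambda>x. ennreal (norm (h x)))"
  unfolding distr_Lp_norm_def
proof (rule antisym)
  show "(INF h\<in>{h. represents h u}. Lp_norm p (\<lambda>x. ennreal (norm (h x)))) \<le> Lp_norm p (\<lambda>x. ennreal (norm (h x)))"
    using assms(2) by (intro INF_lower) simp
  show "Lp_norm p (\<lambda>x. ennreal (norm (h x))) \<le> (INF h\<in>{h. represents h u}. Lp_norm p (\<lambda>x. ennreal (norm (h x))))"
  proof (rule INF_greatest)
    fix h' assume "h' \<in> {h. represents h u}"
    then have h': "represents h' u" by simp
    have [measurable]: "h \<in> borel_measurable borel" using assms(2) by (simp add: represents_def)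
    show "Lp_norm p (\<lambda>x. ennreal (norm (h x))) \<le> Lp_norm p (\<lambda>x. ennreal (norm (h' x)))"
      using represents_unique[OF assms(2) h' assms(3,4)]
      by (intro Lp_norm_mono assms(1)) (auto elim!: eventually_mono)
  qed
qed

lemma
  fixes A :: "real^'n^'n"
  assumes "invertible A"
  shows matrix_mul_inv_right: "A ** matrix_inv A = mat 1"
    and matrix_mul_inv_left: "matrix_inv A ** A = mat 1"
  using someI_ex[OF assms[unfolded invertible_def]] by (simp_all add: matrix_inv_def)

text \<open>Tested against \<phi>, the distribution is \<open>f\<close> at t to
  \<open>a (B t) * fourier \<phi> (B t)\<close>, where B is the inverse of \<open>A\<close>. Written
  out, the second factor makes this a superposition of characters with weight \<phi>; moving
  \<open>f\<close> inside the integral exhibits the representing function.\<close>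

lemma represents_fourier_dilate:
  fixes A :: "real^'n^'n"
  assumes f: "tempered_distr f" and a: "a \<in> test_functions" and A: "invertible A"
  shows "represents (\<lambda>\<xi>. complex_of_real (1 / \<bar>det A\<bar>) *
      f (\<lambda>t. a (matrix_inv A *v t) * fourier_char (transpose (matrix_inv A) *v \<xi>) t))
    (distr_fourier (distr_mult (distr_dilate A f) a))"
proof -
  define B where "B = matrix_inv A"
  have AB: "A ** B = mat 1" using A by (simp add: B_def matrix_mul_inv_right)
  define \<psi> where "\<psi> t = a (B *v t)" for t
  have \<psi>: "\<psi> \<in> test_functions"
    using test_functions_affine[OF a AB, of 0] by (simp add: \<psi>_def[abs_def])
  define G where "G = (\<lambda>z t. \<psi> (t - fst z) * fourier_char (snd z) t)"
  have G: "G \<in> tf_families" unfolding G_def by (rule tf_families.shift[OF \<psi>])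
  \<comment> \<open>There is no translation, and since (B t) . \<xi> = t . (B^T \<xi>) the character
    composed with B has frequency B^T \<xi>.\<close>
  define Z where "Z \<xi> = (0 :: real^'n, transpose B *v \<xi>)" for \<xi>
  have Z_meas: "Z \<in> borel_measurable borel"
    unfolding Z_def[abs_def] by (intro borel_measurable_continuous_onI continuous_intros linear_continuous_on) simp
  obtain K where K: "K > 0" "\<And>x. norm (transpose B *v x) \<le> norm x * K"
    using bounded_linear.pos_bounded[OF matrix_vector_mul_bounded_linear[of "transpose B"]] by metis
  have mom: "moments_integrable lborel \<phi> Z" if "\<phi> \<in> schwartz" for \<phi>
  proof (rule moments_integrable_bounded[OF rapidly_decreasing_moments[OF schwartz_rapidly_decreasing[OF that]]])
    show "Z \<in> borel_measurable lborel" using Z_meas by simp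
    show "0 \<le> 1 + K" using K(1) by simp
    show "1 + norm (Z x) \<le> (1 + K) * (1 + norm x)" for x
    proof -
      have "norm (Z x) = norm (transpose B *v x)" by (simp add: Z_def norm_Pair)
      moreover have "(1 + K) * (1 + norm x) = 1 + K + norm x + norm x * K"
        by (simp add: algebra_simps)
      ultimately show ?thesis using K(1) K(2)[of x] norm_ge_zero[of x] by linarith
    qed
  qed
  have sup: "superpose lborel \<phi> Z G t = a (B *v t) * fourier \<phi> (B *v t)" for \<phi> t
  proof -
    have "superpose lborel \<phi> Z G t = (\<integral>\<xi>. \<psi> t * (\<phi> \<xi> * fourier_char (B *v t) \<xi>) \<partial>lborel)"
      unfolding superpose_def
      by (intro Bochner_Integration.integral_cong refl)
         (simp add: Z_def G_def fourier_char_matrix[symmetric] fourier_char_commute[of "B *v t"] mult_ac del: transpose_matrix_vector)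
    then show ?thesis by (simp add: fourier_eq \<psi>_def)
  qed
  have eq: "G (Z \<xi>) = (\<lambda>t. a (B *v t) * fourier_char (transpose B *v \<xi>) t)" for \<xi>
    by (simp add: G_def Z_def \<psi>_def)
  let ?c = "complex_of_real (1 / \<bar>det A\<bar>)"
  have "represents (\<lambda>\<xi>. ?c * f (G (Z \<xi>))) (distr_fourier (distr_mult (distr_dilate A f) a))"
    unfolding represents_def
  proof (intro conjI ballI)
    have "(\<lambda>\<xi>. f (G (Z \<xi>))) \<in> borel_measurable borel"
      by (rule measurable_compose[OF Z_meas borel_measurable_continuous_onI[OF tempered_distr_continuous[OF f G]]])
    then show "(\<lambda>\<xi>. ?c * f (G (Z \<xi>))) \<in> borel_measurable lborel" by simp
    fix \<phi> :: "real^'n \<Rightarrow> complex" assume \<phi>: "\<phi> \<in> schwartz"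
    note * = tempered_distr_superpose[OF f G mom[OF \<phi>]]
    have "integrable lborel (\<lambda>\<xi>. ?c * (\<phi> \<xi> * f (G (Z \<xi>))))"
      by (intro integrable_mult_right *)
    then show "integrable lborel (\<lambda>\<xi>. ?c * f (G (Z \<xi>)) * \<phi> \<xi>)"
      by (simp add: mult_ac)
    have "distr_fourier (distr_mult (distr_dilate A f) a) \<phi> = ?c * f (superpose lborel \<phi> Z G)"
      by (simp add: distr_fourier_def distr_mult_def distr_dilate_def sup[abs_def] B_def[symmetric])
    also have "\<dots> = (\<integral>\<xi>. ?c * (\<phi> \<xi> * f (G (Z \<xi>))) \<partial>lborel)"
      unfolding * by (simp only: integral_mult_right_zero)
    finally show "distr_fourier (distr_mult (distr_dilate A f) a) \<phi> = (\<integral>\<xi>. ?c * f (G (Z \<xi>)) * \<phi> \<xi> \<partial>lborel)"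
      by (simp add: mult_ac)
  qed
  then show ?thesis by (simp add: eq B_def)
qed

lemma represents_fourier:
  assumes f: "tempered_distr f" and a: "a \<in> test_functions"
  shows "represents (\<lambda>\<xi>. f (\<lambda>t. a t * fourier_char \<xi> t)) (distr_fourier (distr_mult f a))"
proof -
  have inv1: "invertible (mat 1 :: real^'a^'a)"
    by (simp add: invertible_det_nz)
  have inv: "matrix_inv (mat 1 :: real^'a^'a) = mat 1"
    using matrix_mul_inv_left[of "mat 1 :: real^'a^'a"] by (simp add: inv1)
  then have "distr_dilate (mat 1) f = f"
    by (simp add: distr_dilate_def fun_eq_iff)
  then show ?thesis
    using represents_fourier_dilate[OF f a, of "mat 1"] by (simp add: inv inv1)
qed


section \<open>Change of window\<close>

text \<open>The short-time Fourier transform of \<open>f\<close>, with the window not conjugated to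
  match the bilinear pairing.\<close>

definition stft :: "'n::finite distr \<Rightarrow> (real^'n \<Rightarrow> complex) \<Rightarrow> real^'n \<Rightarrow> real^'n \<Rightarrow> complex" where
  "stft f g y \<xi> = f (\<lambda>t. g (t - y) * fourier_char \<xi> t)"

lemma stft_continuous:
  assumes "tempered_distr f" "g \<in> test_functions"
  shows "continuous_on UNIV (\<lambda>z. stft f g (fst z) (snd z))"
  unfolding stft_def using tempered_distr_continuous[OF assms(1) tf_families.shift[OF assms(2)]] by simp

lemma stft_measurable:
  assumes "tempered_distr f" "g \<in> test_functions"
    and [measurable]: "a \<in> borel_measurable M" "b \<in> borel_measurable M"
  shows "(\<lambda>x. stft f g (a x) (b x)) \<in> borel_measurable M"
proof -
  have "(\<lambda>z. stft f g (fst z) (snd z)) \<in> borel_measurable (borel \<Otimes>\<^sub>M borel)"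
    using borel_measurable_continuous_onI[OF stft_continuous[OF assms(1,2)]] by (simp add: borel_prod)
  moreover have "(\<lambda>x. (a x, b x)) \<in> M \<rightarrow>\<^sub>M borel \<Otimes>\<^sub>M borel" by measurable
  ultimately show ?thesis
    using measurable_compose[of "\<lambda>x. (a x, b x)" M "borel \<Otimes>\<^sub>M borel" "\<lambda>z. stft f g (fst z) (snd z)"] by simp
qed

lemma FLp_norm_stft:
  fixes g \<rho> :: "real^'n \<Rightarrow> complex"
  assumes "1 \<le> p" "tempered_distr f" "g \<in> test_functions" "\<rho> \<in> test_functions" "(\<integral>x. \<rho> x \<partial>lborel) = 1"
  shows "FLp_norm p (distr_mult f (translate y g)) = Lp_norm p (\<lambda>\<xi>. ennreal (norm (stft f g y \<xi>)))"
proof -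
  have "translate y g \<in> test_functions"
    using test_functions_translate[OF assms(3), of y] by (simp add: translate_def[abs_def])
  from distr_Lp_norm_eq[OF assms(1) represents_fourier[OF assms(2) this] assms(4,5)]
  show ?thesis by (simp add: FLp_norm_def stft_def translate_def)
qed

text \<open>As B t - x = B (t - A x), a window at x before dilation becomes the dilated window
  centred at A x.\<close>

lemma FLp_norm_dilate_stft:
  fixes A :: "real^'n^'n" and \<rho> :: "real^'n \<Rightarrow> complex"
  assumes "1 \<le> p" "tempered_distr f" "g \<in> test_functions" "\<rho> \<in> test_functions" "(\<integral>x. \<rho> x \<partial>lborel) = 1"
    and A: "invertible A"
  defines "B \<equiv> matrix_inv A"
  shows "FLp_norm p (distr_mult (distr_dilate A f) (translate x g)) =
    Lp_norm p (\<lambda>\<xi>. ennreal (norm (complex_of_real (1 / \<bar>det A\<bar>) * stft f (\<lambda>t. g (B *v t)) (A *v x) (transpose B *v \<xi>))))"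
proof -
  have tr: "translate x g \<in> test_functions"
    using test_functions_translate[OF assms(3), of x] by (simp add: translate_def[abs_def])
  have "B *v (A *v x) = x"
    using matrix_mul_inv_left[OF A] by (simp add: B_def matrix_vector_mul_assoc)
  then have "translate x g (B *v t) = g (B *v (t - A *v x))" for t
    by (simp add: translate_def matrix_vector_mult_diff_distrib)
  with distr_Lp_norm_eq[OF assms(1) represents_fourier_dilate[OF assms(2) tr A] assms(4,5)]
  show ?thesis by (simp add: FLp_norm_def stft_def B_def del: transpose_matrix_vector)
qed

lemma integral_pair_product:
  fixes f :: "'a::euclidean_space \<Rightarrow> complex" and g :: "'b::euclidean_space \<Rightarrow> complex"
  assumes "integrable lborel f" "integrable lborel g"
  shows "(\<integral>z. f (fst z) * g (snd z) \<partial>lborel) = (\<integral>x. f x \<partial>lborel) * (\<integral>y. g y \<partial>lborel)"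
proof -
  have "(\<integral>z. f (fst z) * g (snd z) \<partial>lborel) = (\<integral>z. (case z of (x, y) \<Rightarrow> f x * g y) \<partial>(lborel \<Otimes>\<^sub>M lborel))"
    by (simp add: lborel_prod case_prod_unfold)
  also have "\<dots> = (\<integral>x. \<integral>y. f x * g y \<partial>lborel \<partial>lborel)"
    using lborel_pair.integral_fst'[OF integrable_pair_product[OF assms]] by simp
  finally show ?thesis by simp
qed

lemma compact_linear_image_plus_ball:
  "compact {A *v u + v | u v. u \<in> cball 0 R \<and> v \<in> cball 0 R}"
  for A :: "real^'n^'n"
proof -
  have "compact ((\<lambda>z. A *v fst z + snd z) ` (cball 0 R \<times> cball 0 R))"
    by (intro compact_continuous_image continuous_intros compact_Times compact_cball
        linear_continuous_on_compose[OF continuous_on_fst[OF continuous_on_id]]) (simp_all add: matrix_vector_mul_linear)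
  also have "(\<lambda>z. A *v fst z + snd z) ` (cball 0 R \<times> cball 0 R) = {A *v u + v | u v. u \<in> cball 0 R \<and> v \<in> cball 0 R}"
    by force
  finally show ?thesis .
qed

text \<open>Insert \<open>1 = \<integral> \<bar>g (t - y)\<bar>\<^sup>2 dy\<close> and expand both \<open>cnj (g (t - y))\<close> and
  \<open>g (B t - x)\<close> by Fourier inversion. Only those \<open>y\<close> contribute for which the supports meet, that is
  \<open>y - A x \<in> A (cball 0 R) + cball 0 R\<close>.\<close>

lemma stft_dilated_window_le:
  fixes A B :: "real^'n^'n" and g :: "real^'n \<Rightarrow> complex"
  assumes f: "tempered_distr f" and g: "g \<in> test_functions" and one: "(\<integral>t. g t * cnj (g t) \<partial>lborel) = 1"
    and R: "\<And>t. g t \<noteq> 0 \<Longrightarrow> norm t \<le> R" and AB: "A ** B = mat 1" "B ** A = mat 1"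
  defines "Q \<equiv> {A *v u + v | u v. u \<in> cball 0 R \<and> v \<in> cball 0 R}"
  shows "ennreal (norm (stft f (\<lambda>t. g (B *v t)) (A *v x) \<zeta>))
    \<le> (\<integral>\<^sup>+m. indicator Q (fst m - A *v x) *
        (ennreal (norm (fourier g (fst (snd m))) * norm (fourier g (snd (snd m))))
          * ennreal (norm (stft f g (fst m) (\<zeta> + fst (snd m) - transpose B *v snd (snd m))))) \<partial>lborel)"
proof -
  let ?\<kappa> = "fourier g"
  have \<kappa>: "rapidly_decreasing ?\<kappa>" "integrable lborel ?\<kappa>"
    by (intro fourier_rapidly_decreasing fourier_integrable g)+
  have [measurable]: "g \<in> borel_measurable borel" "?\<kappa> \<in> borel_measurable borel"
    using \<kappa>(1) by (auto intro: smooth_fun_measurable test_functions_smooth g simp: rapidly_decreasing_def)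
  have [measurable]: "cnj \<in> borel_measurable borel"
    by (intro borel_measurable_continuous_onI continuous_intros)
  have Q: "compact Q" unfolding Q_def by (rule compact_linear_image_plus_ball)
  then have Qb [measurable]: "Q \<in> sets borel" by (rule borel_compact)
  define S where "S = (\<lambda>s. A *v x + s) ` Q"
  have S: "compact S" unfolding S_def by (intro compact_translation Q)
  then have Sb [measurable]: "S \<in> sets borel" by (rule borel_compact)
  have SQ: "y \<in> S \<longleftrightarrow> y - A *v x \<in> Q" for y
    by (auto simp: S_def image_iff) (metis add_diff_cancel_left' add.commute diff_add_cancel)
  \<comment> \<open>The parameter is m = (y, \<eta>, \<theta>): the averaging point, the frequency
    of the conjugated window at y and that of the dilated window. The indicator restricts y to a
    compact set, without which the weight would have no finite integral over y.\<close>
  define w where "w m = indicator S (fst m) * (cnj (?\<kappa> (fst (snd m))) * fourier_char (fst (snd m)) (- fst m)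
      * (?\<kappa> (snd (snd m)) * fourier_char (- snd (snd m)) (- x)))" for m :: "(real^'n) \<times> (real^'n) \<times> (real^'n)"
  \<comment> \<open>The window \<open>g (t - y)\<close> remains as the shift; the three characters
    in t combine to this single frequency.\<close>
  define Z where "Z m = (fst m, \<zeta> + fst (snd m) - transpose B *v snd (snd m))" for m :: "(real^'n) \<times> (real^'n) \<times> (real^'n)"
  let ?G = "\<lambda>z t. g (t - fst z) * fourier_char (snd z) t"
  have G: "?G \<in> tf_families" by (rule tf_families.shift[OF g])
  have w_meas: "w \<in> borel_measurable borel"
    unfolding w_def[abs_def] borel_prod[symmetric] by measurable
  have Z_meas: "Z \<in> borel_measurable borel"
    unfolding Z_def[abs_def] borel_prod[symmetric] using measurable_compose[OF _ measurable_matrix_mult]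
    by (intro measurable_Pair borel_measurable_diff borel_measurable_add) measurable
  have norm_w: "norm (w m) = indicator S (fst m) * (norm (?\<kappa> (fst (snd m))) * norm (?\<kappa> (snd (snd m))))" for m
    by (simp add: w_def norm_mult indicator_def)
  have mom: "moments_integrable lborel w Z"
    unfolding moments_integrable_def
  proof (intro conjI allI)
    show "w \<in> borel_measurable lborel" "Z \<in> borel_measurable lborel" using w_meas Z_meas by simp_all
    fix N
    obtain K where K: "K > 0" "\<And>x. norm (transpose B *v x) \<le> norm x * K"
      using bounded_linear.pos_bounded[OF matrix_vector_mul_bounded_linear[of "transpose B"]] by metis
    \<comment> \<open>The weight and the majorant of \<open>Z\<close> are split into a product over
      the three variables, so that integrability reduces to one variable at a time. The values are
      complex to fit \<open>integrable_pair_product\<close>.\<close>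
    define F where "F y = complex_of_real (indicator S y * (1 + norm y) ^ N)" for y :: "real^'n"
    define H where "H y = complex_of_real (norm (?\<kappa> y) * (1 + norm y) ^ N)" for y
    have "integrable lborel (\<lambda>y. indicator S y *\<^sub>R (1 + norm y) ^ N)"
      by (rule borel_integrable_compact[OF S]) (intro continuous_intros)
    then have F: "integrable lborel F"
      unfolding F_def[abs_def] by (intro integrable_of_real) simp
    have H: "integrable lborel H"
      unfolding H_def[abs_def] using rapidly_decreasing_moments[OF \<kappa>(1)]
      by (intro integrable_of_real) (simp add: moments_integrable_def)
    have HH: "integrable lborel (\<lambda>p. H (fst p) * H (snd p))"
      using integrable_pair_product[OF H H] by (simp add: lborel_prod case_prod_unfold)
    have "integrable lborel (\<lambda>m. ((1 + norm \<zeta>) * (1 + K)) ^ N * (F (fst m) * (H (fst (snd m)) * H (snd (snd m)))))"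
      using integrable_pair_product[OF F HH] by (intro integrable_mult_right) (simp add: lborel_prod case_prod_unfold)
    then show "integrable lborel (\<lambda>m. norm (w m) * (1 + norm (Z m)) ^ N)"
    proof (rule Bochner_Integration.integrable_bound)
      show "(\<lambda>m. norm (w m) * (1 + norm (Z m)) ^ N) \<in> borel_measurable lborel"
        using w_meas Z_meas by simp
      show "AE m in lborel. norm (norm (w m) * (1 + norm (Z m)) ^ N)
          \<le> norm (((1 + norm \<zeta>) * (1 + K)) ^ N * (F (fst m) * (H (fst (snd m)) * H (snd (snd m)))))"
      proof (rule AE_I2)
        fix m :: "(real^'n) \<times> (real^'n) \<times> (real^'n)"
        obtain y \<eta> \<theta> where m: "m = (y, \<eta>, \<theta>)" by (metis surj_pair)
        let ?a = "norm \<zeta>" and ?b = "norm y" and ?c = "norm \<eta>" and ?d = "norm \<theta>"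
        have "norm (Z m) \<le> norm y + norm (\<zeta> + \<eta> - transpose B *v \<theta>)"
          unfolding Z_def m by (simp only: fst_conv snd_conv norm_Pair sqrt_sum_squares_le_sum norm_ge_zero)
        also have "norm (\<zeta> + \<eta> - transpose B *v \<theta>) \<le> ?a + ?c + ?d * K"
          using K(2)[of \<theta>] norm_triangle_ineq4[of "\<zeta> + \<eta>" "transpose B *v \<theta>"] norm_triangle_ineq[of \<zeta> \<eta>] by linarith
        finally have "1 + norm (Z m) \<le> 1 + (?b + (?a + ?c + ?d * K))" by simp
        also have "\<dots> \<le> ((1 + ?a) * (1 + K)) * (1 + ?b) * (1 + ?c) * (1 + ?d)"
        proof -
          have "1 + (?b + (?a + ?c + ?d * K)) \<le> (1 + ?a) * (1 + ?b) * (1 + ?c) * (1 + ?d * K)"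
            using K(1) by (simp add: algebra_simps)
          also have "\<dots> \<le> (1 + ?a) * (1 + ?b) * (1 + ?c) * ((1 + K) * (1 + ?d))"
            using K(1) by (intro mult_left_mono) (auto simp: algebra_simps)
          finally show ?thesis by (simp only: mult_ac)
        qed
        finally have "(1 + norm (Z m)) ^ N \<le> (((1 + ?a) * (1 + K)) * (1 + ?b) * (1 + ?c) * (1 + ?d)) ^ N"
          by (intro power_mono) auto
        then have "norm (w m) * (1 + norm (Z m)) ^ N
            \<le> norm (w m) * (((1 + ?a) * (1 + K)) * (1 + ?b) * (1 + ?c) * (1 + ?d)) ^ N"
          by (intro mult_left_mono) auto
        also have "\<dots> = ((1 + norm \<zeta>) * (1 + K)) ^ N * ((indicator S y * (1 + norm y) ^ N)
            * ((norm (?\<kappa> \<eta>) * (1 + norm \<eta>) ^ N) * (norm (?\<kappa> \<theta>) * (1 + norm \<theta>) ^ N)))"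
          unfolding norm_w m fst_conv snd_conv power_mult_distrib by (simp only: mult_ac)
        also have "\<dots> = norm (((1 + norm \<zeta>) * (1 + K)) ^ N * (F (fst m) * (H (fst (snd m)) * H (snd (snd m)))))"
        proof -
          have "norm (complex_of_real (1 + K)) = 1 + K" "norm (complex_of_real (1 + norm \<zeta>)) = 1 + norm \<zeta>" for \<zeta> :: "real^'n"
            using K(1) norm_ge_zero[of \<zeta>] by (simp_all only: norm_of_real abs_of_nonneg)
          then show ?thesis
            unfolding m F_def H_def fst_conv snd_conv norm_mult norm_power norm_of_real
            by (simp add: abs_mult indicator_def)
        qed
        finally show "norm (norm (w m) * (1 + norm (Z m)) ^ N)
          \<le> norm (((1 + norm \<zeta>) * (1 + K)) ^ N * (F (fst m) * (H (fst (snd m)) * H (snd (snd m)))))"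
          by simp
      qed
    qed
  qed
  have sup: "superpose lborel w Z ?G t = g (B *v (t - A *v x)) * fourier_char \<zeta> t" for t
  proof -
    have Bx: "B *v (t - A *v x) = B *v t - x"
      using AB(2) by (simp add: matrix_vector_mult_diff_distrib matrix_vector_mul_assoc)
    have inv_cnj: "(\<integral>\<eta>. cnj (?\<kappa> \<eta>) * fourier_char \<eta> (t - y) \<partial>lborel) = cnj (g (t - y))" for y
    proof -
      have "cnj (g (t - y)) = (\<integral>\<eta>. cnj (?\<kappa> \<eta> * fourier_char (- \<eta>) (t - y)) \<partial>lborel)"
        by (subst fourier_inversion[OF g]) (rule Bochner_Integration.integral_cnj[symmetric])
      then show ?thesis by (simp add: cnj_fourier_char)
    qed
    have inv: "(\<integral>\<theta>. ?\<kappa> \<theta> * fourier_char (- \<theta>) (B *v t - x) \<partial>lborel) = g (B *v t - x)"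
      by (rule fourier_inversion[OF g, symmetric])
    have integrand: "w m * ?G (Z m) t = (indicator S (fst m) * g (t - fst m) * fourier_char \<zeta> t) *
        ((cnj (?\<kappa> (fst (snd m))) * fourier_char (fst (snd m)) (t - fst m)) *
         (?\<kappa> (snd (snd m)) * fourier_char (- snd (snd m)) (B *v t - x)))" for m
    proof -
      obtain y \<eta> \<theta> where m: "m = (y, \<eta>, \<theta>)" by (metis surj_pair)
      have "fourier_char (\<zeta> + \<eta> - transpose B *v \<theta>) t = fourier_char \<zeta> t * fourier_char \<eta> t * fourier_char (- \<theta>) (B *v t)"
      proof -
        have "fourier_char (- \<theta>) (B *v t) = fourier_char (- (transpose B *v \<theta>)) t"
        proof -
          have "B *v (- t) = - (B *v t)"
            using linear_neg[OF matrix_vector_mul_linear[of B], of t] by simp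
          then show ?thesis
            by (simp only: fourier_char_minus fourier_char_matrix[symmetric])
        qed
        then show ?thesis
          by (simp only: diff_conv_add_uminus fourier_char_add)
      qed
      moreover have "fourier_char \<eta> (t - y) = fourier_char \<eta> t * fourier_char \<eta> (- y)"
        "fourier_char (- \<theta>) (B *v t - x) = fourier_char (- \<theta>) (B *v t) * fourier_char (- \<theta>) (- x)"
        by (simp_all only: diff_conv_add_uminus fourier_char_add_right)
      ultimately show ?thesis
        unfolding m w_def Z_def fst_conv snd_conv by (simp only: mult_ac)
    qed
    have int: "integrable (lborel \<Otimes>\<^sub>M lborel) (\<lambda>m. w m * ?G (Z m) t)"
      using superpose_integrable[OF mom G, of t] by (simp add: lborel_prod)
    have "superpose lborel w Z ?G t = (\<integral>y. \<integral>p. w (y, p) * ?G (Z (y, p)) t \<partial>lborel \<partial>lborel)"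
      unfolding superpose_def using lborel_pair.integral_fst'[OF int] by (simp add: lborel_prod)
    also have "\<dots> = (\<integral>y. (indicator S y * g (t - y) * fourier_char \<zeta> t) * (cnj (g (t - y)) * g (B *v t - x)) \<partial>lborel)"
    proof (rule Bochner_Integration.integral_cong[OF refl])
      fix y
      have "(\<integral>p. (cnj (?\<kappa> (fst p)) * fourier_char (fst p) (t - y)) * (?\<kappa> (snd p) * fourier_char (- snd p) (B *v t - x)) \<partial>lborel)
          = cnj (g (t - y)) * g (B *v t - x)"
      proof -
        have "integrable lborel (\<lambda>\<eta>. cnj (?\<kappa> \<eta>) * fourier_char \<eta> (t - y))"
          by (rule Bochner_Integration.integrable_bound[OF \<kappa>(2)]) (auto simp: norm_mult)
        moreover have "integrable lborel (\<lambda>\<theta>. ?\<kappa> \<theta> * fourier_char (- \<theta>) (B *v t - x))"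
          by (rule Bochner_Integration.integrable_bound[OF \<kappa>(2)]) (auto simp: norm_mult)
        ultimately show ?thesis
          using integral_pair_product[of "\<lambda>\<eta>. cnj (?\<kappa> \<eta>) * fourier_char \<eta> (t - y)" "\<lambda>\<theta>. ?\<kappa> \<theta> * fourier_char (- \<theta>) (B *v t - x)"]
          by (simp only: inv inv_cnj)
      qed
      then show "(\<integral>p. w (y, p) * ?G (Z (y, p)) t \<partial>lborel)
          = (indicator S y * g (t - y) * fourier_char \<zeta> t) * (cnj (g (t - y)) * g (B *v t - x))"
        unfolding integrand fst_conv snd_conv by (simp only: integral_mult_right_zero)
    qed
    also have "\<dots> = (\<integral>y. (g (B *v t - x) * fourier_char \<zeta> t) * (g (t - y) * cnj (g (t - y))) \<partial>lborel)"
    proof (rule Bochner_Integration.integral_cong[OF refl])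
      fix y
      \<comment> \<open>If both windows are nonzero at t, then y - A x = A (B t - x) - (t - y) with
        both vectors in the ball, so the cut-off removes nothing from the integral over y.\<close>
      have "indicator S y = (1 :: complex)" if "g (B *v t - x) \<noteq> 0" "g (t - y) \<noteq> 0"
      proof -
        have "A *v (B *v t - x) = t - A *v x"
          using AB(1) by (simp add: matrix_vector_mult_diff_distrib matrix_vector_mul_assoc)
        then have "y - A *v x = A *v (B *v t - x) + (- (t - y))" by simp
        then have "y - A *v x \<in> Q"
          unfolding Q_def mem_Collect_eq using R[OF that(1)] R[OF that(2)]
          by (intro exI[of _ "B *v t - x"] exI[of _ "- (t - y)"] conjI) (simp_all add: norm_minus_commute)
        then show ?thesis by (simp add: SQ)
      qed
      then show "(indicator S y * g (t - y) * fourier_char \<zeta> t) * (cnj (g (t - y)) * g (B *v t - x))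
          = (g (B *v t - x) * fourier_char \<zeta> t) * (g (t - y) * cnj (g (t - y)))"
        by (cases "g (B *v t - x) = 0 \<or> g (t - y) = 0") auto
    qed
    also have "\<dots> = (g (B *v t - x) * fourier_char \<zeta> t) * (\<integral>y. g (t - y) * cnj (g (t - y)) \<partial>lborel)"
      by (simp only: integral_mult_right_zero)
    also have "(\<integral>y. g (t - y) * cnj (g (t - y)) \<partial>lborel) = 1"
      using lborel_integral_affine[of "-1" "\<lambda>t. g t * cnj (g t)" t] one by simp
    finally show ?thesis by (simp add: Bx)
  qed
  have "stft f (\<lambda>t. g (B *v t)) (A *v x) \<zeta> = f (superpose lborel w Z ?G)"
    by (simp add: stft_def sup[abs_def])
  also have "\<dots> = (\<integral>m. w m * f (?G (Z m)) \<partial>lborel)"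
    by (rule tempered_distr_superpose(2)[OF f G mom])
  finally have "ennreal (norm (stft f (\<lambda>t. g (B *v t)) (A *v x) \<zeta>)) \<le> (\<integral>\<^sup>+m. ennreal (norm (w m * f (?G (Z m)))) \<partial>lborel)"
    using integral_norm_bound_ennreal[OF tempered_distr_superpose(1)[OF f G mom]] by simp
  also have "\<dots> = (\<integral>\<^sup>+m. indicator Q (fst m - A *v x) *
        (ennreal (norm (fourier g (fst (snd m))) * norm (fourier g (snd (snd m))))
          * ennreal (norm (stft f g (fst m) (\<zeta> + fst (snd m) - transpose B *v snd (snd m))))) \<partial>lborel)"
  proof (rule nn_integral_cong)
    fix m
    have "f (?G (Z m)) = stft f g (fst m) (\<zeta> + fst (snd m) - transpose B *v snd (snd m))"
      by (simp add: stft_def Z_def del: transpose_matrix_vector)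
    then show "ennreal (norm (w m * f (?G (Z m)))) = indicator Q (fst m - A *v x) *
        (ennreal (norm (fourier g (fst (snd m))) * norm (fourier g (snd (snd m))))
          * ennreal (norm (stft f g (fst m) (\<zeta> + fst (snd m) - transpose B *v snd (snd m)))))"
      unfolding norm_mult[of "w m"] norm_w by (auto simp: indicator_def SQ ennreal_mult simp del: transpose_matrix_vector)
  qed
  finally show ?thesis .
qed


section \<open>Norm estimates for the dilated distribution\<close>

lemma amalgam_window_integral:
  assumes "amalgam_window g"
  shows "(\<integral>t. g t * cnj (g t) \<partial>lborel) = 1"
proof -
  have g: "g \<in> test_functions" and n: "Lp_norm 2 (\<lambda>t. ennreal (norm (g t))) = 1"
    using assms by (auto simp: amalgam_window_def)
  have [measurable]: "g \<in> borel_measurable borel"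
    by (intro smooth_fun_measurable test_functions_smooth g)
  have two: "enn2real 2 = 2"
    by (metis enn2real_ennreal ennreal_numeral zero_le_numeral)
  let ?I = "\<integral>\<^sup>+x. ennreal_powr (ennreal (norm (g x))) 2 \<partial>lborel"
  have "ennreal_powr ?I (1 / 2) = 1"
    using n by (simp add: Lp_norm_def two)
  then have "ennreal_powr (ennreal_powr ?I (1 / 2)) 2 = 1"
    using ennreal_powr_ennreal[of 1 2] by simp
  then have "?I = 1"
    by (subst (asm) ennreal_powr_inverse(2)) simp_all
  then have "(\<integral>\<^sup>+x. ennreal ((norm (g x))\<^sup>2) \<partial>lborel) = 1"
    by (simp add: powr_numeral)
  then have "(\<integral>x. (norm (g x))\<^sup>2 \<partial>lborel) = 1"
    by (subst integral_eq_nn_integral) auto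
  moreover have "(\<integral>t. g t * cnj (g t) \<partial>lborel) = complex_of_real (\<integral>x. (norm (g x))\<^sup>2 \<partial>lborel)"
    by (simp only: complex_norm_square[symmetric] integral_complex_of_real)
  ultimately show ?thesis by simp
qed

lemma Lp_norm_stft_measurable:
  assumes "tempered_distr f" "g \<in> test_functions"
  shows "(\<lambda>y. Lp_norm p (\<lambda>\<xi>. ennreal (norm (stft f g y \<xi>)))) \<in> borel_measurable borel"
proof (rule measurable_Lp_norm)
  have "(\<lambda>z. stft f g (fst z) (snd z)) \<in> borel_measurable (lborel \<Otimes>\<^sub>M lborel)"
    by (rule stft_measurable[OF assms]) measurable
  then show "(\<lambda>(y, \<xi>). ennreal (norm (stft f g y \<xi>))) \<in> borel_measurable (lborel \<Otimes>\<^sub>M lborel)"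
    by (simp add: case_prod_unfold)
qed

text \<open>By Minkowski the inner norm may be taken for each parameter separately. The frequency
  then enters through an affine map with linear part B^T; its translation is invisible to the norm
  and its determinant costs the power 1/p of |det A|. The two window frequencies therefore integrate
  out to the squared L1 norm of \<open>fourier g\<close>.\<close>

lemma Lp_norm_stft_dilated_window_le:
  fixes A B :: "real^'n^'n" and g :: "real^'n \<Rightarrow> complex"
  assumes p: "1 \<le> p" and f: "tempered_distr f" and g: "g \<in> test_functions" and one: "(\<integral>t. g t * cnj (g t) \<partial>lborel) = 1"
    and R: "\<And>t. g t \<noteq> 0 \<Longrightarrow> norm t \<le> R" and AB: "A ** B = mat 1" "B ** A = mat 1"
  defines "Q \<equiv> {A *v u + v | u v. u \<in> cball 0 R \<and> v \<in> cball 0 R}"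
  shows "Lp_norm p (\<lambda>\<xi>. ennreal (norm (stft f (\<lambda>t. g (B *v t)) (A *v x) (transpose B *v \<xi>))))
    \<le> ennreal (\<bar>det A\<bar> powr enn2real (1 / p) * (\<integral>\<eta>. norm (fourier g \<eta>) \<partial>lborel)\<^sup>2)
      * (\<integral>\<^sup>+s. indicator Q s * Lp_norm p (\<lambda>\<xi>. ennreal (norm (stft f g (A *v x + s) \<xi>))) \<partial>lborel)"
proof -
  let ?\<kappa> = "fourier g"
  let ?F = "\<lambda>y. Lp_norm p (\<lambda>\<xi>. ennreal (norm (stft f g y \<xi>)))"
  have \<kappa>: "integrable lborel ?\<kappa>" by (rule fourier_integrable[OF g])
  have [measurable]: "?\<kappa> \<in> borel_measurable borel"
    using borel_measurable_integrable[OF \<kappa>] by simp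
  have F [measurable]: "?F \<in> borel_measurable borel"
    by (rule Lp_norm_stft_measurable[OF f g])
  have Q [measurable]: "Q \<in> sets borel"
    unfolding Q_def by (intro borel_compact compact_linear_image_plus_ball)
  define \<psi> where "\<psi> t = g (B *v t)" for t
  have \<psi>: "\<psi> \<in> test_functions"
    using test_functions_affine[OF g AB(1), of 0] by (simp add: \<psi>_def[abs_def])
  have detB: "det (transpose B) = 1 / det A" and detA: "det A \<noteq> 0"
  proof -
    have "det A * det B = 1" using AB(1) by (metis det_I det_mul)
    then show "det (transpose B) = 1 / det A" "det A \<noteq> 0"
      by (auto simp: det_transpose eq_divide_eq mult.commute)
  qed
  define c where "c m = indicator Q (fst m - A *v x) * (ennreal (norm (?\<kappa> (fst (snd m)))) * ennreal (norm (?\<kappa> (snd (snd m)))))"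
    for m :: "(real^'n) \<times> (real^'n) \<times> (real^'n)"
  define H where "H m \<xi> = c m * ennreal (norm (stft f g (fst m) (transpose B *v \<xi> + (fst (snd m) - transpose B *v snd (snd m)))))"
    for m :: "(real^'n) \<times> (real^'n) \<times> (real^'n)" and \<xi>
  note mv = measurable_compose[OF _ measurable_matrix_mult]
  have c_meas: "c \<in> borel_measurable borel"
    unfolding c_def[abs_def] borel_prod[symmetric] by measurable
  have "(\<lambda>m :: (real^'n) \<times> (real^'n) \<times> (real^'n). ?F (fst m)) \<in> borel_measurable borel"
    by (rule measurable_compose[OF borel_measurable_continuous_onI F]) (intro continuous_intros)
  with c_meas have cF_meas: "(\<lambda>m. c m * ?F (fst m)) \<in> borel_measurable lborel"
    by (simp add: borel_measurable_times_ennreal)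
  have "(\<lambda>z. H (fst z) (snd z)) \<in> borel_measurable (lborel \<Otimes>\<^sub>M lborel)"
  proof -
    have 1: "(\<lambda>z. c (fst z)) \<in> borel_measurable (lborel \<Otimes>\<^sub>M lborel)"
      by (rule measurable_compose[OF _ c_meas]) simp
    have [measurable]: "fst \<in> borel_measurable (borel :: ((real^'n) \<times> (real^'n) \<times> (real^'n)) measure)"
      "(\<lambda>m. fst (snd m)) \<in> borel_measurable (borel :: ((real^'n) \<times> (real^'n) \<times> (real^'n)) measure)"
      "(\<lambda>m. snd (snd m)) \<in> borel_measurable (borel :: ((real^'n) \<times> (real^'n) \<times> (real^'n)) measure)"
      by (intro borel_measurable_continuous_onI continuous_intros)+
    have 2: "(\<lambda>z :: ((real^'n) \<times> (real^'n) \<times> (real^'n)) \<times> (real^'n). stft f g (fst (fst z))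
        (transpose B *v (snd z) + (fst (snd (fst z)) - transpose B *v snd (snd (fst z))))) \<in> borel_measurable (lborel \<Otimes>\<^sub>M lborel)"
      by (intro stft_measurable[OF f g] borel_measurable_add borel_measurable_diff mv) measurable
    from 1 2 show ?thesis
      unfolding H_def by measurable
  qed
  then have H_meas: "case_prod H \<in> borel_measurable (lborel \<Otimes>\<^sub>M lborel)"
    by (simp add: case_prod_unfold)
  have "Lp_norm p (\<lambda>\<xi>. ennreal (norm (stft f \<psi> (A *v x) (transpose B *v \<xi>)))) \<le> Lp_norm p (\<lambda>\<xi>. \<integral>\<^sup>+m. H m \<xi> \<partial>lborel)"
  proof (intro Lp_norm_mono p AE_I2)
    show "ennreal (norm (stft f \<psi> (A *v x) (transpose B *v \<xi>))) \<le> (\<integral>\<^sup>+m. H m \<xi> \<partial>lborel)" for \<xi>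
      using stft_dilated_window_le[OF f g one R AB, of x "transpose B *v \<xi>"]
      by (simp add: \<psi>_def[abs_def] H_def c_def Q_def ennreal_mult mult.assoc add_diff_eq del: transpose_matrix_vector)
    show "(\<lambda>\<xi>. ennreal (norm (stft f \<psi> (A *v x) (transpose B *v \<xi>)))) \<in> borel_measurable borel"
    proof -
      have "(\<lambda>\<xi>. stft f \<psi> (A *v x) (transpose B *v \<xi>)) \<in> borel_measurable borel"
        by (rule stft_measurable[OF f \<psi> borel_measurable_const]) (rule measurable_matrix_mult)
      then show ?thesis by simp
    qed
  qed
  also have "\<dots> \<le> (\<integral>\<^sup>+m. Lp_norm p (H m) \<partial>lborel)"
    by (rule Minkowski_nn_integral[OF p H_meas])
  also have "\<dots> \<le> (\<integral>\<^sup>+m. c m * (ennreal (\<bar>det A\<bar> powr enn2real (1 / p)) * ?F (fst m)) \<partial>lborel)"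
  proof (rule nn_integral_mono)
    fix m
    \<comment> \<open>The weight is finite, and \<open>Lp_norm_cmult\<close> takes real
      scalars.\<close>
    have "c m = ennreal (enn2real (c m))"
      unfolding c_def by (auto simp: indicator_def ennreal_mult[symmetric] simp del: ennreal_mult)
    then obtain c' where c': "c m = ennreal c'" "0 \<le> c'"
      using enn2real_nonneg by blast
    have st: "(\<lambda>\<xi>. ennreal (norm (stft f g (fst m) \<xi>))) \<in> borel_measurable borel"
    proof -
      have "(\<lambda>\<xi>. stft f g (fst m) \<xi>) \<in> borel_measurable borel"
        by (rule stft_measurable[OF f g borel_measurable_const]) simp
      then show ?thesis by simp
    qed
    have "Lp_norm p (H m) \<le> ennreal c' * Lp_norm p (\<lambda>\<xi>. ennreal (norm (stft f g (fst m) (transpose B *v \<xi> + (fst (snd m) - transpose B *v snd (snd m))))))"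
    proof -
      have "(\<lambda>\<xi>. stft f g (fst m) (transpose B *v \<xi> + (fst (snd m) - transpose B *v snd (snd m)))) \<in> borel_measurable borel"
        by (rule stft_measurable[OF f g borel_measurable_const]) (intro borel_measurable_add borel_measurable_const measurable_matrix_mult)
      then show ?thesis
        unfolding H_def c'(1) by (intro Lp_norm_cmult p c') simp
    qed
    also have "\<dots> \<le> ennreal c' * (ennreal (\<bar>det (transpose B)\<bar> powr (- enn2real (1 / p))) * ?F (fst m))"
      using detB detA by (intro mult_left_mono Lp_norm_affine p st) auto
    also have "\<bar>det (transpose B)\<bar> powr (- enn2real (1 / p)) = \<bar>det A\<bar> powr enn2real (1 / p)"
      using detA unfolding detB by (simp add: powr_minus powr_divide abs_divide)
    finally show "Lp_norm p (H m) \<le> c m * (ennreal (\<bar>det A\<bar> powr enn2real (1 / p)) * ?F (fst m))"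
      by (simp add: c')
  qed
  also have "\<dots> = ennreal (\<bar>det A\<bar> powr enn2real (1 / p)) * (\<integral>\<^sup>+m. c m * ?F (fst m) \<partial>lborel)"
    using cF_meas by (subst nn_integral_cmult[symmetric]) (simp_all add: mult_ac)
  also have "(\<integral>\<^sup>+m. c m * ?F (fst m) \<partial>lborel)
      = (\<integral>\<^sup>+y. indicator Q (y - A *v x) * ?F y * (ennreal (\<integral>\<eta>. norm (?\<kappa> \<eta>) \<partial>lborel) * ennreal (\<integral>\<eta>. norm (?\<kappa> \<eta>) \<partial>lborel)) \<partial>lborel)"
  proof -
    have k: "(\<integral>\<^sup>+\<eta>. ennreal (norm (?\<kappa> \<eta>)) \<partial>lborel) = ennreal (\<integral>\<eta>. norm (?\<kappa> \<eta>) \<partial>lborel)"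
      using \<kappa> by (intro nn_integral_eq_integral integrable_norm) auto
    have "(\<lambda>m. c m * ?F (fst m)) \<in> borel_measurable (lborel \<Otimes>\<^sub>M lborel)"
      using cF_meas by (simp add: lborel_prod)
    from lborel.nn_integral_fst[OF this]
    have "(\<integral>\<^sup>+m. c m * ?F (fst m) \<partial>lborel) = (\<integral>\<^sup>+y. \<integral>\<^sup>+p. c (y, p) * ?F y \<partial>lborel \<partial>lborel)"
      by (simp add: lborel_prod)
    also have "\<dots> = (\<integral>\<^sup>+y. indicator Q (y - A *v x) * ?F y * (ennreal (\<integral>\<eta>. norm (?\<kappa> \<eta>) \<partial>lborel) * ennreal (\<integral>\<eta>. norm (?\<kappa> \<eta>) \<partial>lborel)) \<partial>lborel)"
    proof (rule nn_integral_cong)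
      fix y
      have "(\<integral>\<^sup>+p. c (y, p) * ?F y \<partial>lborel)
          = (\<integral>\<^sup>+p. (indicator Q (y - A *v x) * ?F y) * (ennreal (norm (?\<kappa> (fst p))) * ennreal (norm (?\<kappa> (snd p)))) \<partial>(lborel \<Otimes>\<^sub>M lborel))"
        by (simp add: c_def mult_ac lborel_prod)
      also have "\<dots> = (indicator Q (y - A *v x) * ?F y) * (\<integral>\<^sup>+p. ennreal (norm (?\<kappa> (fst p))) * ennreal (norm (?\<kappa> (snd p))) \<partial>(lborel \<Otimes>\<^sub>M lborel))"
        by (rule nn_integral_cmult) measurable
      also have "(\<integral>\<^sup>+p. ennreal (norm (?\<kappa> (fst p))) * ennreal (norm (?\<kappa> (snd p))) \<partial>(lborel \<Otimes>\<^sub>M lborel))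
          = (\<integral>\<^sup>+\<eta>. \<integral>\<^sup>+\<theta>. ennreal (norm (?\<kappa> \<eta>)) * ennreal (norm (?\<kappa> \<theta>)) \<partial>lborel \<partial>lborel)"
        by (subst lborel.nn_integral_fst[symmetric]) simp_all
      also have "\<dots> = ennreal (\<integral>\<eta>. norm (?\<kappa> \<eta>) \<partial>lborel) * ennreal (\<integral>\<eta>. norm (?\<kappa> \<eta>) \<partial>lborel)"
        by (simp add: nn_integral_cmult nn_integral_multc k)
      finally show "(\<integral>\<^sup>+p. c (y, p) * ?F y \<partial>lborel)
          = indicator Q (y - A *v x) * ?F y * (ennreal (\<integral>\<eta>. norm (?\<kappa> \<eta>) \<partial>lborel) * ennreal (\<integral>\<eta>. norm (?\<kappa> \<eta>) \<partial>lborel))" .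
    qed
    finally show ?thesis .
  qed
  also have "\<dots> = (\<integral>\<^sup>+y. indicator Q (y - A *v x) * ?F y \<partial>lborel) * ennreal ((\<integral>\<eta>. norm (?\<kappa> \<eta>) \<partial>lborel)\<^sup>2)"
    by (subst nn_integral_multc) (simp_all add: ennreal_mult[symmetric] power2_eq_square)
  also have "(\<integral>\<^sup>+y. indicator Q (y - A *v x) * ?F y \<partial>lborel) = (\<integral>\<^sup>+s. indicator Q s * ?F (A *v x + s) \<partial>lborel)"
    by (subst lborel_distr_plus[of "A *v x", symmetric]) (simp add: nn_integral_distr)
  finally show ?thesis
    by (simp add: \<psi>_def[abs_def] ennreal_mult mult_ac)
qed

text \<open>The exponent of |det A| has three sources: -1 from the definition of the dilation, 1/p
  from the frequencies and -1/q from the positions x to A x + s.\<close>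

lemma amalgam_norm_dilate_le:
  fixes A :: "real^'n^'n" and g :: "real^'n \<Rightarrow> complex"
  assumes p: "1 \<le> p" and q: "1 \<le> q" and f: "tempered_distr f" and win: "amalgam_window g"
    and R: "\<And>t. g t \<noteq> 0 \<Longrightarrow> norm t \<le> R" and A: "invertible A"
  defines "Q \<equiv> {A *v u + v | u v. u \<in> cball 0 R \<and> v \<in> cball 0 R}"
  shows "amalgam_norm g p q (distr_dilate A f)
    \<le> ennreal ((\<integral>\<eta>. norm (fourier g \<eta>) \<partial>lborel)\<^sup>2 * \<bar>det A\<bar> powr (enn2real (1 / p) - enn2real (1 / q) - 1))
      * emeasure lborel Q * amalgam_norm g p q f"
proof -
  have g: "g \<in> test_functions" using win by (simp add: amalgam_window_def)
  have one: "(\<integral>t. g t * cnj (g t) \<partial>lborel) = 1" by (rule amalgam_window_integral[OF win])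
  \<comment> \<open>The normalisation of the window supplies the mollifier of integral 1 that
    identifies the norms of representing functions.\<close>
  have \<rho>: "(\<lambda>t. g t * cnj (g t)) \<in> test_functions"
    by (intro test_functions_mult g smooth_fun_cnj test_functions_smooth)
  define B where "B = matrix_inv A"
  have AB: "A ** B = mat 1" "B ** A = mat 1"
    using A by (simp_all add: B_def matrix_mul_inv_left matrix_mul_inv_right)
  have detA: "det A \<noteq> 0" using A by (simp add: invertible_det_nz)
  let ?F = "\<lambda>y. Lp_norm p (\<lambda>\<xi>. ennreal (norm (stft f g y \<xi>)))"
  let ?k = "(\<integral>\<eta>. norm (fourier g \<eta>) \<partial>lborel)\<^sup>2"
  have F [measurable]: "?F \<in> borel_measurable borel"
    by (rule Lp_norm_stft_measurable[OF f g])
  have Q [measurable]: "Q \<in> sets borel"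
    unfolding Q_def by (intro borel_compact compact_linear_image_plus_ball)
  have norm_f: "amalgam_norm g p q f = Lp_norm q ?F"
    unfolding amalgam_norm_def by (simp add: FLp_norm_stft[OF p f g \<rho> one])
  define \<psi> where "\<psi> t = g (B *v t)" for t
  have \<psi>: "\<psi> \<in> test_functions"
    using test_functions_affine[OF g AB(1), of 0] by (simp add: \<psi>_def[abs_def])
  note mv = measurable_compose[OF _ measurable_matrix_mult]
  let ?h = "\<lambda>x \<xi>. ennreal (norm (complex_of_real (1 / \<bar>det A\<bar>) * stft f \<psi> (A *v x) (transpose B *v \<xi>)))"
  let ?H = "\<lambda>s x. indicator Q s * ?F (A *v x + s)"
  let ?c = "\<bar>det A\<bar> powr (enn2real (1 / p) - 1) * ?k"
  have h: "FLp_norm p (distr_mult (distr_dilate A f) (translate x g)) = Lp_norm p (?h x)" for x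
    using FLp_norm_dilate_stft[OF p f g \<rho> one A, of x] by (simp only: B_def \<psi>_def[abs_def])
  have st: "(\<lambda>\<xi>. ennreal (norm (stft f \<psi> (A *v x) (transpose B *v \<xi>)))) \<in> borel_measurable borel" for x
  proof -
    have "(\<lambda>\<xi>. stft f \<psi> (A *v x) (transpose B *v \<xi>)) \<in> borel_measurable borel"
      by (rule stft_measurable[OF f \<psi> borel_measurable_const]) (rule measurable_matrix_mult)
    then show ?thesis by simp
  qed
  have pointwise: "Lp_norm p (?h x) \<le> ennreal ?c * (\<integral>\<^sup>+s. ?H s x \<partial>lborel)" for x
  proof -
    have "?h x \<xi> = ennreal (1 / \<bar>det A\<bar>) * ennreal (norm (stft f \<psi> (A *v x) (transpose B *v \<xi>)))" for \<xi>
      unfolding norm_mult norm_of_real by (subst ennreal_mult) (simp_all del: transpose_matrix_vector)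
    then have "Lp_norm p (?h x) \<le> ennreal (1 / \<bar>det A\<bar>) * Lp_norm p (\<lambda>\<xi>. ennreal (norm (stft f \<psi> (A *v x) (transpose B *v \<xi>))))"
      using Lp_norm_cmult[OF p _ st, of "1 / \<bar>det A\<bar>" x] by simp
    also have "\<dots> \<le> ennreal (1 / \<bar>det A\<bar>) * (ennreal (\<bar>det A\<bar> powr enn2real (1 / p) * ?k) * (\<integral>\<^sup>+s. ?H s x \<partial>lborel))"
      unfolding \<psi>_def[abs_def] Q_def by (intro mult_left_mono Lp_norm_stft_dilated_window_le p f g one R AB) auto
    also have "\<dots> = ennreal ?c * (\<integral>\<^sup>+s. ?H s x \<partial>lborel)"
      using detA by (simp add: ennreal_mult'[symmetric] mult.assoc[symmetric] powr_diff)
    finally show ?thesis .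
  qed
  have H_meas: "case_prod ?H \<in> borel_measurable (lborel \<Otimes>\<^sub>M lborel)"
  proof -
    have "(\<lambda>z. A *v snd z + fst z) \<in> borel_measurable (lborel \<Otimes>\<^sub>M lborel)"
      by (intro borel_measurable_add mv) measurable
    from measurable_compose[OF this F] show ?thesis
      unfolding case_prod_unfold by measurable
  qed
  have inner_meas: "(\<lambda>x. \<integral>\<^sup>+s. ?H s x \<partial>lborel) \<in> borel_measurable borel"
  proof -
    have "(\<lambda>z. A *v fst z + snd z) \<in> borel_measurable (borel \<Otimes>\<^sub>M lborel)"
      by (intro borel_measurable_add mv) measurable
    from measurable_compose[OF this F] show ?thesis
      by (intro lborel.borel_measurable_nn_integral) (simp add: case_prod_unfold)
  qed
  have lhs_meas: "(\<lambda>x. Lp_norm p (?h x)) \<in> borel_measurable borel"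
  proof (rule measurable_Lp_norm)
    have "(\<lambda>z. stft f \<psi> (A *v fst z) (transpose B *v snd z)) \<in> borel_measurable (lborel \<Otimes>\<^sub>M lborel)"
      by (intro stft_measurable[OF f \<psi>] mv) measurable
    then have "(\<lambda>z. complex_of_real (1 / \<bar>det A\<bar>) * stft f \<psi> (A *v fst z) (transpose B *v snd z)) \<in> borel_measurable (lborel \<Otimes>\<^sub>M lborel)"
      by (intro borel_measurable_times borel_measurable_const)
    then show "case_prod ?h \<in> borel_measurable (lborel \<Otimes>\<^sub>M lborel)"
      unfolding case_prod_unfold by measurable
  qed
  have "amalgam_norm g p q (distr_dilate A f) = Lp_norm q (\<lambda>x. Lp_norm p (?h x))"
    unfolding amalgam_norm_def h ..
  also have "\<dots> \<le> Lp_norm q (\<lambda>x. ennreal ?c * (\<integral>\<^sup>+s. ?H s x \<partial>lborel))"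
    by (intro Lp_norm_mono q AE_I2 pointwise lhs_meas)
  also have "\<dots> \<le> ennreal ?c * Lp_norm q (\<lambda>x. \<integral>\<^sup>+s. ?H s x \<partial>lborel)"
    by (intro Lp_norm_cmult q inner_meas) auto
  \<comment> \<open>The second use of Minkowski, in the outer norm. It is available because the
    variable s = y - A x ranges over a set \<open>Q\<close> that does not depend on x.\<close>
  also have "\<dots> \<le> ennreal ?c * (\<integral>\<^sup>+s. Lp_norm q (?H s) \<partial>lborel)"
    by (intro mult_left_mono Minkowski_nn_integral q H_meas) auto
  also have "\<dots> \<le> ennreal ?c * (\<integral>\<^sup>+s. ennreal (\<bar>det A\<bar> powr (- enn2real (1 / q))) * Lp_norm q ?F * indicator Q s \<partial>lborel)"
  proof (intro mult_left_mono nn_integral_mono)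
    fix s
    have Fs: "(\<lambda>x. ?F (A *v x + s)) \<in> borel_measurable borel"
      by (rule measurable_compose[OF _ F]) (intro borel_measurable_add mv, measurable)
    have "Lp_norm q (?H s) \<le> indicator Q s * Lp_norm q (\<lambda>x. ?F (A *v x + s))"
      using Lp_norm_cmult[OF q _ Fs, of "indicator Q s"] by (simp add: ennreal_indicator)
    also have "\<dots> \<le> indicator Q s * (ennreal (\<bar>det A\<bar> powr (- enn2real (1 / q))) * Lp_norm q ?F)"
      by (intro mult_left_mono Lp_norm_affine q detA F) auto
    finally show "Lp_norm q (?H s) \<le> ennreal (\<bar>det A\<bar> powr (- enn2real (1 / q))) * Lp_norm q ?F * indicator Q s"
      by (simp add: mult_ac)
  qed auto
  also have "\<dots> = ennreal ?c * (ennreal (\<bar>det A\<bar> powr (- enn2real (1 / q))) * Lp_norm q ?F * emeasure lborel Q)"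
    by (simp add: nn_integral_cmult_indicator)
  also have "\<dots> = ennreal (?c * \<bar>det A\<bar> powr (- enn2real (1 / q))) * emeasure lborel Q * Lp_norm q ?F"
    by (simp add: ennreal_mult mult_ac)
  also have "?c * \<bar>det A\<bar> powr (- enn2real (1 / q)) = ?k * \<bar>det A\<bar> powr (enn2real (1 / p) - enn2real (1 / q) - 1)"
  proof -
    have "\<bar>det A\<bar> powr (enn2real (1 / p) - 1) * \<bar>det A\<bar> powr (- enn2real (1 / q)) = \<bar>det A\<bar> powr (enn2real (1 / p) - enn2real (1 / q) - 1)"
      unfolding powr_add[symmetric] by (simp add: algebra_simps)
    then show ?thesis by (simp add: mult_ac)
  qed
  finally show ?thesis by (simp only: norm_f)
qed

theorem corollary3p2:
  fixes g :: "real^'n \<Rightarrow> complex" and p q :: ennreal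
  assumes "amalgam_window g" and "1 \<le> p" and "1 \<le> q"
  shows "\<exists>C::real. C > 0 \<and>
    (\<forall>A :: real^'n^'n. invertible A \<longrightarrow>
      (\<forall>f \<in> amalgam_space g p q.
        amalgam_norm g p q (distr_dilate A f) \<le>
          ennreal (C * \<bar>det A\<bar> powr (enn2real (1 / p) - enn2real (1 / q) - 1)
                     * sqrt (det (mat 1 + transpose A ** A)))
          * amalgam_norm g p q f))"
proof -
  have g: "g \<in> test_functions" using assms(1) by (simp add: amalgam_window_def)
  obtain R where R: "R > 0" "\<And>t. g t \<noteq> 0 \<Longrightarrow> norm t \<le> R"
    using test_functions_supportE[OF g] by metis
  let ?k = "(\<integral>\<eta>. norm (fourier g \<eta>) \<partial>lborel)\<^sup>2"
  \<comment> \<open>The first summand collects the squared L1 norm of \<open>fourier g\<close> and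
    the volume of the cube of side 4 CARD('n) R. The added 1 ensures positivity.\<close>
  define C where "C = ?k * (4 * CARD('n) * R) ^ CARD('n) + 1"
  have "C > 0" using R by (auto simp: C_def intro!: add_nonneg_pos)
  moreover have "amalgam_norm g p q (distr_dilate A f) \<le>
      ennreal (C * \<bar>det A\<bar> powr (enn2real (1 / p) - enn2real (1 / q) - 1) * sqrt (det (mat 1 + transpose A ** A))) * amalgam_norm g p q f"
    if A: "invertible A" and f: "f \<in> amalgam_space g p q" for A f
  proof -
    let ?d = "\<bar>det A\<bar> powr (enn2real (1 / p) - enn2real (1 / q) - 1)"
    let ?s = "sqrt (det (mat 1 + transpose A ** A))"
    have s: "0 \<le> ?s"
      using det_gram_pos[of "transpose A"] by simp
    have "amalgam_norm g p q (distr_dilate A f)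
        \<le> ennreal (?k * ?d) * emeasure lborel {A *v u + v | u v. u \<in> cball 0 R \<and> v \<in> cball 0 R} * amalgam_norm g p q f"
      using f by (intro amalgam_norm_dilate_le assms R A) (auto simp: amalgam_space_def)
    also have "\<dots> \<le> ennreal (?k * ?d) * ennreal ((4 * CARD('n) * R) ^ CARD('n) * ?s) * amalgam_norm g p q f"
      using R(1) by (intro mult_right_mono mult_left_mono emeasure_linear_image_plus_ball A) auto
    also have "ennreal (?k * ?d) * ennreal ((4 * CARD('n) * R) ^ CARD('n) * ?s) = ennreal ((?k * (4 * CARD('n) * R) ^ CARD('n)) * ?d * ?s)"
      by (subst ennreal_mult'[symmetric]) (simp_all add: mult_ac)
    also have "ennreal ((?k * (4 * CARD('n) * R) ^ CARD('n)) * ?d * ?s) \<le> ennreal (C * ?d * ?s)"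
      using s by (intro ennreal_leI mult_right_mono) (auto simp: C_def)
    finally show ?thesis by (simp add: mult_right_mono)
  qed
  ultimately show ?thesis by blast
qed

end
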